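(* If $S$ is any analytic quasi-order on ${}^{\mathbb Q}\omega$ such that ${\le^{=}_{dop}}\subseteq S\subseteq{\le^{\ge}_{dop}}$, then the pair $(S,\cong_{dop})$ is invariantly universal. In particular $(\le^{=}_{dop},\cong_{dop})$ and $(\le^{\ge}_{dop},\cong_{dop})$ are invariantly universal.
   Context: A function $g\colon\mathbb Q\to\mathbb Q$ is dense order preserving if it is strictly increasing and for all $q_0,q_1,r_0,r_1\in\mathbb Q$ with $g(q_0)<r_0<r_1<g(q_1)$ there is $q\in\mathbb Q$ with $r_0<g(q)<r_1$. For a quasi-order $R$ on a countable set $C$, $\le^R_{dop}$ is the quasi-order on ${}^{\mathbb Q}C$ with $c\le^R_{dop}c'$ iff there is a dense order preserving $g$ with $c(q)\,R\,c'(g(q))$ for all $q$; $\le^=_{dop}$ and $\le^\ge_{dop}$ are the cases $C=\omega$ with $R$ equality, resp. $\ge$. $c\cong_{dop}c'$ iff there is an order automorphism $h$ of $\mathbb Q$ with $c(q)=c'(h(q))$ for all $q$. Borel reducibility: for binary relations $R,R'$ on standard Borel spaces $X,X'$, a Borel $h\colon X\to X'$ with $x\,R\,y \iff h(x)\,R'\,h(y)$ is a Borel reduction, written $R\le_B R'$; $R\sim_B R'$ means $R\le_B R'\le_B R$. For an analytic quasi-order $S$ on a standard Borel space $X$ and an analytic equivalence relation $E\subseteq S\cap S^{-1}$ on $X$, the pair $(S,E)$ is invariantly universal if for every analytic quasi-order $R$ on a standard Borel space there is a Borel $E$-invariant $B\subseteq X$ with $R\sim_B S\restriction B$. *)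

theory Defs
  imports "HOL-Analysis.Analysis"
begin

text \<open>
  Measurable spaces are represented by the type \<^typ>\<open>'a measure\<close>; only the carrier and the
  sigma-algebra are ever used, the measure itself is irrelevant.
\<close>

definition standard_borel :: "'a measure \<Rightarrow> bool" where
  "standard_borel M \<longleftrightarrow>
     (\<exists>T. topspace T = space M \<and> completely_metrizable_space T \<and> second_countable T \<and>
          sets M = sigma_sets (space M) {U. openin T U})"

text \<open>
  Analytic means: projection of a Borel subset of the product with the Baire space.
\<close>

definition analytic_in :: "'a measure \<Rightarrow> 'a set \<Rightarrow> bool" where
  "analytic_in M A \<longleftrightarrow>
     (\<exists>D \<in> sets (M \<Otimes>\<^sub>M (borel :: (nat \<Rightarrow> nat) measure)). A = fst ` D)"

definition analytic_quasi_order :: "'a measure \<Rightarrow> 'a rel \<Rightarrow> bool" where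
  "analytic_quasi_order M R \<longleftrightarrow>
     standard_borel M \<and> preorder_on (space M) R \<and> analytic_in (M \<Otimes>\<^sub>M M) R"

definition analytic_equivalence :: "'a measure \<Rightarrow> 'a rel \<Rightarrow> bool" where
  "analytic_equivalence M E \<longleftrightarrow>
     standard_borel M \<and> equiv (space M) E \<and> analytic_in (M \<Otimes>\<^sub>M M) E"

definition borel_reducible :: "'a measure \<Rightarrow> 'a rel \<Rightarrow> 'b measure \<Rightarrow> 'b rel \<Rightarrow> bool" where
  "borel_reducible M R N R' \<longleftrightarrow>
     (\<exists>h \<in> measurable M N. \<forall>x\<in>space M. \<forall>y\<in>space M. (x, y) \<in> R \<longleftrightarrow> (h x, h y) \<in> R')"

definition borel_bireducible :: "'a measure \<Rightarrow> 'a rel \<Rightarrow> 'b measure \<Rightarrow> 'b rel \<Rightarrow> bool" where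
  "borel_bireducible M R N R' \<longleftrightarrow> borel_reducible M R N R' \<and> borel_reducible N R' M R"

definition invariant_set :: "'a rel \<Rightarrow> 'a set \<Rightarrow> bool" where
  "invariant_set E B \<longleftrightarrow> (\<forall>x y. x \<in> B \<longrightarrow> (x, y) \<in> E \<longrightarrow> y \<in> B)"

text \<open>
  A definition cannot quantify over types, so the type carrying the arbitrary quasi-order \<open>R\<close> is
  a parameter; a statement in which that type is a type variable speaks about all standard
  Borel spaces.  The standing requirements on the pair \<open>(S, E)\<close> are part of the definition.
\<close>

definition invariantly_universal :: "'b itself \<Rightarrow> 'a measure \<Rightarrow> 'a rel \<Rightarrow> 'a rel \<Rightarrow> bool" where
  "invariantly_universal (_ :: 'b itself) M S E \<longleftrightarrow>
     analytic_quasi_order M S \<and> analytic_equivalence M E \<and> E \<subseteq> S \<inter> S\<inverse> \<and>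
     (\<forall>(N :: 'b measure) R. analytic_quasi_order N R \<longrightarrow>
        (\<exists>B \<in> sets M. invariant_set E B \<and>
           borel_bireducible N R (restrict_space M B) (S \<inter> B \<times> B)))"

definition dense_order_preserving :: "(rat \<Rightarrow> rat) \<Rightarrow> bool" where
  "dense_order_preserving g \<longleftrightarrow>
     strict_mono g \<and>
     (\<forall>q\<^sub>0 q\<^sub>1 r\<^sub>0 r\<^sub>1. g q\<^sub>0 < r\<^sub>0 \<and> r\<^sub>0 < r\<^sub>1 \<and> r\<^sub>1 < g q\<^sub>1 \<longrightarrow> (\<exists>q. r\<^sub>0 < g q \<and> g q < r\<^sub>1))"

definition dop_le :: "('c \<Rightarrow> 'c \<Rightarrow> bool) \<Rightarrow> (rat \<Rightarrow> 'c) rel" where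
  "dop_le R = {(c, c'). \<exists>g. dense_order_preserving g \<and> (\<forall>q. R (c q) (c' (g q)))}"

definition dop_iso :: "(rat \<Rightarrow> 'c) rel" where
  "dop_iso = {(c, c'). \<exists>h. bij h \<and> strict_mono h \<and> (\<forall>q. c q = c' (h q))}"

text \<open>
  The Borel structure of the product topology on the countable power of the discrete space
  of natural numbers (the topology of \<^typ>\<open>rat\<close> plays no role).
\<close>

abbreviation colourings :: "(rat \<Rightarrow> nat) measure" where
  "colourings \<equiv> borel"

end

theory Submission
  imports Defs "HOL-Library.Sublist" "HOL-Library.List_Lexorder"
begin

text \<open>
  Code the points of the given standard Borel space by bit sequences, and write the transported
  quasi-order \<open>R\<close> as \<open>u R v \<longleftrightarrow> (\<exists>d. F u v d)\<close> with \<open>F\<close> closed.  To a code \<open>z\<close> belongs the tree of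
  finite approximations of chains \<open>z\<^sub>0 R z\<^sub>1 R \<dots> R z\<^sub>k = z\<close> together with witnesses, in which every node
  also gets a dead child.  If \<open>u R v\<close>, appending the link \<open>(u, d)\<close> maps the tree of \<open>u\<close> to that
  of \<open>v\<close>.  Conversely, a level preserving map between the trees sends the branch of the trivial
  chain (\<open>k = 0\<close>) at \<open>u\<close> to an infinite branch, hence to a genuine chain from \<open>u\<close> to \<open>v\<close>.

  The tree is turned into a coloured order.  A node of level \<open>n\<close> becomes a block: a dense interval
  of background colour \<open>3n + 2\<close> with finitely many other points, among them between \<open>3n + 1\<close> and
  \<open>3n + 3\<close> points of colour \<open>0\<close>.  It is followed by the blocks of its descendants, where the children of each
  kind lie densely.  A dense order preserving map that does not increase colours can send background
  only to background of at most the same level, since a target interval of large colours has to be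
  hit as well; and it is injective on the points of colour \<open>0\<close>, so the level cannot drop either.
  Hence it maps blocks into blocks and respects levels and children.  On the other hand, isolated
  points may be skipped by a colour preserving map, and the dead children can be sent anywhere,
  so that a back and forth argument turns a relation between trees into an embedding.

  The names of the nodes are legible in the colouring.  So it is a Borel and invariant condition that
  a colouring has the form prescribed by the code that can be read off from it, and the set \<open>B\<close> of
  these colourings is as required.
\<close>


section \<open>Back and forth\<close>

text \<open>For \<open>A = Y\<close> this says that \<open>Y\<close> is a nonempty dense order
  without endpoints. In general \<open>A\<close> fills every finite cut of \<open>Y\<close>, which
  is what one step of a back and forth construction asks for.\<close>

definition meets_cuts :: "'a::linorder set \<Rightarrow> 'a set \<Rightarrow> bool" where
  "meets_cuts A Y \<longleftrightarrow> A \<noteq> {} \<and> (\<forall>y\<in>Y. (\<exists>a\<in>A. a < y) \<and> (\<exists>a\<in>A. y < a)) \<and>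
     (\<forall>y\<in>Y. \<forall>y'\<in>Y. y < y' \<longrightarrow> (\<exists>a\<in>A. y < a \<and> a < y'))"

lemma meets_cutsD:
  assumes "meets_cuts A Y"
  shows "A \<noteq> {}" "\<And>y. y \<in> Y \<Longrightarrow> \<exists>a\<in>A. a < y" "\<And>y. y \<in> Y \<Longrightarrow> \<exists>a\<in>A. y < a"
    "\<And>y y'. y \<in> Y \<Longrightarrow> y' \<in> Y \<Longrightarrow> y < y' \<Longrightarrow> \<exists>a\<in>A. y < a \<and> a < y'"
  using assms by (auto simp: meets_cuts_def)

lemma meets_cuts_between:
  assumes "meets_cuts A Y" "finite L" "finite U" "L \<subseteq> Y" "U \<subseteq> Y" "\<forall>l\<in>L. \<forall>u\<in>U. l < u"
  obtains a where "a \<in> A" "\<forall>l\<in>L. l < a" "\<forall>u\<in>U. a < u"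
proof -
  have "\<exists>a\<in>A. (\<forall>l\<in>L. l < a) \<and> (\<forall>u\<in>U. a < u)"
  proof (cases "L = {}")
    case True
    show ?thesis
    proof (cases "U = {}")
      case True
      with \<open>L = {}\<close> assms(1) show ?thesis by (auto simp: meets_cuts_def)
    next
      case False
      then have "Min U \<in> Y" using assms(3,5) Min_in by blast
      then obtain a where "a \<in> A" "a < Min U" using meets_cutsD(2)[OF assms(1)] by blast
      then show ?thesis using \<open>L = {}\<close> assms(3) False by (intro bexI[of _ a]) auto
    qed
  next
    case L: False
    then have mx: "Max L \<in> L" "Max L \<in> Y" using assms(2,4) Max_in by blast+
    show ?thesis
    proof (cases "U = {}")
      case True
      obtain a where "a \<in> A" "Max L < a" using meets_cutsD(3)[OF assms(1)] mx by blast
      then show ?thesis using True assms(2) L by (intro bexI[of _ a]) auto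
    next
      case False
      then have "Min U \<in> U" "Min U \<in> Y" using assms(3,5) Min_in by blast+
      with mx assms(6) have "Max L < Min U" by blast
      then obtain a where "a \<in> A" "Max L < a" "a < Min U"
        using meets_cutsD(4)[OF assms(1)] mx \<open>Min U \<in> Y\<close> by blast
      then show ?thesis using assms(2,3) L False by (intro bexI[of _ a]) auto
    qed
  qed
  then show ?thesis using that by blast
qed

text \<open>If the point found in a gap is the removed one, a second point of the gap is found next
  to it. This makes it possible to skip a marked point of the target.\<close>

lemma meets_cuts_remove:
  assumes "meets_cuts Y Y" shows "meets_cuts (Y - {b}) (Y - {b})"
proof -
  note * = meets_cutsD(2-4)[OF assms]
  obtain y where "y \<in> Y" using assms by (auto simp: meets_cuts_def)
  moreover obtain a where "a \<in> Y" "a < y" using *(1)[OF \<open>y \<in> Y\<close>] by blast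
  ultimately have "Y - {b} \<noteq> {}" by auto
  moreover have "\<exists>a\<in>Y - {b}. a < y" if y: "y \<in> Y - {b}" for y
  proof -
    obtain a where a: "a \<in> Y" "a < y" using *(1) y by blast
    obtain a' where "a' \<in> Y" "a' < a" using *(1) a by blast
    then show ?thesis using a by (cases "a = b") (auto intro: less_trans)
  qed
  moreover have "\<exists>a\<in>Y - {b}. y < a" if y: "y \<in> Y - {b}" for y
  proof -
    obtain a where a: "a \<in> Y" "y < a" using *(2) y by blast
    obtain a' where "a' \<in> Y" "a < a'" using *(2) a by blast
    then show ?thesis using a by (cases "a = b") (auto intro: less_trans)
  qed
  moreover have "\<exists>a\<in>Y - {b}. y < a \<and> a < y'" if y: "y \<in> Y - {b}" "y' \<in> Y - {b}" "y < y'" for y y'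
  proof -
    obtain a where a: "a \<in> Y" "y < a" "a < y'" using *(3) y by blast
    obtain a' where "a' \<in> Y" "y < a'" "a' < a" using *(3) a y by blast
    then show ?thesis using a by (cases "a = b") (auto intro: less_trans)
  qed
  ultimately show ?thesis by (auto simp: meets_cuts_def)
qed

lemma meets_cuts_lower:
  assumes "meets_cuts Y Y" "p \<in> Y" shows "meets_cuts {y\<in>Y. y < p} {y\<in>Y. y < p}"
proof -
  note * = meets_cutsD(2-4)[OF assms(1)]
  show ?thesis unfolding meets_cuts_def
  proof (intro conjI ballI impI)
    show "{y\<in>Y. y < p} \<noteq> {}" using *(1)[OF assms(2)] by blast
    fix y assume y: "y \<in> {y\<in>Y. y < p}"
    then obtain a where "a \<in> Y" "a < y" using *(1)[of y] by blast
    then show "\<exists>a\<in>{y\<in>Y. y < p}. a < y" using y by (intro bexI[of _ a]) auto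
    show "\<exists>a\<in>{y\<in>Y. y < p}. y < a" using y *(3)[of y p] assms(2) by blast
    fix y' assume y': "y' \<in> {y\<in>Y. y < p}" "y < y'"
    then obtain a where "a \<in> Y" "y < a" "a < y'" using *(3)[of y y'] y by blast
    then show "\<exists>a\<in>{y\<in>Y. y < p}. y < a \<and> a < y'" using y' by (intro bexI[of _ a]) auto
  qed
qed

lemma meets_cuts_upper:
  assumes "meets_cuts Y Y" "p \<in> Y" shows "meets_cuts {y\<in>Y. p < y} {y\<in>Y. p < y}"
proof -
  note * = meets_cutsD(2-4)[OF assms(1)]
  show ?thesis unfolding meets_cuts_def
  proof (intro conjI ballI impI)
    show "{y\<in>Y. p < y} \<noteq> {}" using *(2)[OF assms(2)] by blast
    fix y assume y: "y \<in> {y\<in>Y. p < y}"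
    then obtain a where "a \<in> Y" "y < a" using *(2)[of y] by blast
    then show "\<exists>a\<in>{y\<in>Y. p < y}. y < a" using y by (intro bexI[of _ a]) auto
    show "\<exists>a\<in>{y\<in>Y. p < y}. a < y" using y *(3)[of p y] assms(2) by blast
    fix y' assume y': "y' \<in> {y\<in>Y. p < y}" "y < y'"
    then obtain a where "a \<in> Y" "y < a" "a < y'" using *(3)[of y y'] y by blast
    then show "\<exists>a\<in>{y\<in>Y. p < y}. y < a \<and> a < y'" using y by (intro bexI[of _ a]) auto
  qed
qed

text \<open>The union of a chain of finite partial isomorphisms inside \<open>K\<close>, each of
  which absorbs the next element of both enumerations.\<close>

lemma back_and_forth:
  fixes X :: "'a::linorder set" and Y :: "'b::linorder set"
  assumes cX: "countable X" and cY: "countable Y"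
    and zig: "\<And>x L U. x \<in> X \<Longrightarrow> finite L \<Longrightarrow> finite U \<Longrightarrow> L \<subseteq> Y \<Longrightarrow> U \<subseteq> Y \<Longrightarrow>
      \<forall>l\<in>L. \<forall>u\<in>U. l < u \<Longrightarrow> \<exists>y\<in>Y. K x y \<and> (\<forall>l\<in>L. l < y) \<and> (\<forall>u\<in>U. y < u)"
    and zag: "\<And>y L U. y \<in> Y \<Longrightarrow> finite L \<Longrightarrow> finite U \<Longrightarrow> L \<subseteq> X \<Longrightarrow> U \<subseteq> X \<Longrightarrow>
      \<forall>l\<in>L. \<forall>u\<in>U. l < u \<Longrightarrow> \<exists>x\<in>X. K x y \<and> (\<forall>l\<in>L. l < x) \<and> (\<forall>u\<in>U. x < u)"
  shows "\<exists>f. bij_betw f X Y \<and> strict_mono_on X f \<and> (\<forall>x\<in>X. K x (f x))"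
proof -
  define good where "good p \<longleftrightarrow> p \<subseteq> X \<times> Y \<and> (\<forall>(x, y)\<in>p. K x y) \<and>
    (\<forall>(x, y)\<in>p. \<forall>(x', y')\<in>p. x < x' \<longleftrightarrow> y < y')" for p
  have goodD: "a \<in> X \<and> b \<in> Y \<and> K a b" "a < a' \<longleftrightarrow> b < b'"
    if "good p" "(a, b) \<in> p" "(a', b') \<in> p" for p a b a' b'
    using that unfolding good_def by blast+
  have ext1: "\<exists>p'. finite p' \<and> good p' \<and> p \<subseteq> p' \<and> x \<in> fst ` p'"
    if p: "finite p" "good p" and x: "x \<in> X" for p x
  proof (cases "x \<in> fst ` p")
    case True then show ?thesis using p by blast
  next
    case False
    \<comment> \<open>\<open>L\<close> and \<open>U\<close> are the images of the points of
      \<open>p\<close> to the left and to the right of \<open>x\<close>.\<close>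
    have "\<exists>y\<in>Y. K x y \<and> (\<forall>l\<in>snd ` {q\<in>p. fst q < x}. l < y) \<and> (\<forall>u\<in>snd ` {q\<in>p. x < fst q}. y < u)"
    proof (rule zig[OF x])
      show "\<forall>l\<in>snd ` {q\<in>p. fst q < x}. \<forall>u\<in>snd ` {q\<in>p. x < fst q}. l < u"
        using goodD(2)[OF p(2)] by (auto; meson less_trans)
    qed (use p goodD(1)[OF p(2)] in auto)
    then obtain y where y: "y \<in> Y" "K x y" "\<And>a b. (a, b) \<in> p \<Longrightarrow> a < x \<Longrightarrow> b < y"
      "\<And>a b. (a, b) \<in> p \<Longrightarrow> x < a \<Longrightarrow> y < b" by force
    have "a < x \<longleftrightarrow> b < y" "x < a \<longleftrightarrow> y < b" if "(a, b) \<in> p" for a b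
    proof -
      have "a \<noteq> x" using False that by force
      then show "a < x \<longleftrightarrow> b < y" "x < a \<longleftrightarrow> y < b" using y(3,4)[OF that] by force+
    qed
    then have "good (insert (x, y) p)" using p(2) x y(1,2) unfolding good_def by auto
    then show ?thesis using p(1) by (intro exI[of _ "insert (x, y) p"]) auto
  qed
  have ext2: "\<exists>p'. finite p' \<and> good p' \<and> p \<subseteq> p' \<and> y \<in> snd ` p'"
    if p: "finite p" "good p" and y: "y \<in> Y" for p y
  proof (cases "y \<in> snd ` p")
    case True then show ?thesis using p by blast
  next
    case False
    have "\<exists>x\<in>X. K x y \<and> (\<forall>l\<in>fst ` {q\<in>p. snd q < y}. l < x) \<and> (\<forall>u\<in>fst ` {q\<in>p. y < snd q}. x < u)"
    proof (rule zag[OF y])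
      show "\<forall>l\<in>fst ` {q\<in>p. snd q < y}. \<forall>u\<in>fst ` {q\<in>p. y < snd q}. l < u"
        using goodD(2)[OF p(2)] by (auto; meson less_trans)
    qed (use p goodD(1)[OF p(2)] in auto)
    then obtain x where x: "x \<in> X" "K x y" "\<And>a b. (a, b) \<in> p \<Longrightarrow> b < y \<Longrightarrow> a < x"
      "\<And>a b. (a, b) \<in> p \<Longrightarrow> y < b \<Longrightarrow> x < a" by force
    have "a < x \<longleftrightarrow> b < y" "x < a \<longleftrightarrow> y < b" if "(a, b) \<in> p" for a b
    proof -
      have "b \<noteq> y" using False that by force
      then show "a < x \<longleftrightarrow> b < y" "x < a \<longleftrightarrow> y < b" using x(3,4)[OF that] by force+
    qed
    then have "good (insert (x, y) p)" using p(2) y x(1,2) unfolding good_def by auto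
    then show ?thesis using p(1) by (intro exI[of _ "insert (x, y) p"]) auto
  qed
  \<comment> \<open>Stage \<open>n\<close> absorbs the \<open>n\<close>-th element of
    \<open>X\<close> and of \<open>Y\<close>. An empty set has no enumeration, hence the
    guards.\<close>
  define step where "step n p p' \<longleftrightarrow> p \<subseteq> p' \<and> (X \<noteq> {} \<longrightarrow> from_nat_into X n \<in> fst ` p') \<and>
    (Y \<noteq> {} \<longrightarrow> from_nat_into Y n \<in> snd ` p')" for n :: nat and p p'
  have "\<exists>P. \<forall>n. (finite (P n) \<and> good (P n)) \<and> step n (P n) (P (Suc n))"
  proof (rule dependent_nat_choice)
    show "\<exists>p. finite p \<and> good p" by (rule exI[of _ "{}"]) (simp add: good_def)
  next
    fix p and n :: nat assume p: "finite p \<and> good p"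
    obtain p1 where p1: "finite p1" "good p1" "p \<subseteq> p1" "X \<noteq> {} \<longrightarrow> from_nat_into X n \<in> fst ` p1"
      using p ext1[of p "from_nat_into X n"] from_nat_into[of X n] by (cases "X = {}") auto
    obtain p2 where "finite p2" "good p2" "p1 \<subseteq> p2" "Y \<noteq> {} \<longrightarrow> from_nat_into Y n \<in> snd ` p2"
      using p1 ext2[of p1 "from_nat_into Y n"] from_nat_into[of Y n] by (cases "Y = {}") auto
    then show "\<exists>p'. (finite p' \<and> good p') \<and> step n p p'"
      using p1 unfolding step_def by (intro exI[of _ p2]) auto
  qed
  then obtain P where P: "\<And>n. good (P n)" "\<And>n. step n (P n) (P (Suc n))" by blast
  have mono: "P m \<subseteq> P n" if "m \<le> n" for m n
    using that by (rule lift_Suc_mono_le[rotated]) (use P(2) in \<open>auto simp: step_def\<close>)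
  define G where "G = (\<Union>n. P n)"
  have ord: "x < x' \<longleftrightarrow> y < y'" if xy: "(x, y) \<in> G" "(x', y') \<in> G" for x y x' y'
  proof -
    obtain m n where "(x, y) \<in> P m" "(x', y') \<in> P n" using xy by (auto simp: G_def)
    then have "(x, y) \<in> P (max m n)" "(x', y') \<in> P (max m n)" using mono[of m "max m n"] mono[of n "max m n"] by auto
    then show ?thesis using P(1)[of "max m n"] by (auto simp: good_def)
  qed
  have GK: "x \<in> X \<and> y \<in> Y \<and> K x y" if "(x, y) \<in> G" for x y
    using that P(1) by (fastforce simp: G_def good_def)
  have domG: "\<exists>y. (x, y) \<in> G" if "x \<in> X" for x
  proof -
    obtain n where "from_nat_into X n = x" using from_nat_into_surj[OF cX \<open>x \<in> X\<close>] by blast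
    then have "x \<in> fst ` P (Suc n)" using P(2)[of n] \<open>x \<in> X\<close> by (auto simp: step_def)
    then show ?thesis by (force simp: G_def)
  qed
  have ranG: "\<exists>x. (x, y) \<in> G" if "y \<in> Y" for y
  proof -
    obtain n where "from_nat_into Y n = y" using from_nat_into_surj[OF cY \<open>y \<in> Y\<close>] by blast
    then have "y \<in> snd ` P (Suc n)" using P(2)[of n] \<open>y \<in> Y\<close> by (auto simp: step_def)
    then show ?thesis by (force simp: G_def)
  qed
  define f where "f x = (SOME y. (x, y) \<in> G)" for x
  have fG: "(x, f x) \<in> G" if "x \<in> X" for x unfolding f_def using domG[OF that] by (rule someI_ex)
  have sm: "strict_mono_on X f" by (rule strict_mono_onI) (use fG ord in blast)
  have "f ` X = Y"
  proof
    show "f ` X \<subseteq> Y" using fG GK by blast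
    show "Y \<subseteq> f ` X"
    proof
      fix y assume "y \<in> Y"
      then obtain x where x: "(x, y) \<in> G" using ranG by blast
      then have "x \<in> X" using GK by blast
      have "f x = y" using ord[OF x fG[OF \<open>x \<in> X\<close>]] ord[OF fG[OF \<open>x \<in> X\<close>] x] by force
      then show "y \<in> f ` X" using \<open>x \<in> X\<close> by blast
    qed
  qed
  then have "bij_betw f X Y" using sm by (auto simp: bij_betw_def strict_mono_on_imp_inj_on)
  then show ?thesis using sm fG GK by blast
qed

lemma cantor_isomorphism:
  fixes X :: "'a::linorder set" and Y :: "'b::linorder set"
  assumes "countable X" "countable Y" "meets_cuts X X" "meets_cuts Y Y"
  shows "\<exists>f. bij_betw f X Y \<and> strict_mono_on X f"
proof -
  have "\<exists>f. bij_betw f X Y \<and> strict_mono_on X f \<and> (\<forall>x\<in>X. True)"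
  proof (rule back_and_forth[OF assms(1,2)])
    fix L U :: "'b set"
    assume "finite L" "finite U" "L \<subseteq> Y" "U \<subseteq> Y" "\<forall>l\<in>L. \<forall>u\<in>U. l < u"
    from meets_cuts_between[OF assms(4) this]
    show "\<exists>y\<in>Y. True \<and> (\<forall>l\<in>L. l < y) \<and> (\<forall>u\<in>U. y < u)" by metis
  next
    fix L U :: "'a set"
    assume "finite L" "finite U" "L \<subseteq> X" "U \<subseteq> X" "\<forall>l\<in>L. \<forall>u\<in>U. l < u"
    from meets_cuts_between[OF assms(3) this]
    show "\<exists>x\<in>X. True \<and> (\<forall>l\<in>L. l < x) \<and> (\<forall>u\<in>U. x < u)" by metis
  qed
  then show ?thesis by blast
qed

text \<open>The marked points of the target may be skipped, but its background has to be hit everywhere.\<close>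

lemma marked_order_embedding:
  fixes X :: "'a::linorder set" and Y :: "'b::linorder set"
  assumes "countable X" "meets_cuts X X" "set ps \<subseteq> X" "sorted_wrt (<) ps" "\<forall>x\<in>X - set ps. c x = k"
    and "countable Y" "meets_cuts Y Y" "set qs \<subseteq> Y" "sorted_wrt (<) qs" "\<forall>y\<in>Y - set qs. d y = k"
    and "subseq (map c ps) (map d qs)"
  shows "\<exists>f. f ` X \<subseteq> Y \<and> strict_mono_on X f \<and> (\<forall>x\<in>X. d (f x) = c x) \<and> Y - set qs \<subseteq> f ` X"
  using assms
proof (induction qs arbitrary: X Y ps)
  case Nil
  from Nil.prems(11) have "ps = []" by (cases ps) auto
  obtain f where "bij_betw f X Y" "strict_mono_on X f"
    using cantor_isomorphism[OF Nil.prems(1,6,2,7)] by blast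
  then show ?case using Nil.prems \<open>ps = []\<close> by (intro exI[of _ f]) (auto simp: bij_betw_def)
next
  case (Cons b qs)
  \<comment> \<open>Greedy matching: a first target mark that cannot be matched with the first
    source mark is dropped from \<open>Y\<close>. Otherwise the two are matched, the unmarked parts
    to their left are isomorphic by Cantor's theorem, and the induction hypothesis treats the parts
    to their right.\<close>
  show ?case
  proof (cases "\<exists>p ps'. ps = p # ps' \<and> c p = d b")
    case False
    have sub: "subseq (map c ps) (map d qs)"
      using Cons.prems(11) False by (cases ps) (auto split: if_splits)
    have "\<exists>f. f ` X \<subseteq> Y - {b} \<and> strict_mono_on X f \<and> (\<forall>x\<in>X. d (f x) = c x) \<and> Y - {b} - set qs \<subseteq> f ` X"
      by (rule Cons.IH[OF Cons.prems(1-5) _ meets_cuts_remove[OF Cons.prems(7)] _ _ _ sub])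
        (use Cons.prems in auto)
    then obtain f where "f ` X \<subseteq> Y - {b}" "strict_mono_on X f" "\<forall>x\<in>X. d (f x) = c x" "Y - {b} - set qs \<subseteq> f ` X"
      by blast
    then show ?thesis by (intro exI[of _ f]) auto
  next
    case True
    then obtain p ps' where ps: "ps = p # ps'" and pb: "c p = d b" by blast
    have p: "p \<in> X" and b: "b \<in> Y" using Cons.prems ps by auto
    have sub: "subseq (map c ps') (map d qs)" using Cons.prems(11) ps pb by simp
    let ?X1 = "{x\<in>X. x < p}" and ?X2 = "{x\<in>X. p < x}"
    let ?Y1 = "{y\<in>Y. y < b}" and ?Y2 = "{y\<in>Y. b < y}"
    have cX: "countable {x\<in>X. Q x}" for Q by (rule countable_subset[OF _ Cons.prems(1)]) blast
    have cY: "countable {y\<in>Y. Q y}" for Q by (rule countable_subset[OF _ Cons.prems(6)]) blast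
    obtain f1 where f1: "bij_betw f1 ?X1 ?Y1" "strict_mono_on ?X1 f1"
      using cantor_isomorphism[OF cX cY meets_cuts_lower[OF Cons.prems(2) p] meets_cuts_lower[OF Cons.prems(7) b]]
      by blast
    have "\<exists>f. f ` ?X2 \<subseteq> ?Y2 \<and> strict_mono_on ?X2 f \<and> (\<forall>x\<in>?X2. d (f x) = c x) \<and> ?Y2 - set qs \<subseteq> f ` ?X2"
      by (rule Cons.IH[OF cX meets_cuts_upper[OF Cons.prems(2) p] _ _ _ cY meets_cuts_upper[OF Cons.prems(7) b] _ _ _ sub])
        (use Cons.prems ps in auto)
    then obtain f2 where f2: "f2 ` ?X2 \<subseteq> ?Y2" "strict_mono_on ?X2 f2" "\<forall>x\<in>?X2. d (f2 x) = c x"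
      "?Y2 - set qs \<subseteq> f2 ` ?X2" by blast
    define f where "f x = (if x < p then f1 x else if x = p then b else f2 x)" for x
    have f1': "f1 x \<in> Y" "f1 x < b" if "x \<in> X" "x < p" for x
      using f1(1) that by (auto simp: bij_betw_def)
    have f2': "f2 x \<in> Y" "b < f2 x" if "x \<in> X" "p < x" for x
      using f2(1) that by auto
    have cases3: "x < p \<or> x = p \<or> p < x" for x by auto
    have "strict_mono_on X f"
    proof (rule strict_mono_onI)
      fix x y assume xy: "x \<in> X" "y \<in> X" "x < y"
      show "f x < f y"
      proof (cases "y < p \<or> p < x")
        case True
        then show ?thesis using xy strict_mono_onD[OF f1(2), of x y] strict_mono_onD[OF f2(2), of x y]
          by (auto simp: f_def)
      next
        case False
        then have "x < p \<or> x = p" "p < y \<or> p = y" by auto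
        then show ?thesis using xy f1'(2)[of x] f2'(2)[of y] by (auto simp: f_def)
      qed
    qed
    moreover have "f ` X \<subseteq> Y" using f1' f2' b cases3 unfolding f_def by auto
    moreover have "d (f x) = c x" if x: "x \<in> X" for x
    proof -
      consider "x < p" | "x = p" | "p < x" by force
      then show ?thesis
      proof cases
        case 1
        have "x \<notin> set ps" using 1 Cons.prems(4) ps by auto
        moreover have "f1 x \<notin> set (b # qs)" using f1'[OF x 1] Cons.prems(9) by auto
        ultimately show ?thesis using 1 x Cons.prems(5,10) f1'[OF x 1] by (auto simp: f_def)
      qed (use x f2(3) pb in \<open>auto simp: f_def\<close>)
    qed
    moreover have "Y - set (b # qs) \<subseteq> f ` X"
    proof
      fix y assume y: "y \<in> Y - set (b # qs)"
      consider "y < b" | "b < y" using y by force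
      then show "y \<in> f ` X"
      proof cases
        case 1
        then have "y \<in> f1 ` ?X1" using f1(1) y by (auto simp: bij_betw_def)
        then show ?thesis by (auto simp: f_def)
      next
        case 2
        then have "y \<in> f2 ` ?X2" using f2(4) y by auto
        then obtain x where "x \<in> X" "p < x" "y = f2 x" by auto
        then show ?thesis unfolding f_def by (intro image_eqI[of _ _ x]) auto
      qed
    qed
    ultimately show ?thesis by blast
  qed
qed

section \<open>Coloured orders built from trees of blocks\<close>

text \<open>A name \<open>None\<close> marks a dead node; \<open>Some (b, l)\<close> lists in \<open>l\<close>, for each link of a chain, the next bit
  of its left end and the next value of its witness, and \<open>b\<close> is the next bit of the first member
  of the chain.\<close>

type_synonym name = "(bool \<times> (bool \<times> nat) list) option"

text \<open>The colours of the isolated points of a block, from left to right after its head.  The number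
  of zeros is monotone in the status of the node (dead, bit 0, bit 1) and tells the levels apart.\<close>

fun word_of :: "nat \<Rightarrow> name \<Rightarrow> nat list" where
  "word_of n None = replicate (3 * n + 1) 0"
| "word_of n (Some (b, l)) = replicate (3 * n + 2 + of_bool b) 0 @ map (\<lambda>p. 3 * to_nat p + 3) l"

lemma count_word_of:
  "count_list (word_of n a) 0 = 3 * n + (case a of None \<Rightarrow> 1 | Some (b, l) \<Rightarrow> 2 + of_bool b)"
proof -
  have "count_list (replicate m x) x = m" for m and x :: nat by (induction m) auto
  moreover have "count_list (map (\<lambda>p. 3 * to_nat p + 3) l) (0 :: nat) = 0" for l :: "(bool \<times> nat) list"
    by (induction l) auto
  ultimately show ?thesis by (cases a) (auto simp del: replicate.simps)
qed

lemma word_of_mod: "x \<in> set (word_of n a) \<Longrightarrow> x mod 3 = 0"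
  by (cases a) (auto simp del: replicate.simps split: if_splits)

text \<open>Colour classes: heads of level \<open>n\<close> have colour \<open>3n + 1\<close>, the background of level \<open>n\<close> has colour
  \<open>3n + 2\<close>, and the other isolated points have colours divisible by 3.  Each block contains exactly
  one head, which represents it.\<close>

definition head :: "('p \<Rightarrow> nat) \<Rightarrow> 'p \<Rightarrow> bool" where
  "head c v \<longleftrightarrow> c v mod 3 = 1"

definition level :: "('p \<Rightarrow> nat) \<Rightarrow> 'p \<Rightarrow> nat" where
  "level c v = c v div 3"

definition block :: "('p::linorder \<Rightarrow> nat) \<Rightarrow> 'p \<Rightarrow> 'p \<Rightarrow> bool" where
  "block c v q \<longleftrightarrow> (\<forall>t. head c t \<and> (v \<le> t \<and> t \<le> q \<or> q \<le> t \<and> t \<le> v) \<longrightarrow> t = v)"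

definition has_word :: "('p::linorder \<Rightarrow> nat) \<Rightarrow> 'p \<Rightarrow> nat list \<Rightarrow> bool" where
  "has_word c v w \<longleftrightarrow> (\<exists>ps. sorted_wrt (<) (v # ps) \<and> map c ps = w \<and> (\<forall>p\<in>set ps. block c v p) \<and>
     (\<forall>q. block c v q \<longrightarrow> q = v \<or> q \<in> set ps \<or> c q = 3 * level c v + 2))"

text \<open>Blocks of level at most that of \<open>u\<close> bound the descendants of \<open>u\<close> on the right.\<close>

definition child :: "('p::linorder \<Rightarrow> nat) \<Rightarrow> 'p \<Rightarrow> 'p \<Rightarrow> bool" where
  "child c u v \<longleftrightarrow> head c u \<and> head c v \<and> u < v \<and> level c v = Suc (level c u) \<and>
     (\<forall>t. head c t \<and> u < t \<and> t < v \<longrightarrow> level c u < level c t)"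

text \<open>The names on the path to \<open>v\<close> are listed from \<open>v\<close> upwards, without the root.\<close>

primrec node :: "('p::linorder \<Rightarrow> nat) \<Rightarrow> name list \<Rightarrow> 'p \<Rightarrow> bool" where
  "node c [] v \<longleftrightarrow> head c v \<and> level c v = 0"
| "node c (a # s) v \<longleftrightarrow> has_word c v (word_of (Suc (length s)) a) \<and> (\<exists>u. child c u v \<and> node c s u)"

text \<open>\<open>T\<close> is the set of name lists of the tree, latest name first. For fixed
  \<open>T\<close> the clauses speak only of order and colours and quantify over points, names and
  lists of them; so the condition is isomorphism invariant and, over the rationals, Borel. By the
  last clause each allowed name fills all cuts among the children, so that back and forth never gets
  stuck.\<close>

definition shaped :: "('p::linorder \<Rightarrow> nat) \<Rightarrow> (name list \<Rightarrow> bool) \<Rightarrow> bool" where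
  "shaped c T \<longleftrightarrow>
     (\<forall>q. \<exists>v. head c v \<and> block c v q) \<and>
     (\<forall>v q. head c v \<and> block c v q \<longrightarrow> (\<exists>q'. q' < q \<and> block c v q') \<and> (\<exists>q'. q < q' \<and> block c v q')) \<and>
     (\<exists>r. head c r \<and> level c r = 0 \<and> has_word c r (word_of 0 None) \<and>
        (\<forall>v. head c v \<longrightarrow> v = r \<or> r < v \<and> 0 < level c v)) \<and>
     (\<forall>v. head c v \<and> 0 < level c v \<longrightarrow> (\<exists>u. child c u v)) \<and>
     (\<forall>s u v. node c s u \<and> child c u v \<longrightarrow> (\<exists>a. T (a # s) \<and> has_word c v (word_of (Suc (length s)) a))) \<and>
     (\<forall>s u a. node c s u \<and> T (a # s) \<longrightarrow>
        meets_cuts {v. child c u v \<and> has_word c v (word_of (Suc (length s)) a)} {v. child c u v})"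

lemma block_self: "block c v v"
  by (auto simp: block_def)

lemma block_convex:
  assumes "block c v q" "block c v q'" "q \<le> t" "t \<le> q'"
  shows "block c v t"
  unfolding block_def
proof (intro allI impI)
  fix x assume x: "head c x \<and> (v \<le> x \<and> x \<le> t \<or> t \<le> x \<and> x \<le> v)"
  then have "v \<le> x \<and> x \<le> q' \<or> q \<le> x \<and> x \<le> v" using assms(3,4) by auto
  then show "x = v" using x assms(1,2) by (auto simp: block_def)
qed

lemma node_level: "node c s v \<Longrightarrow> head c v \<and> level c v = length s"
  by (induction s arbitrary: v) (auto simp: child_def)

lemma has_wordE:
  assumes "has_word c v w"
  obtains ps where "sorted_wrt (<) (v # ps)" "map c ps = w" "\<forall>p\<in>set ps. block c v p"
    "\<forall>q. block c v q \<longrightarrow> q = v \<or> q \<in> set ps \<or> c q = 3 * level c v + 2"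
  using assms unfolding has_word_def by blast

lemma has_word_finite:
  assumes "has_word c v w" shows "finite {q. block c v q \<and> c q \<noteq> 3 * level c v + 2}"
proof -
  obtain ps where "\<forall>q. block c v q \<longrightarrow> q = v \<or> q \<in> set ps \<or> c q = 3 * level c v + 2"
    using assms by (rule has_wordE)
  then have "{q. block c v q \<and> c q \<noteq> 3 * level c v + 2} \<subseteq> insert v (set ps)" by auto
  then show ?thesis by (rule finite_subset) simp
qed

text \<open>Neither the head nor the background has colour 0, so all zeros of the block are listed
  in the word.\<close>

lemma has_word_card:
  assumes "has_word c v w" "head c v"
  shows "card {q. block c v q \<and> c q = 0} = count_list w 0"
proof -
  obtain ps where ps: "sorted_wrt (<) (v # ps)" "map c ps = w" "\<forall>p\<in>set ps. block c v p"
    "\<forall>q. block c v q \<longrightarrow> q = v \<or> q \<in> set ps \<or> c q = 3 * level c v + 2"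
    using assms(1) by (rule has_wordE)
  have "c v \<noteq> 0" using assms(2) by (auto simp: head_def)
  then have "{q. block c v q \<and> c q = 0} = set (filter (\<lambda>q. c q = 0) ps)" using ps(3,4) by force
  moreover have "distinct ps" using ps(1) by (simp add: sorted_wrt_append strict_sorted_iff)
  then have "card (set (filter (\<lambda>q. c q = 0) ps)) = length (filter (\<lambda>q. c q = 0) ps)"
    by (intro distinct_card) simp
  moreover have "length (filter (\<lambda>q. c q = 0) ps) = count_list (map c ps) 0"
    by (induction ps) auto
  ultimately show ?thesis using ps(2) by simp
qed

text \<open>Letters divisible by 3 are neither head colours nor background colours, so both words
  enumerate the same points in increasing order.\<close>

lemma has_word_unique:
  assumes "has_word c v w" "has_word c v w'" "head c v" "\<And>x. x \<in> set w \<union> set w' \<Longrightarrow> x mod 3 = 0"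
  shows "w = w'"
proof -
  obtain ps where ps: "sorted_wrt (<) (v # ps)" "map c ps = w" "\<forall>p\<in>set ps. block c v p"
    "\<forall>q. block c v q \<longrightarrow> q = v \<or> q \<in> set ps \<or> c q = 3 * level c v + 2"
    using assms(1) by (rule has_wordE)
  obtain qs where qs: "sorted_wrt (<) (v # qs)" "map c qs = w'" "\<forall>p\<in>set qs. block c v p"
    "\<forall>q. block c v q \<longrightarrow> q = v \<or> q \<in> set qs \<or> c q = 3 * level c v + 2"
    using assms(2) by (rule has_wordE)
  have sp: "c p mod 3 = 0" if "p \<in> set ps \<union> set qs" for p using that assms(4) ps(2) qs(2) by auto
  have bg: "c p \<noteq> 3 * level c v + 2" if "c p mod 3 = 0" for p
  proof
    assume "c p = 3 * level c v + 2"
    with that have "(3 * level c v + 2) mod 3 = 0" by metis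
    then show False by presburger
  qed
  have hv: "v \<notin> set ps \<union> set qs" using assms(3) sp[of v] by (auto simp: head_def)
  have "p \<in> set qs" if "p \<in> set ps" for p
  proof -
    have "block c v p" "p \<noteq> v" "c p \<noteq> 3 * level c v + 2" using ps(3) hv that bg sp by auto
    then show ?thesis using qs(4) by auto
  qed
  moreover have "p \<in> set ps" if "p \<in> set qs" for p
  proof -
    have "block c v p" "p \<noteq> v" "c p \<noteq> 3 * level c v + 2" using qs(3) hv that bg sp by auto
    then show ?thesis using ps(4) by auto
  qed
  ultimately have "set ps = set qs" by blast
  then have "ps = qs"
    using ps(1) qs(1) strict_sorted_equal by auto
  then show ?thesis using ps(2) qs(2) by simp
qed

section \<open>Blocks, parents and children in a shaped colouring\<close>

locale shaping =
  fixes c :: "rat \<Rightarrow> nat" and T :: "name list \<Rightarrow> bool"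
  assumes shaped: "shaped c T" and T_None: "\<And>s. T (None # s)"
begin

lemma
  shows cover: "\<exists>v. head c v \<and> block c v q"
    and block_lower: "head c v \<Longrightarrow> block c v q \<Longrightarrow> \<exists>q'. q' < q \<and> block c v q'"
    and block_upper: "head c v \<Longrightarrow> block c v q \<Longrightarrow> \<exists>q'. q < q' \<and> block c v q'"
    and root_ex: "\<exists>r. head c r \<and> level c r = 0 \<and> has_word c r (word_of 0 None) \<and>
        (\<forall>v. head c v \<longrightarrow> v = r \<or> r < v \<and> 0 < level c v)"
    and parent_ex: "head c v \<Longrightarrow> 0 < level c v \<Longrightarrow> \<exists>u. child c u v"
    and child_name: "node c s u \<Longrightarrow> child c u v \<Longrightarrow>
        \<exists>a. T (a # s) \<and> has_word c v (word_of (Suc (length s)) a)"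
    and children_dense: "node c s u \<Longrightarrow> T (a # s) \<Longrightarrow>
        meets_cuts {v. child c u v \<and> has_word c v (word_of (Suc (length s)) a)} {v. child c u v}"
  using shaped unfolding shaped_def by blast+

lemma node_ex: "head c v \<Longrightarrow> \<exists>s. node c s v"
proof (induction "level c v" arbitrary: v)
  case 0
  then show ?case by (intro exI[of _ "[]"]) simp
next
  case (Suc n)
  then obtain u where u: "child c u v" using parent_ex[of v] by auto
  then have "head c u" "level c u = n" using Suc by (auto simp: child_def)
  then obtain s where s: "node c s u" using Suc by blast
  then obtain a where "has_word c v (word_of (Suc (length s)) a)" using child_name u by blast
  then show ?case using s u by (intro exI[of _ "a # s"]) auto
qed

lemma node_Cons_T: "node c s u \<Longrightarrow> child c u v \<Longrightarrow> \<exists>a. T (a # s) \<and> node c (a # s) v"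
  using child_name by fastforce

lemma ex_word:
  assumes "head c v"
  shows "\<exists>a. has_word c v (word_of (level c v) a)"
proof -
  obtain s where s: "node c s v" using node_ex assms by blast
  show ?thesis
  proof (cases s)
    case Nil
    obtain r where r: "has_word c r (word_of 0 None)" "head c r"
        "\<forall>v. head c v \<longrightarrow> v = r \<or> r < v \<and> 0 < level c v" using root_ex by blast
    moreover have "level c v = 0" using s Nil by simp
    ultimately have "v = r" using assms by auto
    then show ?thesis using r \<open>level c v = 0\<close> by metis
  next
    case (Cons a s')
    then show ?thesis using s node_level[OF s] by auto
  qed
qed

text \<open>The ranges for different levels are disjoint, so the number of zeros of a block
  determines its level.\<close>

lemma zeros_bounds:
  assumes "head c v"
  shows "finite {q. block c v q \<and> c q = 0}"
    and "3 * level c v + 1 \<le> card {q. block c v q \<and> c q = 0}"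
    and "card {q. block c v q \<and> c q = 0} \<le> 3 * level c v + 3"
proof -
  obtain a where a: "has_word c v (word_of (level c v) a)" using ex_word assms by blast
  have "{q. block c v q \<and> c q = 0} \<subseteq> {q. block c v q \<and> c q \<noteq> 3 * level c v + 2}" by auto
  then show "finite {q. block c v q \<and> c q = 0}" using has_word_finite[OF a] finite_subset by blast
  show "3 * level c v + 1 \<le> card {q. block c v q \<and> c q = 0}"
    "card {q. block c v q \<and> c q = 0} \<le> 3 * level c v + 3"
    using has_word_card[OF a assms] by (auto simp: count_word_of split: option.splits)
qed

text \<open>A block has only finitely many points outside the background; \<open>r\<close> is the
  first of them after \<open>q\<close>, or \<open>q'\<close> if none comes earlier.\<close>

lemma background_interval:
  assumes "head c v" "block c v q" "block c v q'" "q < q'"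
  obtains r where "q < r" "r \<le> q'" "\<And>x. q < x \<Longrightarrow> x < r \<Longrightarrow> block c v x \<and> c x = 3 * level c v + 2"
proof -
  obtain a where a: "has_word c v (word_of (level c v) a)" using ex_word assms by blast
  define F where "F = insert q' {x. block c v x \<and> c x \<noteq> 3 * level c v + 2 \<and> q < x \<and> x < q'}"
  have F: "finite F" unfolding F_def
    by (rule finite.insertI, rule finite_subset[OF _ has_word_finite[OF a]]) auto
  show thesis
  proof (rule that[of "Min F"])
    show "q < Min F" using F assms(4) by (subst Min_gr_iff) (auto simp: F_def)
    show m: "Min F \<le> q'" using F by (auto simp: F_def)
    fix x assume x: "q < x" "x < Min F"
    then have "x < q'" using m by simp
    then have b: "block c v x" using block_convex[OF assms(2,3), of x] x by simp
    have "x \<notin> F" using F x(2) by (meson Min_le leD)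
    then show "block c v x \<and> c x = 3 * level c v + 2" using b x \<open>x < q'\<close> by (auto simp: F_def)
  qed
qed

lemma has_child: "head c u \<Longrightarrow> \<exists>v. child c u v"
  using node_ex[of u] children_dense[OF _ T_None] by (fastforce simp: meets_cuts_def)

text \<open>Climb from \<open>v2\<close> through its parents. As long as a parent lies to the right
  of \<open>v1\<close>, the hypotheses persist. A parent cannot lie to the left of
  \<open>v1\<close>: then \<open>v1\<close> would lie between it and its child and have at least the
  level of that child.\<close>

lemma ancestor_ex:
  assumes "head c v1" "head c v2" "v1 < v2" "\<And>t. head c t \<Longrightarrow> v1 < t \<Longrightarrow> t \<le> v2 \<Longrightarrow> level c v1 < level c t"
  shows "\<exists>u. child c v1 u \<and> u \<le> v2"
  using assms(2-4)
proof (induction "level c v2" arbitrary: v2 rule: less_induct)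
  case less
  have l: "level c v1 < level c v2" using less.prems by blast
  obtain p where p: "child c p v2" using parent_ex[of v2] less.prems(1) l by auto
  consider "p = v1" | "v1 < p" | "p < v1" by force
  then show ?case
  proof cases
    case 1
    then show ?thesis using p by auto
  next
    case 2
    have "\<exists>u. child c v1 u \<and> u \<le> p"
    proof (rule less.hyps)
      show "level c p < level c v2" "head c p" "v1 < p" using p 2 by (auto simp: child_def)
      fix t assume "head c t" "v1 < t" "t \<le> p"
      then show "level c v1 < level c t" using less.prems(3)[of t] p by (auto simp: child_def)
    qed
    then show ?thesis using p by (auto simp: child_def)
  next
    case 3
    then have "level c p < level c v1" using p assms(1) less.prems(2) by (auto simp: child_def)
    then show ?thesis using l p by (auto simp: child_def)
  qed
qed

text \<open>Either some child of \<open>v1\<close> precedes \<open>v2\<close>, or \<open>v2\<close>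
  comes no later than a child, so that all heads up to \<open>v2\<close> are deeper than
  \<open>v1\<close> and \<open>ancestor_ex\<close> yields a child that is at most \<open>v2\<close>.
  The children have no leftmost element, so another child lies strictly before it.\<close>

lemma head_between:
  assumes "head c v1" "head c v2" "v1 < v2"
  obtains t where "head c t" "v1 < t" "t < v2" "level c t = Suc (level c v1)"
proof -
  obtain s where s: "node c s v1" using node_ex assms by blast
  have ch: "head c t \<and> v1 < t \<and> level c t = Suc (level c v1)" if "child c v1 t" for t
    using that by (auto simp: child_def)
  obtain v where v: "child c v1 v" using has_child assms by blast
  have "\<exists>t. child c v1 t \<and> t < v2"
  proof (cases "v < v2")
    case True then show ?thesis using v by blast
  next
    case False
    have "\<exists>u. child c v1 u \<and> u \<le> v2"
    proof (cases "v = v2")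
      case True then show ?thesis using v by blast
    next
      case n: False
      show ?thesis
        by (rule ancestor_ex[OF assms]) (use v n False in \<open>auto simp: child_def\<close>)
    qed
    then obtain u where u: "child c v1 u" "u \<le> v2" by blast
    then obtain u' where "child c v1 u'" "u' < u"
      using meets_cutsD(2)[OF children_dense[OF s T_None], of u] by auto
    then show ?thesis using u by (intro exI[of _ u']) auto
  qed
  then show thesis using that ch by blast
qed

text \<open>Iterating \<open>head_between\<close> raises the level without bound. This will prevent
  a map that does not increase colours from spreading one block over several.\<close>

lemma high_head_between:
  assumes "head c v1" "head c v2" "v1 < v2"
  shows "\<exists>t. head c t \<and> v1 < t \<and> t < v2 \<and> m < level c t"
proof (induction m)
  case 0
  obtain t where "head c t" "v1 < t" "t < v2" "level c t = Suc (level c v1)" by (rule head_between[OF assms])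
  then show ?case by auto
next
  case (Suc m)
  then obtain t where t: "head c t" "v1 < t" "t < v2" "m < level c t" by blast
  obtain t' where "head c t'" "t < t'" "t' < v2" "level c t' = Suc (level c t)"
    by (rule head_between[OF t(1) assms(2) t(3)])
  then show ?case using t by (intro exI[of _ t']) auto
qed

lemma block_less:
  assumes "head c v" "head c v'" "block c v q" "block c v' q'" "v < v'"
  shows "q < q'"
proof -
  obtain t where t: "head c t" "v < t" "t < v'" using head_between assms(1,2,5) by metis
  have "q < t" using assms(3) t by (force simp: block_def)
  moreover have "t < q'" using assms(4) t by (force simp: block_def)
  ultimately show ?thesis by simp
qed

lemma block_unique:
  assumes "head c v" "head c v'" "block c v q" "block c v' q"
  shows "v = v'"
  using block_less[OF assms] block_less[OF assms(2,1,4,3)] by force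

lemma block_le:
  assumes "head c v" "head c v'" "block c v q" "block c v' q'" "q < q'"
  shows "v \<le> v'"
  using block_less[OF assms(2,1,4,3)] assms(5) by force

text \<open>Of two parents, the later one would lie between the earlier one and \<open>v\<close>,
  but both have the same level.\<close>

lemma parent_unique:
  assumes "child c u v" "child c u' v" shows "u = u'"
proof (rule ccontr)
  assume "u \<noteq> u'"
  then consider "u < u'" | "u' < u" by force
  then show False using assms by cases (auto simp: child_def)
qed

end

text \<open>The definition of density wants strict inequalities at the ends, so it is applied to a
  subinterval of \<open>(r0, r1)\<close>.\<close>

lemma dop_between:
  assumes "dense_order_preserving g" "g q0 \<le> r0" "r0 < r1" "r1 \<le> g q1"
  obtains q where "r0 < g q" "g q < r1" "q0 < q" "q < q1"
proof -
  obtain s where s: "r0 < s" "s < r1" using dense assms(3) by blast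
  obtain s' where s': "s < s'" "s' < r1" using dense s(2) by blast
  have "g q0 < s \<and> s < s' \<and> s' < g q1" using s s' assms by auto
  then obtain q where q: "s < g q" "g q < s'"
    using assms(1) unfolding dense_order_preserving_def by blast
  have "strict_mono g" using assms(1) by (simp add: dense_order_preserving_def)
  moreover have "g q0 < g q" "g q < g q1" using q s s' assms by auto
  ultimately have "q0 < q" "q < q1" by (auto simp: strict_mono_less)
  moreover have "r0 < g q" "g q < r1" using q s s' by simp_all
  ultimately show thesis using that by blast
qed

lemma rev_map_Suc: "rev (map f [0..<Suc n]) = f n # rev (map f [0..<n])"
  by simp

text \<open>A name that may extend the list of a node occurs among its children, so a path with
  prescribed names is continued forever by dependent choice.\<close>

lemma (in shaping) branch_nodes:
  assumes f: "\<And>n. T (rev (map f [0..<Suc n]))"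
  shows "\<exists>v. \<forall>n. node c (rev (map f [0..<n])) (v n) \<and> child c (v n) (v (Suc n)) \<and>
      has_word c (v (Suc n)) (word_of (Suc n) (f n))"
proof -
  let ?s = "\<lambda>n. rev (map f [0..<n])"
  have "\<exists>v. \<forall>n. node c (?s n) (v n) \<and> (child c (v n) (v (Suc n)) \<and>
      has_word c (v (Suc n)) (word_of (Suc n) (f n)))"
  proof (rule dependent_nat_choice)
    show "\<exists>x. node c (?s 0) x" using root_ex by auto
    fix v n assume v: "node c (?s n) v"
    have "T (f n # ?s n)" using f[of n] by simp
    from meets_cutsD(1)[OF children_dense[OF v this]] obtain v2
      where "child c v v2" "has_word c v2 (word_of (Suc n) (f n))" by auto
    then show "\<exists>y. node c (?s (Suc n)) y \<and> child c v y \<and> has_word c y (word_of (Suc n) (f n))"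
      using v unfolding rev_map_Suc by (intro exI[of _ v2]) auto
  qed
  then show ?thesis by blast
qed

section \<open>From maps that do not increase colours to maps of trees\<close>

locale shaping_pair = S: shaping c T + S': shaping c' T' for c T c' T'
begin

context
  fixes g
  assumes g: "dense_order_preserving g" and cg: "\<And>q. c q \<ge> c' (g q)"
begin

lemma g_mono: "g x < g y \<longleftrightarrow> x < y"
  using g by (simp add: dense_order_preserving_def strict_mono_less)

text \<open>Density yields two points \<open>x0 < x1\<close> whose images lie in the interval. Just
  after \<open>x0\<close> begins a stretch of background, and by monotonicity it is mapped into the
  interval as well.\<close>

lemma background_between:
  assumes "head c v" "block c v q0" "block c v q1" "g q0 \<le> r0" "r0 < r1" "r1 \<le> g q1"
  obtains x where "block c v x" "c x = 3 * level c v + 2" "r0 < g x" "g x < r1"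
proof -
  obtain x0 where x0: "r0 < g x0" "g x0 < r1" "q0 < x0" "x0 < q1" by (rule dop_between[OF g assms(4-6)])
  have "g x0 \<le> g x0" "g x0 < r1" by (use x0 in auto)
  then obtain x1 where x1: "g x0 < g x1" "g x1 < r1" "x0 < x1" "x1 < q1"
    using dop_between[OF g _ _ assms(6), of x0 "g x0"] by metis
  have b: "block c v x0" "block c v x1"
    using block_convex[OF assms(2,3)] x0 x1 by (meson less_imp_le less_trans)+
  obtain r where r: "x0 < r" "r \<le> x1" "\<And>x. x0 < x \<Longrightarrow> x < r \<Longrightarrow> block c v x \<and> c x = 3 * level c v + 2"
    using S.background_interval[OF assms(1) b x1(3)] by metis
  obtain x where x: "x0 < x" "x < r" using dense r(1) by blast
  then have "g x0 < g x" "g x < g x1" using g_mono r(2) by auto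
  then show thesis using that r(3) x x0 x1 by (meson less_trans)
qed

text \<open>If the images lay in different blocks, a block of level above that of \<open>v\<close>
  would lie between them. A stretch of its background would have to be hit by background of
  \<open>v\<close>, whose colour is smaller.\<close>

lemma image_in_block:
  assumes v: "head c v" "block c v q1" "block c v q2"
    and v': "head c' v1" "head c' v2" "block c' v1 (g q1)" "block c' v2 (g q2)" and "q1 < q2"
  shows "v1 = v2"
proof (rule ccontr)
  assume "v1 \<noteq> v2"
  have "v1 \<le> v2" using S'.block_le[OF v'] \<open>q1 < q2\<close> g_mono by simp
  with \<open>v1 \<noteq> v2\<close> have "v1 < v2" by simp
  from S'.high_head_between[OF v'(1,2) this] obtain t where
    t: "head c' t" "v1 < t" "t < v2" "level c v < level c' t" by blast
  obtain t2 where t2: "t < t2" "block c' t t2" using S'.block_upper[OF t(1) block_self] by blast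
  obtain r where r: "t < r" "r \<le> t2" "\<And>x. t < x \<Longrightarrow> x < r \<Longrightarrow> block c' t x \<and> c' x = 3 * level c' t + 2"
    using S'.background_interval[OF t(1) block_self t2(2,1)] by metis
  have le: "g q1 \<le> t" "r \<le> g q2"
    using S'.block_less[OF v'(1) t(1) v'(3) block_self t(2)]
      S'.block_less[OF t(1) v'(2) t2(2) v'(4) t(3)] r(2) by auto
  obtain x where "block c v x" "c x = 3 * level c v + 2" "t < g x" "g x < r"
    by (rule background_between[OF v le(1) r(1) le(2)])
  then show False using cg[of x] r(3)[of "g x"] t(4) by auto
qed

lemma image_block_ex:
  assumes v: "head c v"
  shows "\<exists>v'. head c' v' \<and> (\<forall>q. block c v q \<longrightarrow> block c' v' (g q))"
proof -
  obtain v' where v': "head c' v'" "block c' v' (g v)" using S'.cover by blast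
  have "block c' v' (g q)" if q: "block c v q" for q
  proof -
    obtain v2 where v2: "head c' v2" "block c' v2 (g q)" using S'.cover by blast
    consider "q = v" | "v < q" | "q < v" by force
    then have "v2 = v'"
    proof cases
      case 1
      then show ?thesis using S'.block_unique v' v2 by blast
    next
      case 2
      then show ?thesis using image_in_block[OF v block_self q v'(1) v2(1) v'(2) v2(2)] by simp
    next
      case 3
      then show ?thesis using image_in_block[OF v q block_self v2(1) v'(1) v2(2) v'(2)] by simp
    qed
    then show ?thesis using v2 by simp
  qed
  then show ?thesis using v' by blast
qed

text \<open>Some background point goes to a background point, so the level does not increase. Colour
  0 can only go to colour 0 and \<open>g\<close> is injective; hence, for the levels
  \<open>l\<close> and \<open>l'\<close>, \<open>3 * l + 1 \<le> 3 * l' + 3\<close> and thus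
  \<open>l \<le> l'\<close>.\<close>

lemma image_block_level:
  assumes v: "head c v" and v': "head c' v'" "\<And>q. block c v q \<Longrightarrow> block c' v' (g q)"
  shows "level c' v' = level c v"
    and "card {q. block c v q \<and> c q = 0} \<le> card {q. block c' v' q \<and> c' q = 0}"
proof -
  obtain q where q: "v < q" "block c v q" using S.block_upper[OF v block_self] by blast
  have b: "block c' v' (g v)" "block c' v' (g q)" using v'(2) q block_self by auto
  obtain r where r: "g v < r" "r \<le> g q" "\<And>x. g v < x \<Longrightarrow> x < r \<Longrightarrow> block c' v' x \<and> c' x = 3 * level c' v' + 2"
    using S'.background_interval[OF v'(1) b] q g_mono by metis
  obtain x where "block c v x" "c x = 3 * level c v + 2" "g v < g x" "g x < r"
    by (rule background_between[OF v block_self q(2) _ r(1,2)]) auto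
  then have le: "level c' v' \<le> level c v" using cg[of x] r(3)[of "g x"] by auto
  have "inj g" using g by (simp add: dense_order_preserving_def strict_mono_imp_inj_on)
  have "g ` {q. block c v q \<and> c q = 0} \<subseteq> {q. block c' v' q \<and> c' q = 0}"
  proof
    fix y assume "y \<in> g ` {q. block c v q \<and> c q = 0}"
    then obtain x where "block c v x" "c x = 0" "y = g x" by blast
    then show "y \<in> {q. block c' v' q \<and> c' q = 0}" using v'(2) cg[of x] by auto
  qed
  from card_mono[OF S'.zeros_bounds(1)[OF v'(1)] this]
  show card: "card {q. block c v q \<and> c q = 0} \<le> card {q. block c' v' q \<and> c' q = 0}"
    using card_image[OF inj_on_subset[OF \<open>inj g\<close> subset_UNIV], of "{q. block c v q \<and> c q = 0}"] by simp
  show "level c' v' = level c v"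
    using card S.zeros_bounds(2)[OF v] S'.zeros_bounds(3)[OF v'(1)] le by simp
qed

text \<open>Density places some \<open>g q\<close> in the block of any head \<open>t\<close> between
  \<open>u'\<close> and \<open>v'\<close>. The block \<open>w\<close> of \<open>q\<close> lies
  strictly between \<open>u\<close> and \<open>v\<close>, hence is deeper than \<open>u\<close>, and
  levels are preserved.\<close>

lemma image_child:
  assumes uv: "child c u v"
    and u': "head c' u'" "\<And>q. block c u q \<Longrightarrow> block c' u' (g q)"
    and v': "head c' v'" "\<And>q. block c v q \<Longrightarrow> block c' v' (g q)"
  shows "child c' u' v'"
proof -
  have u: "head c u" and v: "head c v" and "u < v" and l: "level c v = Suc (level c u)"
    using uv by (auto simp: child_def)
  have l': "level c' v' = Suc (level c' u')"
    using image_block_level(1)[OF u u'] image_block_level(1)[OF v v'] l by simp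
  have gu: "block c' u' (g u)" and gv: "block c' v' (g v)" using u' v' block_self by auto
  have "u' \<le> v'" using S'.block_le[OF u'(1) v'(1) gu gv] g_mono \<open>u < v\<close> by simp
  moreover have "u' \<noteq> v'" using l' by auto
  ultimately have "u' < v'" by simp
  moreover have "level c' u' < level c' t" if t: "head c' t" "u' < t" "t < v'" for t
  proof -
    obtain t2 where t2: "t < t2" "block c' t t2" using S'.block_upper[OF t(1) block_self] by blast
    have le: "g u \<le> t" "t2 \<le> g v"
      using S'.block_less[OF u'(1) t(1) gu block_self t(2)] S'.block_less[OF t(1) v'(1) t2(2) gv t(3)] by auto
    obtain q where q: "t < g q" "g q < t2" "u < q" "q < v" by (rule dop_between[OF g le(1) t2(1) le(2)])
    then have bt: "block c' t (g q)" using block_convex[OF block_self t2(2)] by simp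
    obtain w where w: "head c w" "block c w q" using S.cover by blast
    obtain w' where w': "head c' w'" "\<And>q. block c w q \<Longrightarrow> block c' w' (g q)"
      using image_block_ex[OF w(1)] by blast
    have wt: "w' = t" using S'.block_unique[OF w'(1) t(1) w'(2)[OF w(2)] bt] .
    have "u \<le> w" "w \<le> v"
      using S.block_le[OF u w(1) block_self w(2) q(3)] S.block_le[OF w(1) v w(2) block_self q(4)] by auto
    moreover have "w \<noteq> u"
    proof
      assume "w = u"
      then have "w' = u'" using S'.block_unique[OF w'(1) u'(1) w'(2)[OF w(2)]] u'(2) w(2) by blast
      then show False using wt t(2) by simp
    qed
    moreover have "w \<noteq> v"
    proof
      assume "w = v"
      then have "w' = v'" using S'.block_unique[OF w'(1) v'(1) w'(2)[OF w(2)]] v'(2) w(2) by blast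
      then show False using wt t(3) by simp
    qed
    ultimately have "level c u < level c w" using uv w(1) by (auto simp: child_def)
    then show ?thesis
      using image_block_level(1)[OF w(1) w'] image_block_level(1)[OF u u'] wt by simp
  qed
  ultimately show ?thesis using u'(1) v'(1) l' by (simp add: child_def)
qed

end

text \<open>Children go to children, so the blocks along a branch are mapped into blocks along a
  branch. Zero counts can only grow, because \<open>g\<close> is injective and sends zeros to
  zeros.\<close>

lemma branch_transfer:
  assumes "(c, c') \<in> dop_le (\<ge>)"
    and f: "\<And>n. T (rev (map f [0..<Suc n]))"
  shows "\<exists>f'. \<forall>n. T' (rev (map f' [0..<Suc n])) \<and>
    count_list (word_of (Suc n) (f n)) 0 \<le> count_list (word_of (Suc n) (f' n)) 0"
proof -
  obtain g where g: "dense_order_preserving g" "\<And>q. c q \<ge> c' (g q)"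
    using assms(1) by (auto simp: dop_le_def)
  obtain v where v: "\<And>n. node c (rev (map f [0..<n])) (v n)" "\<And>n. child c (v n) (v (Suc n))"
    "\<And>n. has_word c (v (Suc n)) (word_of (Suc n) (f n))"
    using S.branch_nodes[OF f] by blast
  have hv: "head c (v n)" for n using node_level[OF v(1)] by blast
  have "\<forall>n. \<exists>v'. head c' v' \<and> (\<forall>q. block c (v n) q \<longrightarrow> block c' v' (g q))"
    using image_block_ex[OF g hv] by blast
  then obtain v' where v': "\<And>n. head c' (v' n)" "\<And>n q. block c (v n) q \<Longrightarrow> block c' (v' n) (g q)"
    by metis
  have ch: "child c' (v' n) (v' (Suc n))" for n using image_child[OF g v(2) v' v'] .
  \<comment> \<open>The name lists are chosen dependently, so that each extends the previous one by
    an allowed name.\<close>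
  have "\<exists>S. \<forall>n. node c' (S n) (v' n) \<and> (\<exists>a. S (Suc n) = a # S n \<and> T' (a # S n))"
  proof (rule dependent_nat_choice)
    have "level c' (v' 0) = 0"
      using image_block_level(1)[OF g hv v', of 0] node_level[OF v(1), of 0] by simp
    then show "\<exists>s. node c' s (v' 0)" using v'(1) by (intro exI[of _ "[]"]) simp
    fix s n assume "node c' s (v' n)"
    from S'.node_Cons_T[OF this ch]
    show "\<exists>y. node c' y (v' (Suc n)) \<and> (\<exists>a. y = a # s \<and> T' (a # s))" by blast
  qed
  then obtain S where S: "\<And>n. node c' (S n) (v' n)" "\<And>n. \<exists>a. S (Suc n) = a # S n \<and> T' (a # S n)"
    by blast
  then obtain f' where f': "\<And>n. S (Suc n) = f' n # S n" "\<And>n. T' (f' n # S n)" by metis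
  \<comment> \<open>The image of the root has level 0, so the path of names starts with the empty
    list.\<close>
  have "length (S 0) = 0"
    using node_level[OF S(1)[of 0]] image_block_level(1)[OF g hv v', of 0] node_level[OF v(1)[of 0]] by simp
  then have Sn: "S n = rev (map f' [0..<n])" for n
    by (induction n) (auto simp: f'(1))
  have "count_list (word_of (Suc n) (f n)) 0 \<le> count_list (word_of (Suc n) (f' n)) 0" for n
  proof -
    have "has_word c' (v' (Suc n)) (word_of (Suc (length (S n))) (f' n))"
      using S(1)[of "Suc n"] f'(1) by simp
    then have w: "has_word c' (v' (Suc n)) (word_of (Suc n) (f' n))" by (simp add: Sn)
    show ?thesis
      using has_word_card[OF v(3) hv, of n] has_word_card[OF w v'(1)]
        image_block_level(2)[OF g hv v'(1) v'(2), of "Suc n" "Suc n"] by simp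
  qed
  then show ?thesis using f'(2) Sn by (intro exI[of _ f']) auto
qed

end

section \<open>From relations between trees to embeddings\<close>

lemma (in shaping) block_meets_cuts:
  assumes "head c v" shows "meets_cuts {q. block c v q} {q. block c v q}"
proof -
  have "\<exists>a. block c v a \<and> y < a \<and> a < y'" if y: "block c v y" "block c v y'" "y < y'" for y y'
  proof -
    obtain a where "y < a" "a < y'" using dense y(3) by blast
    then show ?thesis using block_convex[OF y(1,2), of a] by auto
  qed
  then show ?thesis
    using block_lower[OF assms] block_upper[OF assms] block_self unfolding meets_cuts_def by blast
qed

context shaping_pair
begin

text \<open>The heads are put in front of both lists of marks; equal levels give them the same
  colour. A block has only one head, so the head goes to the head.\<close>

lemma block_embedding:
  assumes v: "head c v" "has_word c v w" and v': "head c' v'" "has_word c' v' w'"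
    and "subseq w w'" and w': "\<forall>x\<in>set w'. x mod 3 = 0" and lv: "level c v = level c' v'"
  shows "\<exists>f. f ` {q. block c v q} \<subseteq> {q. block c' v' q} \<and> strict_mono_on {q. block c v q} f \<and>
    (\<forall>q. block c v q \<longrightarrow> c' (f q) = c q) \<and>
    {q. block c' v' q \<and> c' q = 3 * level c' v' + 2} \<subseteq> f ` {q. block c v q} \<and> f v = v'"
proof -
  obtain ps where ps: "sorted_wrt (<) (v # ps)" "map c ps = w" "\<forall>p\<in>set ps. block c v p"
    "\<forall>q. block c v q \<longrightarrow> q = v \<or> q \<in> set ps \<or> c q = 3 * level c v + 2"
    using v(2) by (rule has_wordE)
  obtain qs where qs: "sorted_wrt (<) (v' # qs)" "map c' qs = w'" "\<forall>p\<in>set qs. block c' v' p"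
    "\<forall>q. block c' v' q \<longrightarrow> q = v' \<or> q \<in> set qs \<or> c' q = 3 * level c' v' + 2"
    using v'(2) by (rule has_wordE)
  have "c v = 3 * (c v div 3) + 1" "c' v' = 3 * (c' v' div 3) + 1"
    using v(1) v'(1) unfolding head_def by presburger+
  then have cv: "c v = c' v'" using lv by (simp add: level_def)
  have hd: "x = v'" if "block c' v' x" "head c' x" for x
    using S'.block_unique[OF v'(1) that(2,1) block_self] ..
  have bg: "\<not> head c' x" if "c' x = 3 * level c' v' + 2" for x
    using that unfolding head_def by presburger
  have "\<exists>f. f ` {q. block c v q} \<subseteq> {q. block c' v' q} \<and> strict_mono_on {q. block c v q} f \<and>
    (\<forall>q\<in>{q. block c v q}. c' (f q) = c q) \<and>
    {q. block c' v' q} - set (v' # qs) \<subseteq> f ` {q. block c v q}"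
  proof (rule marked_order_embedding[where ps = "v # ps" and k = "3 * level c v + 2"])
    show "countable {q. block c v q}" "countable {q. block c' v' q}" by auto
    show "set (v # ps) \<subseteq> {q. block c v q}" "set (v' # qs) \<subseteq> {q. block c' v' q}"
      using ps(3) qs(3) block_self[of c v] block_self[of c' v'] by auto
    show "\<forall>x\<in>{q. block c v q} - set (v # ps). c x = 3 * level c v + 2" using ps(4) by auto
    show "\<forall>x\<in>{q. block c' v' q} - set (v' # qs). c' x = 3 * level c v + 2" using qs(4) lv by auto
    show "subseq (map c (v # ps)) (map c' (v' # qs))" using ps(2) qs(2) \<open>subseq w w'\<close> cv by simp
  qed (use ps(1) qs(1) S.block_meets_cuts[OF v(1)] S'.block_meets_cuts[OF v'(1)] in auto)
  then obtain f where f: "f ` {q. block c v q} \<subseteq> {q. block c' v' q}" "strict_mono_on {q. block c v q} f"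
    "\<And>q. block c v q \<Longrightarrow> c' (f q) = c q" "{q. block c' v' q} - set (v' # qs) \<subseteq> f ` {q. block c v q}"
    by auto
  have "head c' (f v)" using f(3)[OF block_self] v(1) by (simp add: head_def)
  moreover have "block c' v' (f v)" using f(1) block_self[of c v] by auto
  ultimately have fv: "f v = v'" using hd by simp
  \<comment> \<open>The points certain to be hit are those outside the list of marks. Marks never
    have the background colour, so all background points are among them.\<close>
  have ne: "c' x \<noteq> 3 * level c' v' + 2" if "x \<in> set (v' # qs)" for x
  proof (cases "x = v'")
    case True then show ?thesis using v'(1) bg by auto
  next
    case False
    then have x: "x \<in> set qs" using that by simp
    then have "c' x mod 3 = 0" using w' qs(2) by auto
    then show ?thesis by presburger
  qed
  then have "{q. block c' v' q \<and> c' q = 3 * level c' v' + 2} \<subseteq> f ` {q. block c v q}"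
    using f(4) by blast
  then show ?thesis using f(1-3) fv by blast
qed

text \<open>The words are quantified apart from the name lists, so that the root, which has a word
  but no name, is covered too.\<close>

definition related :: "(name list \<Rightarrow> name list \<Rightarrow> bool) \<Rightarrow> rat \<Rightarrow> rat \<Rightarrow> bool" where
  "related E u u' \<longleftrightarrow> (\<exists>s t. node c s u \<and> node c' t u' \<and> E s t) \<and> level c u = level c' u' \<and>
     (\<exists>a b. has_word c u (word_of (level c u) a) \<and> has_word c' u' (word_of (level c' u') b) \<and>
        subseq (word_of (level c u) a) (word_of (level c' u') b))"

text \<open>\<open>E\<close> is a bisimulation between the two trees under which words may grow from
  left to right.\<close>

context
  fixes E
  assumes E_Nil: "E [] []"
    and zig: "\<And>s t a. E s t \<Longrightarrow> T (a # s) \<Longrightarrow> \<exists>b. T' (b # t) \<and> E (a # s) (b # t) \<and>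
      subseq (word_of (Suc (length s)) a) (word_of (Suc (length t)) b)"
    and zag: "\<And>s t b. E s t \<Longrightarrow> T' (b # t) \<Longrightarrow> \<exists>a. T (a # s) \<and> E (a # s) (b # t) \<and>
      subseq (word_of (Suc (length s)) a) (word_of (Suc (length t)) b)"
begin

text \<open>\<open>zig\<close> or \<open>zag\<close> supplies a name for the partner, and the
  children with that name fill every cut. The children are thus matched bijectively even where
  \<open>E\<close> relates one name to many.\<close>

lemma children_matching:
  assumes "related E u u'"
  shows "\<exists>\<theta>. bij_betw \<theta> {v. child c u v} {v. child c' u' v} \<and> strict_mono_on {v. child c u v} \<theta> \<and>
    (\<forall>v\<in>{v. child c u v}. related E v (\<theta> v))"
proof -
  obtain s t where st: "node c s u" "node c' t u'" "E s t" and lu: "level c u = level c' u'"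
    using assms by (auto simp: related_def)
  have ls: "level c u = length s" and lt: "level c' u' = length t"
    using node_level[OF st(1)] node_level[OF st(2)] by auto
  have rel: "related E x y"
    if x: "child c u x" "has_word c x (word_of (Suc (length s)) a)"
      and y: "child c' u' y" "has_word c' y (word_of (Suc (length t)) b)"
      and ab: "E (a # s) (b # t)" "subseq (word_of (Suc (length s)) a) (word_of (Suc (length t)) b)"
    for x y a b
  proof -
    have n: "node c (a # s) x" "node c' (b # t) y" using st x y by auto
    have l: "level c x = Suc (length s)" "level c' y = Suc (length t)" using x y ls lt by (auto simp: child_def)
    show ?thesis unfolding related_def using n ab x(2) y(2) l ls lt lu by metis
  qed
  show ?thesis
  proof (rule back_and_forth)
    fix x and L U :: "rat set"
    assume x: "x \<in> {v. child c u v}"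
      and LU: "finite L" "finite U" "L \<subseteq> {v. child c' u' v}" "U \<subseteq> {v. child c' u' v}" "\<forall>l\<in>L. \<forall>u\<in>U. l < u"
    obtain a where a: "T (a # s)" "has_word c x (word_of (Suc (length s)) a)"
      using S.child_name[OF st(1)] x by blast
    obtain b where b: "T' (b # t)" "E (a # s) (b # t)"
      "subseq (word_of (Suc (length s)) a) (word_of (Suc (length t)) b)" using zig[OF st(3) a(1)] by blast
    obtain y where "y \<in> {v. child c' u' v \<and> has_word c' v (word_of (Suc (length t)) b)}"
      "\<forall>l\<in>L. l < y" "\<forall>u\<in>U. y < u"
      by (rule meets_cuts_between[OF S'.children_dense[OF st(2) b(1)] LU])
    then show "\<exists>y\<in>{v. child c' u' v}. related E x y \<and> (\<forall>l\<in>L. l < y) \<and> (\<forall>u\<in>U. y < u)"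
      using rel[OF _ a(2) _ _ b(2,3)] x by (intro bexI[of _ y]) auto
  next
    fix y and L U :: "rat set"
    assume y: "y \<in> {v. child c' u' v}"
      and LU: "finite L" "finite U" "L \<subseteq> {v. child c u v}" "U \<subseteq> {v. child c u v}" "\<forall>l\<in>L. \<forall>u\<in>U. l < u"
    obtain b where b: "T' (b # t)" "has_word c' y (word_of (Suc (length t)) b)"
      using S'.child_name[OF st(2)] y by blast
    obtain a where a: "T (a # s)" "E (a # s) (b # t)"
      "subseq (word_of (Suc (length s)) a) (word_of (Suc (length t)) b)" using zag[OF st(3) b(1)] by blast
    obtain x where "x \<in> {v. child c u v \<and> has_word c v (word_of (Suc (length s)) a)}"
      "\<forall>l\<in>L. l < x" "\<forall>u\<in>U. x < u"
      by (rule meets_cuts_between[OF S.children_dense[OF st(1) a(1)] LU])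
    then show "\<exists>x\<in>{v. child c u v}. related E x y \<and> (\<forall>l\<in>L. l < x) \<and> (\<forall>u\<in>U. x < u)"
      using rel[OF _ _ _ b(2) a(2,3)] y by (intro bexI[of _ x]) auto
  qed auto
qed

text \<open>Starting from the roots, the matchings of children are put together level by
  level.\<close>

lemma heads_matching:
  "\<exists>\<Phi>. (\<forall>v. head c v \<longrightarrow> head c' (\<Phi> v) \<and> related E v (\<Phi> v)) \<and>
    (\<forall>v1 v2. head c v1 \<longrightarrow> head c v2 \<longrightarrow> v1 < v2 \<longrightarrow> \<Phi> v1 < \<Phi> v2) \<and>
    (\<forall>v'. head c' v' \<longrightarrow> (\<exists>v. head c v \<and> \<Phi> v = v'))"
proof -
  obtain r where r: "head c r" "level c r = 0" "has_word c r (word_of 0 None)"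
    "\<And>v. head c v \<Longrightarrow> v = r \<or> r < v \<and> 0 < level c v" using S.root_ex by blast
  obtain r' where r': "head c' r'" "level c' r' = 0" "has_word c' r' (word_of 0 None)"
    "\<And>v. head c' v \<Longrightarrow> v = r' \<or> r' < v \<and> 0 < level c' v" using S'.root_ex by blast
  define par where "par v = (THE u. child c u v)" for v
  have par: "par v = u" if "child c u v" for u v
    unfolding par_def using that S.parent_unique by blast
  have "\<forall>u u'. \<exists>\<theta>. related E u u' \<longrightarrow> bij_betw \<theta> {v. child c u v} {v. child c' u' v} \<and>
    strict_mono_on {v. child c u v} \<theta> \<and> (\<forall>v\<in>{v. child c u v}. related E v (\<theta> v))"
    using children_matching by blast
  then obtain \<Theta> where \<Theta>: "\<And>u u'. related E u u' \<Longrightarrow> bij_betw (\<Theta> u u') {v. child c u v} {v. child c' u' v} \<and>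
    strict_mono_on {v. child c u v} (\<Theta> u u') \<and> (\<forall>v\<in>{v. child c u v}. related E v (\<Theta> u u' v))" by metis
  \<comment> \<open>Recursion on the level: \<open>F n\<close> is meaningful on heads of level
    \<open>n\<close> only, and the parent is one level lower.\<close>
  define F where "F = rec_nat (\<lambda>v. r') (\<lambda>n G v. \<Theta> (par v) (G (par v)) v)"
  define \<Phi> where "\<Phi> v = F (level c v) v" for v
  have \<Phi>_root: "\<Phi> v = r'" if "level c v = 0" for v using that by (simp add: \<Phi>_def F_def)
  have \<Phi>_child: "\<Phi> v = \<Theta> u (\<Phi> u) v" if "child c u v" for u v
    using that par[OF that] by (simp add: \<Phi>_def F_def child_def)
  have rel: "related E v (\<Phi> v)" if "head c v" for v
    using that
  proof (induction "level c v" arbitrary: v)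
    case 0
    then have "v = r" using r(4)[of v] by auto
    have "node c [] r" "node c' [] r'" using r(1,2) r'(1,2) by auto
    then have "related E r r'" unfolding related_def using E_Nil r r' by (metis subseq_order.order_refl)
    then show ?case using \<open>v = r\<close> \<Phi>_root r(2) by simp
  next
    case (Suc n)
    then obtain u where u: "child c u v" using S.parent_ex[of v] by auto
    then have "related E u (\<Phi> u)" using Suc by (auto simp: child_def)
    from \<Theta>[OF this] show ?case using \<Phi>_child[OF u] u by simp
  qed
  have lev: "level c' (\<Phi> v) = level c v" if "head c v" for v using rel[OF that] by (simp add: related_def)
  have \<Phi>_ch: "child c' (\<Phi> u) (\<Phi> v)" if uv: "child c u v" for u v
  proof -
    have "head c u" using uv by (simp add: child_def)
    from \<Theta>[OF rel[OF this]] show ?thesis using \<Phi>_child[OF uv] uv by (auto simp: bij_betw_def)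
  qed
  have \<Phi>_head: "head c' (\<Phi> v)" if "head c v" for v
    using rel[OF that] node_level unfolding related_def by blast
  have mono: "\<Phi> v1 < \<Phi> v2" if "head c v1" "head c v2" "v1 < v2" for v1 v2
    using that
  proof (induction "level c v1 + level c v2" arbitrary: v1 v2 rule: less_induct)
    case less
    have "0 < level c v2" using r(4)[OF less.prems(1)] r(4)[OF less.prems(2)] less.prems(3) by auto
    then obtain p2 where p2: "child c p2 v2" using S.parent_ex less.prems(2) by blast
    then have p2': "head c p2" "p2 < v2" "level c v2 = Suc (level c p2)" by (auto simp: child_def)
    \<comment> \<open>Compare \<open>v1\<close> with the parent \<open>p2\<close> of
      \<open>v2\<close>. If \<open>v1 \<le> p2\<close>, then
      \<open>\<Phi> v1 \<le> \<Phi> p2 < \<Phi> v2\<close>. Otherwise \<open>v1\<close> is a sibling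
      of \<open>v2\<close>, or it is deeper than \<open>v2\<close>; then, for its parent
      \<open>p1\<close>, the head \<open>\<Phi> v2\<close> has too small a level to lie between
      \<open>\<Phi> p1\<close> and \<open>\<Phi> v1\<close>.\<close>
    show ?case
    proof (cases "v1 \<le> p2")
      case True
      have "\<Phi> v1 \<le> \<Phi> p2"
        using less.hyps[of v1 p2] less.prems(1) p2' True by (cases "v1 = p2") auto
      then show ?thesis using \<Phi>_ch[OF p2] by (auto simp: child_def)
    next
      case False
      then have "level c p2 < level c v1" using p2 less.prems by (auto simp: child_def)
      show ?thesis
      proof (cases "level c v1 = level c v2")
        case True
        then have "child c p2 v1" using p2 less.prems False by (auto simp: child_def)
        moreover have "strict_mono_on {v. child c p2 v} (\<Theta> p2 (\<Phi> p2))"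
          using \<Theta>[OF rel[OF p2'(1)]] by blast
        ultimately have "\<Theta> p2 (\<Phi> p2) v1 < \<Theta> p2 (\<Phi> p2) v2"
          using p2 less.prems(3) by (auto simp: strict_mono_on_def)
        then show ?thesis using \<Phi>_child \<open>child c p2 v1\<close> p2 by simp
      next
        case neq: False
        then have gt: "level c v2 < level c v1" using p2'(3) \<open>level c p2 < level c v1\<close> by simp
        then obtain p1 where p1: "child c p1 v1" using S.parent_ex less.prems(1) by (metis less_nat_zero_code neq0_conv)
        then have p1': "head c p1" "p1 < v1" "level c v1 = Suc (level c p1)" by (auto simp: child_def)
        have "\<Phi> p1 < \<Phi> v2" using less.hyps[of p1 v2] less.prems p1' by auto
        moreover have "\<not> \<Phi> v2 < \<Phi> v1"
        proof
          assume "\<Phi> v2 < \<Phi> v1"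
          then have "level c' (\<Phi> p1) < level c' (\<Phi> v2)"
            using \<Phi>_ch[OF p1] \<open>\<Phi> p1 < \<Phi> v2\<close> \<Phi>_head[OF less.prems(2)] by (auto simp: child_def)
          then show False using gt p1'(1,3) less.prems lev by simp
        qed
        moreover have "\<Phi> v1 \<noteq> \<Phi> v2" using lev[OF less.prems(1)] lev[OF less.prems(2)] neq by auto
        ultimately show ?thesis by simp
      qed
    qed
  qed
  have surj: "\<exists>v. head c v \<and> \<Phi> v = v'" if "head c' v'" for v'
    using that
  proof (induction "level c' v'" arbitrary: v')
    case 0
    then have "v' = r'" using r'(4)[of v'] by auto
    then show ?case using \<Phi>_root r by blast
  next
    case (Suc n)
    then obtain u' where u': "child c' u' v'" using S'.parent_ex[of v'] by auto
    then have "head c' u'" "level c' u' = n" using Suc(2) by (auto simp: child_def)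
    then obtain u where u: "head c u" "\<Phi> u = u'" using Suc(1) by blast
    then have "v' \<in> \<Theta> u (\<Phi> u) ` {v. child c u v}" using \<Theta>[OF rel[OF u(1)]] u' by (auto simp: bij_betw_def)
    then obtain v where "child c u v" "v' = \<Theta> u (\<Phi> u) v" by blast
    then show ?case using \<Phi>_child by (intro exI[of _ v]) (auto simp: child_def)
  qed
  show ?thesis using \<Phi>_head rel mono surj by (intro exI[of _ \<Phi>]) blast
qed

text \<open>The block embeddings are glued along the matching of heads. An interval inside one block
  contains background, which is hit; any other interval contains a head, and every head is
  hit.\<close>

lemma embedding_transfer: "(c, c') \<in> dop_le (=)"
proof -
  obtain \<Phi> where \<Phi>: "\<And>v. head c v \<Longrightarrow> head c' (\<Phi> v)" "\<And>v. head c v \<Longrightarrow> related E v (\<Phi> v)"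
    and mono: "\<And>v1 v2. head c v1 \<Longrightarrow> head c v2 \<Longrightarrow> v1 < v2 \<Longrightarrow> \<Phi> v1 < \<Phi> v2"
    and surj: "\<And>v'. head c' v' \<Longrightarrow> \<exists>v. head c v \<and> \<Phi> v = v'"
    using heads_matching by blast
  have "\<exists>f. f ` {q. block c v q} \<subseteq> {q. block c' (\<Phi> v) q} \<and> strict_mono_on {q. block c v q} f \<and>
    (\<forall>q. block c v q \<longrightarrow> c' (f q) = c q) \<and>
    {q. block c' (\<Phi> v) q \<and> c' q = 3 * level c' (\<Phi> v) + 2} \<subseteq> f ` {q. block c v q} \<and> f v = \<Phi> v"
    if v: "head c v" for v
  proof -
    obtain a b where "has_word c v (word_of (level c v) a)" "has_word c' (\<Phi> v) (word_of (level c' (\<Phi> v)) b)"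
      "subseq (word_of (level c v) a) (word_of (level c' (\<Phi> v)) b)" "level c v = level c' (\<Phi> v)"
      using \<Phi>(2)[OF v] by (auto simp: related_def)
    then show ?thesis using block_embedding[OF v _ \<Phi>(1)[OF v]] word_of_mod by blast
  qed
  then have "\<forall>v. \<exists>f. head c v \<longrightarrow> (\<forall>q. block c v q \<longrightarrow> block c' (\<Phi> v) (f q)) \<and>
    strict_mono_on {q. block c v q} f \<and> (\<forall>q. block c v q \<longrightarrow> c' (f q) = c q) \<and>
    (\<forall>q'. block c' (\<Phi> v) q' \<and> c' q' = 3 * level c' (\<Phi> v) + 2 \<longrightarrow> (\<exists>q. block c v q \<and> f q = q')) \<and>
    f v = \<Phi> v"
    unfolding image_subset_iff subset_iff image_iff mem_Collect_eq Ball_def Bex_def by (metis (no_types))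
  then obtain f where "\<forall>v. head c v \<longrightarrow> (\<forall>q. block c v q \<longrightarrow> block c' (\<Phi> v) (f v q)) \<and>
    strict_mono_on {q. block c v q} (f v) \<and> (\<forall>q. block c v q \<longrightarrow> c' (f v q) = c q) \<and>
    (\<forall>q'. block c' (\<Phi> v) q' \<and> c' q' = 3 * level c' (\<Phi> v) + 2 \<longrightarrow> (\<exists>q. block c v q \<and> f v q = q')) \<and>
    f v v = \<Phi> v"
    unfolding choice_iff by blast
  then have f: "\<And>v q. head c v \<Longrightarrow> block c v q \<Longrightarrow> block c' (\<Phi> v) (f v q)"
    "\<And>v. head c v \<Longrightarrow> strict_mono_on {q. block c v q} (f v)"
    "\<And>v q. head c v \<Longrightarrow> block c v q \<Longrightarrow> c' (f v q) = c q"
    "\<And>v q'. head c v \<Longrightarrow> block c' (\<Phi> v) q' \<Longrightarrow> c' q' = 3 * level c' (\<Phi> v) + 2 \<Longrightarrow> \<exists>q. block c v q \<and> f v q = q'"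
    "\<And>v. head c v \<Longrightarrow> f v v = \<Phi> v"
    by blast+
  obtain own where own: "\<And>q. head c (own q)" "\<And>q. block c (own q) q"
    using S.cover by metis
  define g where "g q = f (own q) q" for q
  have g: "g q = f v q" if "head c v" "block c v q" for v q
    using S.block_unique[OF that(1) own(1) that(2) own(2)] by (simp add: g_def)
  have "g x < g y" if "x < y" for x y
  proof (cases "own x = own y")
    case True
    then show ?thesis using strict_mono_onD[OF f(2)[OF own(1)], of x x y] own(2)[of x] own(2)[of y] that
      by (simp add: g_def)
  next
    case False
    then have "own x < own y" using S.block_le[OF own(1) own(1) own(2) own(2) that] by simp
    then have "\<Phi> (own x) < \<Phi> (own y)" using mono own(1) by blast
    then show ?thesis unfolding g_def
      using S'.block_less[OF \<Phi>(1)[OF own(1)] \<Phi>(1)[OF own(1)] f(1)[OF own] f(1)[OF own]] by blast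
  qed
  then have "strict_mono g" by (simp add: strict_mono_def)
  moreover have "\<exists>q. r0 < g q \<and> g q < r1" if r01: "r0 < r1" for r0 r1
  proof -
    obtain v0 v1 where v: "head c' v0" "block c' v0 r0" "head c' v1" "block c' v1 r1"
      using S'.cover by metis
    have "v0 \<le> v1" using S'.block_le[OF v(1,3,2,4) r01] .
    show ?thesis
    proof (cases "v0 = v1")
      case True
      obtain r where r: "r0 < r" "r \<le> r1" "\<And>x. r0 < x \<Longrightarrow> x < r \<Longrightarrow> block c' v0 x \<and> c' x = 3 * level c' v0 + 2"
        using S'.background_interval[OF v(1,2) _ r01] v(4) True by metis
      obtain x where x: "r0 < x" "x < r" using dense r(1) by blast
      obtain w where w: "head c w" "\<Phi> w = v0" using surj v(1) by blast
      obtain q where "block c w q" "f w q = x" using f(4)[OF w(1), of x] r(3)[OF x] w(2) by blast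
      then have "g q = x" using g w(1) by simp
      then show ?thesis using x r(2) by (intro exI[of _ q]) simp
    next
      case False
      with \<open>v0 \<le> v1\<close> have "v0 < v1" by simp
      then obtain t where t: "head c' t" "v0 < t" "t < v1" using S'.head_between[OF v(1,3)] by blast
      obtain w where w: "head c w" "\<Phi> w = t" using surj t(1) by blast
      have "g w = t" using g[OF w(1) block_self] f(5)[OF w(1)] w(2) by simp
      then show ?thesis using S'.block_less[OF v(1) t(1) v(2) block_self t(2)]
          S'.block_less[OF t(1) v(3) block_self v(4) t(3)] by (intro exI[of _ w]) simp
    qed
  qed
  ultimately have "dense_order_preserving g" by (auto simp: dense_order_preserving_def)
  moreover have "c q = c' (g q)" for q using f(3)[OF own] by (simp add: g_def)
  ultimately show ?thesis by (auto simp: dop_le_def)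
qed

end

end

section \<open>Trees of approximate chains\<close>

text \<open>The number of zeros gives the status and the bit, and the remaining letters give the
  list by injectivity of \<open>to_nat\<close>.\<close>

lemma word_of_inj:
  assumes "word_of n a = word_of n b" shows "a = b"
proof -
  have cnt: "(case a of None \<Rightarrow> 1 | Some (b, l) \<Rightarrow> 2 + of_bool b) =
      (case b of None \<Rightarrow> 1 :: nat | Some (b, l) \<Rightarrow> 2 + of_bool b)"
    using arg_cong[OF assms, of "\<lambda>w. count_list w 0"] unfolding count_word_of by simp
  have inj: "inj (\<lambda>p :: bool \<times> nat. 3 * to_nat p + 3)" by (auto intro: injI)
  show ?thesis
  proof (cases a)
    case None
    then show ?thesis using cnt by (cases b) auto
  next
    case (Some p)
    obtain x l where p: "p = (x, l)" by fastforce
    obtain y m where b: "b = Some (y, m)"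
      using cnt Some p by (cases b) auto
    have "x = y" using cnt Some p b by (auto simp: of_bool_def split: if_splits)
    then have "map (\<lambda>p. 3 * to_nat p + 3) l = map (\<lambda>p. 3 * to_nat p + 3) m"
      using assms Some p b by (simp del: replicate.simps)
    then have "l = m" using inj by (simp add: inj_map_eq_map)
    then show ?thesis using Some p b \<open>x = y\<close> by simp
  qed
qed

text \<open>Dead blocks have the fewest zeros of their level and no other letters, so a dead child
  of the source can answer any child of the target.\<close>

lemma word_of_None_subseq: "subseq (word_of n None) (word_of n a)"
proof (cases a)
  case (Some p)
  obtain b l where "p = (b, l)" by fastforce
  then have "word_of n a = word_of n None @ replicate (1 + of_bool b) 0 @ map (\<lambda>p. 3 * to_nat p + 3) l"
    using Some by (simp add: replicate_add[symmetric] del: replicate.simps)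
  then show ?thesis by (metis list_emb_append2 list_emb_refl subseq_order.order_refl prefixI prefix_imp_subseq)
qed simp

lemma word_of_append_subseq: "subseq (word_of n (Some (b, l))) (word_of n (Some (b, l @ [p])))"
  by (rule prefix_imp_subseq) (simp del: replicate.simps)

type_synonym bits = "nat \<Rightarrow> bool"

text \<open>\<open>link\<close> and \<open>witness\<close> extract from a sequence of names the members and the witnesses of the chain
  of \<open>k\<close> links ending in \<open>z\<close>.\<close>

definition approx :: "(bits \<Rightarrow> bits \<Rightarrow> (nat \<Rightarrow> nat) \<Rightarrow> bool) \<Rightarrow> nat \<Rightarrow> bits \<Rightarrow> bits \<Rightarrow> (nat \<Rightarrow> nat) \<Rightarrow> bool" where
  "approx F n u v d \<longleftrightarrow> (\<exists>u' v' d'. F u' v' d' \<and> (\<forall>i<n. u i = u' i \<and> v i = v' i \<and> d i = d' i))"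

definition link :: "bits \<Rightarrow> nat \<Rightarrow> (nat \<Rightarrow> name) \<Rightarrow> nat \<Rightarrow> bits" where
  "link z k f j i = (if j < k then fst (snd (the (f i)) ! j) else z i)"

definition witness :: "(nat \<Rightarrow> name) \<Rightarrow> nat \<Rightarrow> nat \<Rightarrow> nat" where
  "witness f j i = snd (snd (the (f i)) ! j)"

text \<open>The common length \<open>k\<close> of the lists is the number of links of the chain.
  Only approximations of length \<open>n\<close> are required, so the condition depends on finitely
  many values, and a closed \<open>F\<close> holds in the limit along a branch.\<close>

definition alive :: "(bits \<Rightarrow> bits \<Rightarrow> (nat \<Rightarrow> nat) \<Rightarrow> bool) \<Rightarrow> bits \<Rightarrow> nat \<Rightarrow> (nat \<Rightarrow> name) \<Rightarrow> bool" where
  "alive F z n f \<longleftrightarrow> (\<exists>k. (\<forall>i<n. \<exists>b l. f i = Some (b, l) \<and> length l = k \<and> b = link z k f 0 i) \<and>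
     (\<forall>j<k. approx F n (link z k f j) (link z k f (Suc j)) (witness f j)))"

text \<open>\<open>alive\<close> requires all names to be live, so a dead name is followed by dead
  names only. The latest name stands first in the list, hence \<open>rev\<close>.\<close>

primrec admissible :: "(bits \<Rightarrow> bits \<Rightarrow> (nat \<Rightarrow> nat) \<Rightarrow> bool) \<Rightarrow> bits \<Rightarrow> name list \<Rightarrow> bool" where
  "admissible F z [] \<longleftrightarrow> True"
| "admissible F z (a # s) \<longleftrightarrow> a = None \<or> alive F z (Suc (length s)) (\<lambda>i. rev (a # s) ! i)"

lemma approx_mono: "approx F n u v d \<Longrightarrow> m \<le> n \<Longrightarrow> approx F m u v d"
  unfolding approx_def by (metis (full_types) order_less_le_trans)

lemma approx_cong:
  assumes "\<And>i. i < n \<Longrightarrow> u i = u' i" "\<And>i. i < n \<Longrightarrow> v i = v' i" "\<And>i. i < n \<Longrightarrow> d i = d' i"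
  shows "approx F n u v d \<longleftrightarrow> approx F n u' v' d'"
  using assms unfolding approx_def by simp

lemma alive_cong:
  assumes "\<And>i. i < n \<Longrightarrow> z i = z' i" "\<And>i. i < n \<Longrightarrow> f i = f' i"
  shows "alive F z n f \<longleftrightarrow> alive F z' n f'"
proof -
  have "link z k f j i = link z' k f' j i" "witness f j i = witness f' j i" if "i < n" for k j i
    using assms that by (auto simp: link_def witness_def)
  then have "approx F n (link z k f j) (link z k f (Suc j)) (witness f j) \<longleftrightarrow>
    approx F n (link z' k f' j) (link z' k f' (Suc j)) (witness f' j)" for k j
    by (intro approx_cong) auto
  moreover have "(\<forall>i<n. \<exists>b l. f i = Some (b, l) \<and> length l = k \<and> b = link z k f 0 i) \<longleftrightarrow>
    (\<forall>i<n. \<exists>b l. f' i = Some (b, l) \<and> length l = k \<and> b = link z' k f' 0 i)" for k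
    using assms by (auto simp: link_def)
  ultimately show ?thesis unfolding alive_def by simp
qed

lemma alive_mono: "alive F z n f \<Longrightarrow> m \<le> n \<Longrightarrow> alive F z m f"
  unfolding alive_def by (meson approx_mono order_less_le_trans)

lemma admissible_branch:
  "admissible F z (rev (map f [0..<Suc n])) \<longleftrightarrow> f n = None \<or> alive F z (Suc n) f"
proof -
  have "alive F z (Suc n) (\<lambda>i. rev (f n # rev (map f [0..<n])) ! i) \<longleftrightarrow> alive F z (Suc n) f"
    by (rule alive_cong) (auto simp: nth_append less_Suc_eq)
  then show ?thesis by simp
qed

text \<open>Records position \<open>i\<close> of a new last link, which leads from \<open>u\<close>
  with witness \<open>d\<close> to the new endpoint of the chain.\<close>

definition extend :: "bits \<Rightarrow> (nat \<Rightarrow> nat) \<Rightarrow> nat \<Rightarrow> name \<Rightarrow> name" where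
  "extend u d i a = map_option (\<lambda>(b, l). (b, l @ [(u i, d i)])) a"

text \<open>The chain gets one link more: the former endpoint \<open>u\<close> becomes the left end
  of link \<open>k\<close>, and \<open>v\<close> is the new endpoint.\<close>

lemma alive_extend:
  assumes F: "F u v d" and "alive F u n f"
  shows "alive F v n (\<lambda>i. extend u d i (f i))"
proof -
  let ?f = "\<lambda>i. extend u d i (f i)"
  obtain k where k: "\<And>i. i < n \<Longrightarrow> \<exists>b l. f i = Some (b, l) \<and> length l = k \<and> b = link u k f 0 i"
    "\<And>j. j < k \<Longrightarrow> approx F n (link u k f j) (link u k f (Suc j)) (witness f j)"
    using assms(2) unfolding alive_def by blast
  have lk: "link v (Suc k) ?f j i = link u k f j i" if ij: "i < n" "j \<le> k" for i j
  proof -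
    obtain b l where "f i = Some (b, l)" "length l = k" using k(1)[OF ij(1)] by blast
    then show ?thesis using ij(2) by (simp add: link_def extend_def nth_append)
  qed
  have lv: "link v (Suc k) ?f (Suc k) i = v i" for i by (simp add: link_def)
  have w: "witness ?f j i = (if j < k then witness f j i else d i)" if ij: "i < n" "j \<le> k" for i j
  proof -
    obtain b l where "f i = Some (b, l)" "length l = k" using k(1)[OF ij(1)] by blast
    then show ?thesis using ij(2) by (simp add: witness_def extend_def nth_append)
  qed
  show ?thesis unfolding alive_def
  proof (intro exI[of _ "Suc k"] conjI allI impI)
    fix i assume i: "i < n"
    then show "\<exists>b l. ?f i = Some (b, l) \<and> length l = Suc k \<and> b = link v (Suc k) ?f 0 i"
      using k(1)[OF i] lk[OF i, of 0] by (auto simp: extend_def)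
  next
    fix j assume "j < Suc k"
    show "approx F n (link v (Suc k) ?f j) (link v (Suc k) ?f (Suc j)) (witness ?f j)"
    proof (cases "j < k")
      case True
      then have "approx F n (link v (Suc k) ?f j) (link v (Suc k) ?f (Suc j)) (witness ?f j) \<longleftrightarrow>
          approx F n (link u k f j) (link u k f (Suc j)) (witness f j)"
        using lk w by (intro approx_cong) auto
      then show ?thesis using k(2) True by simp
    next
      case False
      then have j: "j = k" using \<open>j < Suc k\<close> by simp
      have "approx F n u v d" using F by (auto simp: approx_def)
      moreover have "approx F n (link v (Suc k) ?f j) (link v (Suc k) ?f (Suc j)) (witness ?f j) \<longleftrightarrow>
          approx F n u v d"
        using lk w lv j by (intro approx_cong) (auto simp: link_def)
      ultimately show ?thesis by simp
    qed
  qed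
qed

text \<open>Live names of the source are answered by \<open>extend\<close>, dead ones by dead ones;
  every name of the target is answered by the dead name of the source.\<close>

lemma coded_embedding:
  assumes c: "shaped c (admissible F u)" and c': "shaped c' (admissible F v)" and F: "F u v d"
  shows "(c, c') \<in> dop_le (=)"
proof -
  interpret shaping_pair c "admissible F u" c' "admissible F v"
    by unfold_locales (use c c' in auto)
  \<comment> \<open>While \<open>s\<close> is live, \<open>t\<close> is its extension; once
    \<open>s\<close> is dead, only the lengths have to agree.\<close>
  define E where "E s t \<longleftrightarrow> length s = length t \<and>
    (alive F u (length s) (\<lambda>i. rev s ! i) \<longrightarrow> (\<forall>i<length s. rev t ! i = extend u d i (rev s ! i)))" for s t
  have nth: "rev (a # s) ! i = (if i < length s then rev s ! i else a)" if "i < Suc (length s)" for a :: name and s i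
    using that by (auto simp: nth_append less_Suc_eq)
  have prev: "alive F u (length s) (\<lambda>i. rev s ! i)" if "alive F u (Suc (length s)) (\<lambda>i. rev (a # s) ! i)" for a s
  proof -
    have "alive F u (length s) (\<lambda>i. rev (a # s) ! i)" using alive_mono[OF that] by simp
    moreover have "alive F u (length s) (\<lambda>i. rev (a # s) ! i) \<longleftrightarrow> alive F u (length s) (\<lambda>i. rev s ! i)"
      by (rule alive_cong) (auto simp: nth_append)
    ultimately show ?thesis by simp
  qed
  have dead: "\<not> alive F z (Suc (length s)) (\<lambda>i. rev (None # s) ! i)" for z s
    unfolding alive_def using nth[of "length s" s None] by (metis less_Suc_eq less_irrefl option.distinct(1))
  have deadE: "E (None # s) (b # t)" if "E s t" for s t b
    using that dead[of u s] by (simp add: E_def)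
  show ?thesis
  proof (rule embedding_transfer[where E = E])
    show "E [] []" by (simp add: E_def)
  next
    fix s t a assume E: "E s t" and a: "admissible F u (a # s)"
    show "\<exists>b. admissible F v (b # t) \<and> E (a # s) (b # t) \<and>
        subseq (word_of (Suc (length s)) a) (word_of (Suc (length t)) b)"
    proof (cases "alive F u (Suc (length s)) (\<lambda>i. rev (a # s) ! i)")
      case False
      then have "a = None" using a by simp
      moreover have "length t = length s" using E by (simp add: E_def)
      ultimately show ?thesis using deadE[OF E, of None] by (intro exI[of _ None]) auto
    next
      case True
      let ?b = "extend u d (length s) a"
      have l: "length t = length s" using E by (simp add: E_def)
      have ti: "rev t ! i = extend u d i (rev s ! i)" if "i < length s" for i
        using E prev[OF True] that by (auto simp: E_def)
      have bi: "rev (?b # t) ! i = extend u d i (rev (a # s) ! i)" if "i < Suc (length s)" for i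
        using that ti l by (auto simp: nth_append less_Suc_eq)
      have "alive F v (Suc (length s)) (\<lambda>i. extend u d i (rev (a # s) ! i))"
        by (rule alive_extend[of F, OF F True])
      then have "alive F v (Suc (length t)) (\<lambda>i. rev (?b # t) ! i)"
        unfolding l by (subst alive_cong[where z' = v and f' = "\<lambda>i. extend u d i (rev (a # s) ! i)"]) (use bi in auto)
      then have "admissible F v (?b # t)" by simp
      moreover have "E (a # s) (?b # t)" unfolding E_def using l bi by simp
      moreover have "subseq (word_of (Suc (length s)) a) (word_of (Suc (length t)) ?b)"
        unfolding l by (cases a) (auto simp: extend_def word_of_append_subseq simp del: word_of.simps)
      ultimately show ?thesis by blast
    qed
  next
    fix s t b assume E: "E s t" and "admissible F v (b # t)"
    have "length t = length s" using E by (simp add: E_def)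
    then show "\<exists>a. admissible F u (a # s) \<and> E (a # s) (b # t) \<and>
        subseq (word_of (Suc (length s)) a) (word_of (Suc (length t)) b)"
      using deadE[OF E] word_of_None_subseq by (intro exI[of _ None]) (simp del: word_of.simps)
  qed
qed

lemma alive_constant: "alive F u n (\<lambda>i. Some (u i, []))"
  unfolding alive_def by (intro exI[of _ 0]) (auto simp: link_def)

text \<open>The branch of the chain without links at \<open>u\<close> goes to a branch of live names
  in the tree of \<open>v\<close>, which is a genuine chain ending in \<open>v\<close>. Its first
  member dominates \<open>u\<close> bitwise and so equals \<open>u\<close> by
  \<open>antichain\<close>.\<close>

lemma coded_reflection:
  assumes c: "shaped c (admissible F u)" and c': "shaped c' (admissible F v)"
    and le: "(c, c') \<in> dop_le (\<ge>)"
    and closed: "\<And>u v d. (\<And>n. approx F n u v d) \<Longrightarrow> F u v d"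
    and F: "\<And>u v d. F u v d \<Longrightarrow> (u, v) \<in> R"
    and R: "preorder_on A R" and uv: "u \<in> A" "v \<in> A"
    and antichain: "\<And>u v. u \<in> A \<Longrightarrow> v \<in> A \<Longrightarrow> (\<And>i. u i \<Longrightarrow> v i) \<Longrightarrow> u = v"
  shows "(u, v) \<in> R"
proof -
  interpret shaping_pair c "admissible F u" c' "admissible F v"
    by unfold_locales (use c c' in auto)
  have "admissible F u (rev (map (\<lambda>i. Some (u i, [])) [0..<Suc n]))" for n
    unfolding admissible_branch using alive_constant by simp
  from branch_transfer[OF le this] obtain f where f: "\<And>n. admissible F v (rev (map f [0..<Suc n]))"
    "\<And>n. count_list (word_of (Suc n) (Some (u n, []))) 0 \<le> count_list (word_of (Suc n) (f n)) 0" by blast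
  \<comment> \<open>A live word has more zeros than the dead word of its level, so no dead name is
    reached.\<close>
  have nn: "f n \<noteq> None" for n using f(2)[of n] unfolding count_word_of by (auto split: option.splits)
  have al: "alive F v (Suc n) f" for n using f(1)[of n] nn[of n] unfolding admissible_branch by simp
  define b where "b n = fst (the (f n))" for n
  define l where "l n = snd (the (f n))" for n
  have fn: "f n = Some (b n, l n)" for n using nn[of n] by (auto simp: b_def l_def)
  \<comment> \<open>Between live names of one level, comparing zero counts means comparing
    bits.\<close>
  have ub: "u n \<Longrightarrow> b n" for n using f(2)[of n] unfolding count_word_of fn by (auto simp: of_bool_def split: if_splits)
  \<comment> \<open>The first name already fixes the number of links, so the numbers obtained for
    all \<open>n\<close> coincide.\<close>
  define k where "k = length (l 0)"
  have k: "length (l n) = k \<and> b n = link v k f 0 n \<and>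
      (\<forall>j<k. approx F (Suc n) (link v k f j) (link v k f (Suc j)) (witness f j))" for n
  proof -
    obtain k' where k': "\<And>i. i < Suc n \<Longrightarrow> length (l i) = k' \<and> b i = link v k' f 0 i"
      "\<And>j. j < k' \<Longrightarrow> approx F (Suc n) (link v k' f j) (link v k' f (Suc j)) (witness f j)"
      using al[of n] unfolding alive_def fn by auto
    have "k' = k" using k'(1)[of 0] by (simp add: k_def)
    then show ?thesis using k'(1)[of n] k'(2) by auto
  qed
  have step: "(link v k f j, link v k f (Suc j)) \<in> R" if "j < k" for j
  proof (rule F, rule closed)
    fix n
    show "approx F n (link v k f j) (link v k f (Suc j)) (witness f j)"
      using k[of n] that approx_mono[of F "Suc n"] by simp
  qed
  have linkk: "link v k f k = v" by (auto simp: link_def)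
  have "(link v k f j, v) \<in> R" if "j \<le> k" for j
    using that
  proof (induction rule: inc_induct)
    case base
    then show ?case using R uv linkk by (auto simp: preorder_on_def refl_on_def)
  next
    case (step j)
    then show ?case using \<open>\<And>j. j < k \<Longrightarrow> (link v k f j, link v k f (Suc j)) \<in> R\<close> R
      by (meson preorder_on_def transD)
  qed
  then have 0: "(link v k f 0, v) \<in> R" by simp
  \<comment> \<open>Related points lie in \<open>A\<close>, so the antichain condition applies to
    the first member.\<close>
  then have "link v k f 0 \<in> A" using R by (auto simp: preorder_on_def)
  then have "u = link v k f 0" using antichain uv(1) ub k by simp
  then show ?thesis using 0 by simp
qed

text \<open>The bits of a code occur as the bits of the chain without links.\<close>

definition decode :: "(rat \<Rightarrow> nat) \<Rightarrow> bits" where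
  "decode c i \<longleftrightarrow> (\<exists>v. head c v \<and> level c v = Suc i \<and> has_word c v (word_of (Suc i) (Some (True, []))))"

text \<open>The trivial chain is a branch of the tree and is realised in \<open>c\<close>.
  Conversely, the empty list in the name forces \<open>k = 0\<close>, and then the bit of the name
  is that of \<open>z\<close>.\<close>

lemma decode_shaped:
  assumes "shaped c (admissible F z)" shows "decode c = z"
proof
  fix i
  interpret shaping c "admissible F z" by unfold_locales (use assms in auto)
  show "decode c i = z i"
  proof
    assume "z i"
    have "admissible F z (rev (map (\<lambda>i. Some (z i, [])) [0..<Suc n]))" for n
      unfolding admissible_branch using alive_constant by simp
    from branch_nodes[OF this] obtain v where
      v: "node c (rev (map (\<lambda>i. Some (z i, [])) [0..<Suc i])) (v (Suc i))"
        "has_word c (v (Suc i)) (word_of (Suc i) (Some (z i, [])))" by blast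
    then show "decode c i" using node_level[OF v(1)] \<open>z i\<close> unfolding decode_def
      by (intro exI[of _ "v (Suc i)"]) auto
  next
    assume "decode c i"
    then obtain v where v: "head c v" "level c v = Suc i" "has_word c v (word_of (Suc i) (Some (True, [])))"
      by (auto simp: decode_def)
    obtain u where u: "child c u v" using parent_ex[OF v(1)] v(2) by (metis zero_less_Suc)
    then have "head c u" "level c u = i" using v by (auto simp: child_def)
    then obtain s where s: "node c s u" "length s = i" using node_ex node_level by metis
    obtain a where a: "admissible F z (a # s)" "has_word c v (word_of (Suc i) a)"
      using child_name[OF s(1) u] s(2) by auto
    have "word_of (Suc i) a = word_of (Suc i) (Some (True, []))"
      by (rule has_word_unique[OF a(2) v(3,1)]) (use word_of_mod in blast)
    then have "a = Some (True, [])" by (rule word_of_inj)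
    then have "alive F z (Suc i) (\<lambda>j. rev (a # s) ! j)" and last: "rev (a # s) ! i = Some (True, [])"
      using a(1) s(2) by (auto simp: nth_append)
    then obtain k where "\<forall>j<Suc i. \<exists>b l. rev (a # s) ! j = Some (b, l) \<and> length l = k \<and>
        b = link z k (\<lambda>j. rev (a # s) ! j) 0 j"
      unfolding alive_def by (elim exE conjE) (rule that)
    then have "\<exists>b l. rev (a # s) ! i = Some (b, l) \<and> length l = k \<and>
        b = link z k (\<lambda>j. rev (a # s) ! j) 0 i"
      by (drule_tac spec[where x = i]) simp
    then have "k = 0" "link z k (\<lambda>j. rev (a # s) ! j) 0 i"
      unfolding last by auto
    then show "z i" by (auto simp: link_def)
  qed
qed

section \<open>Realising a tree by a colouring\<close>

context
  fixes h :: "'p::linorder \<Rightarrow> 'q::linorder" and c :: "'q \<Rightarrow> nat"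
  assumes bij: "bij h" and mono: "strict_mono h"
begin

lemma all_image: "(\<forall>y. P y) \<longleftrightarrow> (\<forall>x. P (h x))"
  using bij by (metis bij_pointE)

lemma ex_image: "(\<exists>y. P y) \<longleftrightarrow> (\<exists>x. P (h x))"
  using bij by (metis bij_pointE)

lemma ex_list_image: "(\<exists>ps. P ps) \<longleftrightarrow> (\<exists>ps. P (map h ps))"
proof
  assume "\<exists>ps. P ps"
  then obtain ps where "P ps" by blast
  moreover have "map h (map (inv h) ps) = ps"
    using bij by (induction ps) (auto simp: bij_is_surj surj_f_inv_f)
  ultimately show "\<exists>ps. P (map h ps)" by metis
qed blast

lemma image_order: "h x < h y \<longleftrightarrow> x < y" "h x \<le> h y \<longleftrightarrow> x \<le> y" "h x = h y \<longleftrightarrow> x = y"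
  using mono by (auto simp: strict_mono_less strict_mono_less_eq strict_mono_eq)

lemma head_image: "head (c \<circ> h) v \<longleftrightarrow> head c (h v)"
  by (simp add: head_def)

lemma level_image: "level (c \<circ> h) v = level c (h v)"
  by (simp add: level_def)

lemma block_image: "block (c \<circ> h) v q \<longleftrightarrow> block c (h v) (h q)"
  unfolding block_def by (simp add: all_image head_image image_order)

lemma has_word_image: "has_word (c \<circ> h) v w \<longleftrightarrow> has_word c (h v) w"
  unfolding has_word_def ex_list_image
  by (simp add: all_image block_image image_order level_image sorted_wrt_map image_iff)

lemma child_image: "child (c \<circ> h) u v \<longleftrightarrow> child c (h u) (h v)"
  unfolding child_def by (simp add: all_image head_image image_order level_image)

lemma node_image: "node (c \<circ> h) s v \<longleftrightarrow> node c s (h v)"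
  by (induction s arbitrary: v)
    (simp_all add: ex_image head_image level_image has_word_image child_image)

text \<open>Quantifiers over points and lists of points move along \<open>h\<close>. This serves
  both to pass from \<open>point\<close> to the rationals and to show invariance under
  isomorphism.\<close>

lemma shaped_image: "shaped (c \<circ> h) T \<longleftrightarrow> shaped c T"
proof -
  have m: "meets_cuts {v. child c u v \<and> has_word c v w} {v. child c u v} \<longleftrightarrow>
      meets_cuts {v. child c u (h v) \<and> has_word c (h v) w} {v. child c u (h v)}" for u w
    unfolding meets_cuts_def by (simp add: set_eq_iff Ball_def Bex_def all_image ex_image image_order)
  have ch: "child (c \<circ> h) u = (\<lambda>v. child c (h u) (h v))" for u
    by (rule ext) (rule child_image)
  show ?thesis
    unfolding shaped_def
    by (simp add: all_image ex_image head_image level_image has_word_image ch node_image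
      block_image image_order m)
qed

end

section \<open>The lexicographic order of addressed points\<close>

datatype point = Point "rat list" rat

instance point :: countable
  by countable_datatype

instantiation point :: linorder
begin

text \<open>\<open>Point s e\<close> is position \<open>e\<close> in the block with address
  \<open>s\<close>. A list precedes its proper extensions, so a block precedes the blocks of its
  descendants.\<close>

definition less_point :: "point \<Rightarrow> point \<Rightarrow> bool" where
  "less_point x y = (case (x, y) of (Point s e, Point t f) \<Rightarrow> s < t \<or> s = t \<and> e < f)"

definition less_eq_point :: "point \<Rightarrow> point \<Rightarrow> bool" where
  "less_eq_point x y \<longleftrightarrow> x < y \<or> x = y"

instance
  by standard (auto simp: less_point_def less_eq_point_def split: point.splits)

end

lemma Point_less: "Point s e < Point t f \<longleftrightarrow> s < t \<or> s = t \<and> e < f"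
  by (simp add: less_point_def)

lemma Point_le: "Point s e \<le> Point t f \<longleftrightarrow> s < t \<or> s = t \<and> e \<le> f"
  by (auto simp add: less_point_def less_eq_point_def)

lemma point_isomorphism: "\<exists>h :: rat \<Rightarrow> point. bij h \<and> strict_mono h"
proof -
  have "meets_cuts (UNIV :: rat set) UNIV"
    by (auto simp: meets_cuts_def dense intro: lt_ex gt_ex)
  moreover have "meets_cuts (UNIV :: point set) UNIV"
    unfolding meets_cuts_def
  proof (intro conjI ballI impI)
    fix x y :: point
    obtain s e t f where xy: "x = Point s e" "y = Point t f" by (metis point.exhaust)
    show "\<exists>a\<in>UNIV. a < x" by (rule bexI[of _ "Point s (e - 1)"]) (simp_all add: xy Point_less)
    show "\<exists>a\<in>UNIV. x < a" by (rule bexI[of _ "Point s (e + 1)"]) (simp_all add: xy Point_less)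
    assume "x < y"
    then show "\<exists>a\<in>UNIV. x < a \<and> a < y"
    proof (cases "s = t")
      case True
      then obtain d where "e < d" "d < f" using \<open>x < y\<close> xy dense by (auto simp: Point_less)
      then show ?thesis using True by (auto simp: xy Point_less intro!: exI[of _ "Point s d"])
    next
      case False
      then show ?thesis using \<open>x < y\<close> by (auto simp: xy Point_less intro!: exI[of _ "Point s (e + 1)"])
    qed
  qed auto
  ultimately show ?thesis
    using cantor_isomorphism[of "UNIV :: rat set" "UNIV :: point set"] by auto
qed

lemma list_less_cases:
  fixes s t :: "'a::order list"
  assumes "s < t"
  obtains q r where "t = s @ q # r" | p a b x y where "s = p @ a # x" "t = p @ b # y" "a < b"
  using assms unfolding list_less_def lexord_def by auto

lemma append_less_iff: "p @ x < p @ (y :: 'a::order list) \<longleftrightarrow> x < y"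
  by (induction p) auto

lemma list_less_snoc: "s < s @ [q :: 'a::order]"
  using append_less_iff[of s "[]" "[q]"] by simp

text \<open>If \<open>t\<close> extends \<open>s\<close> by a tail starting with \<open>q\<close>,
  append \<open>q - 1\<close> to \<open>s\<close>. If the lists differ at some place, every
  extension of \<open>s\<close> stays below \<open>t\<close>.\<close>

lemma list_dense:
  fixes s t :: "rat list"
  assumes "s < t"
  shows "\<exists>r. s < r \<and> r < t"
  using assms
proof (cases rule: list_less_cases)
  case (1 q r)
  then show ?thesis using append_less_iff[of s "[]" "[q - 1]"] append_less_iff[of s "[q - 1]" "q # r"]
    by (intro exI[of _ "s @ [q - 1]"]) auto
next
  case (2 p a b x y)
  then show ?thesis using list_less_snoc[of s 0] append_less_iff[of p "a # x @ [0]" "b # y"]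
    by (intro exI[of _ "s @ [0]"]) auto
qed

text \<open>Shade the dyadic rational \<open>m / 2\<^sup>j\<close> with \<open>m\<close> odd by the first component of the pair coded by \<open>j\<close>.\<close>

lemma dyadic_shade:
  "\<exists>\<nu> :: rat \<Rightarrow> nat. \<forall>k a b. a < b \<longrightarrow> (\<exists>q. a < q \<and> q < b \<and> \<nu> q = k)"
proof -
  have uniq: "i = j" if "odd m" "odd n" "of_int m / 2 ^ i = (of_int n / 2 ^ j :: rat)" for m n :: int and i j :: nat
  proof -
    have *: "i \<le> j" if "odd n" "of_int m / 2 ^ i = (of_int n / 2 ^ j :: rat)" "odd m" for m n :: int and i j :: nat
    proof (rule ccontr)
      assume "\<not> i \<le> j"
      then obtain d where d: "i = j + Suc d" using less_iff_Suc_add[of j i] by auto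
      have "(of_int m :: rat) = of_int n * 2 ^ Suc d"
        using that(2) by (simp add: d power_add field_simps)
      also have "\<dots> = of_int (n * 2 ^ Suc d)" by simp
      finally have "m = n * 2 ^ Suc d" by (simp only: of_int_eq_iff)
      then show False using that(3) by simp
    qed
    show ?thesis using *[of n m i j] *[of m n j i] that by simp
  qed
  define \<nu> where "\<nu> q = fst (prod_decode (THE j. \<exists>m :: int. odd m \<and> q = of_int m / 2 ^ j))" for q :: rat
  have "\<exists>q. a < q \<and> q < b \<and> \<nu> q = k" if "a < b" for a b k
  proof -
    \<comment> \<open>The second component \<open>i\<close> makes the code \<open>j\<close> so large
      that \<open>(a, b)\<close> scaled by \<open>2 ^ j\<close> is longer than 3 and contains the
      odd integer \<open>m\<close>.\<close>
    obtain i :: nat where i: "3 / (b - a) < of_nat i" using reals_Archimedean2 by blast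
    define j where "j = prod_encode (k, i)"
    have "(of_nat i :: rat) \<le> of_nat j" by (simp add: j_def le_prod_encode_2)
    also have "\<dots> < (2 :: rat) ^ j" by (rule of_nat_less_two_power)
    finally have "(of_nat i :: rat) < 2 ^ j" .
    with i have "3 / (b - a) < 2 ^ j" by (rule less_trans)
    then have w: "3 < (b - a) * 2 ^ j" using that by (simp add: field_simps)
    define m where "m = 2 * \<lfloor>a * 2 ^ j / 2\<rfloor> + 3"
    have "of_int \<lfloor>a * 2 ^ j / 2\<rfloor> \<le> a * 2 ^ j / 2" "a * 2 ^ j / 2 < of_int \<lfloor>a * 2 ^ j / 2\<rfloor> + 1"
      by linarith+
    then have "a * 2 ^ j < of_int m" "of_int m < b * 2 ^ j" using w by (auto simp: m_def algebra_simps)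
    then have "a < of_int m / 2 ^ j" "of_int m / 2 ^ j < b" by (simp_all add: field_simps)
    moreover have "odd m" by (simp add: m_def)
    then have "(THE j'. \<exists>m' :: int. odd m' \<and> (of_int m / 2 ^ j :: rat) = of_int m' / 2 ^ j') = j"
      using uniq by (intro the_equality) blast+
    then have "\<nu> (of_int m / 2 ^ j) = k" by (simp add: \<nu>_def j_def)
    ultimately show ?thesis by blast
  qed
  then show ?thesis by blast
qed


definition shade :: "rat \<Rightarrow> nat" where
  "shade = (SOME \<nu>. \<forall>k a b. a < b \<longrightarrow> (\<exists>q. a < q \<and> q < b \<and> \<nu> q = k))"

lemma shade_dense: "a < b \<Longrightarrow> \<exists>q. a < q \<and> q < b \<and> shade q = k"
  using someI_ex[OF dyadic_shade] unfolding shade_def by blast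

text \<open>Codes of names that are not allowed fall back on the dead name. If that one is always
  allowed, every child receives an allowed name, and each allowed name is picked at its own
  code.\<close>

definition pick :: "(name list \<Rightarrow> bool) \<Rightarrow> name list \<Rightarrow> nat \<Rightarrow> name" where
  "pick T s k = (if T (from_nat k # s) then from_nat k else None)"

definition path_names :: "(name list \<Rightarrow> bool) \<Rightarrow> rat list \<Rightarrow> name list" where
  "path_names T \<tau> = fold (\<lambda>q s. pick T s (shade q) # s) \<tau> []"

definition letters :: "(name list \<Rightarrow> bool) \<Rightarrow> rat list \<Rightarrow> nat list" where
  "letters T \<tau> = (case path_names T \<tau> of [] \<Rightarrow> word_of 0 None | a # s \<Rightarrow> word_of (Suc (length s)) a)"

text \<open>Position 0 of a block is its head, so the letters start at position 1 and
  \<open>nat \<lfloor>e\<rfloor> - 1\<close> turns a position into an index.\<close>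

fun tree_colouring :: "(name list \<Rightarrow> bool) \<Rightarrow> point \<Rightarrow> nat" where
  "tree_colouring T (Point \<tau> e) =
     (if e = 0 then 3 * length \<tau> + 1
      else if \<exists>i<length (letters T \<tau>). e = of_nat (Suc i) then letters T \<tau> ! (nat \<lfloor>e\<rfloor> - 1)
      else 3 * length \<tau> + 2)"

lemma path_names_Nil: "path_names T [] = []"
  by (simp add: path_names_def)

lemma path_names_snoc: "path_names T (\<tau> @ [q]) = pick T (path_names T \<tau>) (shade q) # path_names T \<tau>"
  by (simp add: path_names_def)

lemma length_path_names: "length (path_names T \<tau>) = length \<tau>"
  by (induction \<tau> rule: rev_induct) (simp_all add: path_names_Nil path_names_snoc)

lemma letters_mod: "x \<in> set (letters T \<tau>) \<Longrightarrow> x mod 3 = 0"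
  using word_of_mod by (cases "path_names T \<tau>") (auto simp: letters_def simp del: word_of.simps)

lemma tree_colouring_letter:
  "i < length (letters T \<tau>) \<Longrightarrow> tree_colouring T (Point \<tau> (of_nat (Suc i))) = letters T \<tau> ! i"
proof -
  assume i: "i < length (letters T \<tau>)"
  have "nat \<lfloor>of_nat (Suc i) :: rat\<rfloor> - 1 = i" by (metis diff_Suc_1 floor_of_nat nat_int)
  moreover have "(of_nat (Suc i) :: rat) \<noteq> 0" by (metis of_nat_eq_0_iff nat.distinct(1))
  ultimately show ?thesis using i by (metis tree_colouring.simps)
qed

lemma head_tree_colouring: "head (tree_colouring T) x \<longleftrightarrow> (\<exists>\<tau>. x = Point \<tau> 0)"
proof (cases x)
  case (Point \<tau> e)
  have "tree_colouring T (Point \<tau> e) mod 3 \<noteq> 1" if "e \<noteq> 0"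
  proof (cases "\<exists>i<length (letters T \<tau>). e = of_nat (Suc i)")
    case True
    then obtain i where i: "i < length (letters T \<tau>)" "e = of_nat (Suc i)" by blast
    then show ?thesis using tree_colouring_letter[OF i(1)] letters_mod[of "letters T \<tau> ! i" T \<tau>] by simp
  next
    case False
    then have "tree_colouring T (Point \<tau> e) = 3 * length \<tau> + 2" using that by (simp only: tree_colouring.simps if_False)
    then show ?thesis by presburger
  qed
  moreover have "(3 * length \<tau> + 1) mod 3 = 1" by presburger
  ultimately show ?thesis using Point by (auto simp: head_def)
qed

lemma level_tree_colouring: "level (tree_colouring T) (Point \<tau> 0) = length \<tau>"
  by (simp add: level_def)

text \<open>Between two different addresses there is a third one, and its head separates the
  blocks.\<close>

lemma block_tree_colouring: "block (tree_colouring T) (Point \<tau> 0) x \<longleftrightarrow> (\<exists>e. x = Point \<tau> e)"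
proof (cases x)
  case (Point \<sigma> e)
  have "\<not> block (tree_colouring T) (Point \<tau> 0) (Point \<sigma> e)" if "\<tau> \<noteq> \<sigma>"
  proof -
    have "\<tau> < \<sigma> \<or> \<sigma> < \<tau>" using that by (meson linorder_neqE)
    then obtain \<rho> where "\<tau> < \<rho> \<and> \<rho> < \<sigma> \<or> \<sigma> < \<rho> \<and> \<rho> < \<tau>" using list_dense by blast
    then show ?thesis unfolding block_def head_tree_colouring
      by (auto simp: Point_le intro!: exI[of _ "Point \<rho> 0"])
  qed
  then show ?thesis
    using Point by (auto simp: block_def head_tree_colouring Point_le)
qed

lemma has_word_tree_colouring: "has_word (tree_colouring T) (Point \<tau> 0) (letters T \<tau>)"
proof -
  let ?w = "letters T \<tau>"
  let ?ps = "map (\<lambda>i. Point \<tau> (of_nat (Suc i))) [0..<length ?w]"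
  have "sorted_wrt (<) (Point \<tau> 0 # ?ps)"
    by (auto simp: sorted_wrt_map Point_less add_pos_nonneg)
  moreover have "map (tree_colouring T) ?ps = ?w"
    by (rule nth_equalityI) (simp_all add: tree_colouring_letter del: of_nat_Suc tree_colouring.simps)
  moreover have "x = Point \<tau> 0 \<or> x \<in> set ?ps \<or> tree_colouring T x = 3 * level (tree_colouring T) (Point \<tau> 0) + 2"
    if "block (tree_colouring T) (Point \<tau> 0) x" for x
  proof -
    obtain e where e: "x = Point \<tau> e" using \<open>block _ _ x\<close> unfolding block_tree_colouring by blast
    show ?thesis
    proof (cases "\<exists>i<length ?w. e = of_nat (Suc i)")
      case True
      then show ?thesis using e by (auto simp del: of_nat_Suc)
    next
      case False
      then show ?thesis
        unfolding e level_tree_colouring by (cases "e = 0") (simp_all only: tree_colouring.simps if_False simp_thms)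
    qed
  qed
  ultimately show ?thesis unfolding has_word_def by (intro exI[of _ ?ps]) (auto simp: block_tree_colouring)
qed

text \<open>All addresses strictly between \<open>\<tau>\<close> and \<open>\<tau> @ [q]\<close> are
  proper extensions of \<open>\<tau>\<close>.\<close>

lemma child_tree_colouring:
  "child (tree_colouring T) (Point \<tau> 0) (Point \<sigma> 0) \<longleftrightarrow> (\<exists>q. \<sigma> = \<tau> @ [q])"
proof
  assume c: "child (tree_colouring T) (Point \<tau> 0) (Point \<sigma> 0)"
  then have "\<tau> < \<sigma>" and l: "length \<sigma> = Suc (length \<tau>)"
    by (auto simp: child_def level_tree_colouring Point_less)
  have gap: "length \<tau> < length \<rho>" if "\<tau> < \<rho>" "\<rho> < \<sigma>" for \<rho>
    using that c by (auto simp: child_def level_tree_colouring head_tree_colouring Point_less)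
  from \<open>\<tau> < \<sigma>\<close> show "\<exists>q. \<sigma> = \<tau> @ [q]"
  proof (cases rule: list_less_cases)
    case (1 q r)
    then show ?thesis using l by simp
  next
    case (2 p a b x y)
    \<comment> \<open>Averaging the differing entries gives an address of the same length as
      \<open>\<tau>\<close> in between, which a child excludes.\<close>
    then have "\<tau> < p @ (a + b) / 2 # x" "p @ (a + b) / 2 # x < \<sigma>" by (simp_all add: append_less_iff)
    then show ?thesis using gap[of "p @ (a + b) / 2 # x"] 2 by simp
  qed
next
  assume "\<exists>q. \<sigma> = \<tau> @ [q]"
  then obtain q where q: "\<sigma> = \<tau> @ [q]" by blast
  have "length \<tau> < length \<rho>" if "\<tau> < \<rho>" "\<rho> < \<tau> @ [q]" for \<rho>
    using that(1)
  proof (cases rule: list_less_cases)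
    case (2 p a b x y)
    then have "\<tau> @ [q] < \<rho>" by (simp add: append_less_iff)
    then show ?thesis using that(2) by (meson less_asym)
  qed simp
  then show "child (tree_colouring T) (Point \<tau> 0) (Point \<sigma> 0)"
    using q list_less_snoc by (auto simp: child_def level_tree_colouring head_tree_colouring Point_less)
qed

text \<open>The word of a block determines its name, so the names along a path are read back
  exactly.\<close>

lemma node_tree_colouring: "node (tree_colouring T) s (Point \<tau> 0) \<longleftrightarrow> s = path_names T \<tau>"
proof
  assume "node (tree_colouring T) s (Point \<tau> 0)"
  then show "s = path_names T \<tau>"
  proof (induction s arbitrary: \<tau>)
    case Nil
    then show ?case by (simp add: level_tree_colouring path_names_Nil)
  next
    case (Cons a s)
    then obtain u where w: "has_word (tree_colouring T) (Point \<tau> 0) (word_of (Suc (length s)) a)"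
      and u: "child (tree_colouring T) u (Point \<tau> 0)" "node (tree_colouring T) s u" by auto
    then obtain \<rho> where r: "u = Point \<rho> 0" by (auto simp: child_def head_tree_colouring)
    then obtain q where q: "\<tau> = \<rho> @ [q]" using u child_tree_colouring by blast
    have s: "s = path_names T \<rho>" using Cons.IH u r by blast
    have "word_of (Suc (length s)) a = letters T \<tau>"
      by (rule has_word_unique[OF w has_word_tree_colouring])
        (use word_of_mod letters_mod in \<open>auto simp: head_tree_colouring simp del: word_of.simps\<close>)
    also have "letters T \<tau> = word_of (Suc (length s)) (pick T s (shade q))"
      by (simp add: letters_def q path_names_snoc s del: word_of.simps)
    finally have "a = pick T s (shade q)" by (rule word_of_inj)
    then show ?case by (simp add: q path_names_snoc s)
  qed
next
  have "node (tree_colouring T) (path_names T \<tau>) (Point \<tau> 0)"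
  proof (induction \<tau> rule: rev_induct)
    case Nil
    then show ?case by (simp add: level_tree_colouring path_names_Nil head_tree_colouring)
  next
    case (snoc q \<tau>)
    have "letters T (\<tau> @ [q]) = word_of (Suc (length (path_names T \<tau>))) (pick T (path_names T \<tau>) (shade q))"
      by (simp add: letters_def path_names_snoc del: word_of.simps)
    then show ?case
      using snoc has_word_tree_colouring[of T "\<tau> @ [q]"] child_tree_colouring[of T \<tau> "\<tau> @ [q]"]
      by (auto simp: path_names_snoc simp del: word_of.simps)
  qed
  moreover assume "s = path_names T \<tau>"
  ultimately show "node (tree_colouring T) s (Point \<tau> 0)" by simp
qed

lemma shaped_tree_colouring:
  assumes T: "\<And>s. T (None # s)"
  shows "shaped (tree_colouring T) T"
proof -
  let ?c = "tree_colouring T"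
  have pickT: "T (pick T s k # s)" for s k using T by (simp add: pick_def)
  have less_children: "Point (\<tau> @ [q]) 0 < Point (\<tau> @ [q']) 0 \<longleftrightarrow> q < q'" for \<tau> q q'
    by (simp add: Point_less append_less_iff)
  have children: "child ?c (Point \<tau> 0) x \<longleftrightarrow> (\<exists>q. x = Point (\<tau> @ [q]) 0)" for \<tau> x
  proof
    assume "child ?c (Point \<tau> 0) x"
    moreover from this obtain \<sigma> where "x = Point \<sigma> 0" by (auto simp: child_def head_tree_colouring)
    ultimately show "\<exists>q. x = Point (\<tau> @ [q]) 0" using child_tree_colouring by blast
  qed (use child_tree_colouring in blast)
  have word: "has_word ?c (Point (\<tau> @ [q]) 0) (word_of (Suc (length (path_names T \<tau>))) (pick T (path_names T \<tau>) (shade q)))"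
    for \<tau> q
    using has_word_tree_colouring[of T "\<tau> @ [q]"] by (simp add: letters_def path_names_snoc del: word_of.simps)
  have dense: "meets_cuts {v. child ?c (Point \<tau> 0) v \<and> has_word ?c v (word_of (Suc (length (path_names T \<tau>))) a)}
      {v. child ?c (Point \<tau> 0) v}" if a: "T (a # path_names T \<tau>)" for \<tau> a
  proof -
    \<comment> \<open>The children with shade \<open>to_nat a\<close> get the name \<open>a\<close>,
      and every shade is dense.\<close>
    have in_set: "Point (\<tau> @ [q]) 0 \<in> {v. child ?c (Point \<tau> 0) v \<and> has_word ?c v (word_of (Suc (length (path_names T \<tau>))) a)}"
      if "shade q = to_nat a" for q
      using word[of \<tau> q] a that children by (auto simp: pick_def simp del: word_of.simps)
    have ex: "\<exists>v\<in>{v. child ?c (Point \<tau> 0) v \<and> has_word ?c v (word_of (Suc (length (path_names T \<tau>))) a)}.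
        Point (\<tau> @ [p]) 0 < v \<and> v < Point (\<tau> @ [p']) 0" if "p < p'" for p p'
      using shade_dense[OF that, of "to_nat a"] in_set less_children by blast
    show ?thesis unfolding meets_cuts_def
    proof (intro conjI ballI impI)
      show "{v. child ?c (Point \<tau> 0) v \<and> has_word ?c v (word_of (Suc (length (path_names T \<tau>))) a)} \<noteq> {}"
        using ex[of 0 1] by auto
    next
      fix y assume "y \<in> {v. child ?c (Point \<tau> 0) v}"
      then obtain q where q: "y = Point (\<tau> @ [q]) 0" using children by blast
      show "\<exists>v\<in>{v. child ?c (Point \<tau> 0) v \<and> has_word ?c v (word_of (Suc (length (path_names T \<tau>))) a)}. v < y"
        using ex[of "q - 1" q] q by auto
      show "\<exists>v\<in>{v. child ?c (Point \<tau> 0) v \<and> has_word ?c v (word_of (Suc (length (path_names T \<tau>))) a)}. y < v"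
        using ex[of q "q + 1"] q by auto
      fix y' assume "y' \<in> {v. child ?c (Point \<tau> 0) v}" "y < y'"
      then obtain q' where q': "y' = Point (\<tau> @ [q']) 0" using children by blast
      show "\<exists>v\<in>{v. child ?c (Point \<tau> 0) v \<and> has_word ?c v (word_of (Suc (length (path_names T \<tau>))) a)}. y < v \<and> v < y'"
        using ex[of q q'] q q' \<open>y < y'\<close> less_children by blast
    qed
  qed
  show ?thesis unfolding shaped_def
  proof (intro conjI allI impI)
    fix x
    obtain \<tau> e where "x = Point \<tau> e" by (cases x)
    then show "\<exists>v. head ?c v \<and> block ?c v x"
      by (intro exI[of _ "Point \<tau> 0"]) (auto simp: head_tree_colouring block_tree_colouring)
  next
    fix v x assume "head ?c v \<and> block ?c v x"
    then obtain \<tau> e where "v = Point \<tau> 0" "x = Point \<tau> e"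
      by (auto simp: head_tree_colouring block_tree_colouring)
    then have "Point \<tau> (e - 1) < x \<and> block ?c v (Point \<tau> (e - 1))" "x < Point \<tau> (e + 1) \<and> block ?c v (Point \<tau> (e + 1))"
      by (simp_all add: block_tree_colouring Point_less)
    then show "\<exists>q'<x. block ?c v q'" "\<exists>q'>x. block ?c v q'" by blast+
  next
    have "has_word ?c (Point [] 0) (word_of 0 None)"
      using has_word_tree_colouring[of T "[]"] by (simp add: letters_def path_names_Nil)
    moreover have "v = Point [] 0 \<or> Point [] 0 < v \<and> 0 < level ?c v" if "head ?c v" for v
    proof -
      obtain \<tau> where "v = Point \<tau> 0" using \<open>head ?c v\<close> by (auto simp: head_tree_colouring)
      then show ?thesis by (cases \<tau>) (auto simp: Point_less level_tree_colouring)
    qed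
    ultimately show "\<exists>r. head ?c r \<and> level ?c r = 0 \<and> has_word ?c r (word_of 0 None) \<and>
        (\<forall>v. head ?c v \<longrightarrow> v = r \<or> r < v \<and> 0 < level ?c v)"
      by (intro exI[of _ "Point [] 0"]) (auto simp: head_tree_colouring level_tree_colouring)
  next
    fix v assume "head ?c v \<and> 0 < level ?c v"
    then obtain \<tau> where t: "v = Point \<tau> 0" "0 < level ?c v" unfolding head_tree_colouring by blast
    then have "\<tau> \<noteq> []" unfolding t(1) level_tree_colouring by simp
    have "\<tau> = butlast \<tau> @ [last \<tau>]" using append_butlast_last_id[OF \<open>\<tau> \<noteq> []\<close>] by (rule sym)
    then show "\<exists>u. child ?c u v" unfolding t(1) using child_tree_colouring by blast
  next
    fix s u v assume su: "node ?c s u \<and> child ?c u v"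
    then have "head ?c u" by (simp add: child_def)
    then obtain \<tau> where u: "u = Point \<tau> 0" unfolding head_tree_colouring by blast
    have "s = path_names T \<tau>" using su unfolding u node_tree_colouring by (rule conjunct1)
    moreover obtain q where "v = Point (\<tau> @ [q]) 0" using su unfolding u children by blast
    ultimately have s: "s = path_names T \<tau>" and v: "v = Point (\<tau> @ [q]) 0" by auto
    show "\<exists>a. T (a # s) \<and> has_word ?c v (word_of (Suc (length s)) a)"
      using pickT[of s "shade q"] word[of \<tau> q] unfolding v s by blast
  next
    fix s u a assume su: "node ?c s u \<and> T (a # s)"
    then have "head ?c u" using node_level by blast
    then obtain \<tau> where u: "u = Point \<tau> 0" unfolding head_tree_colouring by blast
    have "s = path_names T \<tau>" using su unfolding u node_tree_colouring by (rule conjunct1)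
    then show "meets_cuts {v. child ?c u v \<and> has_word ?c v (word_of (Suc (length s)) a)} {v. child ?c u v}"
      using dense su u by simp
  qed
qed

section \<open>Closed conditions for analytic sets\<close>

text \<open>With a countable basis for the factor, coordinatewise measurable maps into the space of
  bit sequences are measurable.\<close>

instance bool :: second_countable_topology
proof
  show "\<exists>B :: bool set set. countable B \<and> open = generate_topology B"
    by (intro exI[of _ UNIV])
      (simp add: fun_eq_iff open_discrete generate_topology.Basis countable_finite)
qed

text \<open>Closedness in a product of discrete spaces, expressed by initial segments.\<close>

definition closed_condition :: "((nat \<Rightarrow> 'c) \<Rightarrow> (nat \<Rightarrow> nat) \<Rightarrow> bool) \<Rightarrow> bool" where
  "closed_condition F \<longleftrightarrow>
     (\<forall>z b. (\<forall>n. \<exists>z' b'. F z' b' \<and> (\<forall>i<n. z i = z' i \<and> b i = b' i)) \<longrightarrow> F z b)"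

lemma closed_conditionD:
  assumes "closed_condition F" "\<And>n. \<exists>z' b'. F z' b' \<and> (\<forall>i<n. z i = z' i \<and> b i = b' i)"
  shows "F z b"
  using assms unfolding closed_condition_def by blast

text \<open>Projections of closed sets along the Baire space. Being such a projection together with
  the complement will define a sigma-algebra.\<close>

definition suslin :: "((nat \<Rightarrow> 'c) \<Rightarrow> bool) \<Rightarrow> bool" where
  "suslin P \<longleftrightarrow> (\<exists>F. closed_condition F \<and> (\<forall>z. P z \<longleftrightarrow> (\<exists>b. F z b)))"

lemma suslin_coordinate: "suslin (\<lambda>z. Q (z i))"
proof -
  have "closed_condition (\<lambda>z (b :: nat \<Rightarrow> nat). Q (z i))"
    unfolding closed_condition_def by (metis lessI)
  then show ?thesis unfolding suslin_def by (intro exI[of _ "\<lambda>z b. Q (z i)"]) auto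
qed

text \<open>Witnesses for all \<open>i\<close> are stored as the rows of a single sequence.\<close>

lemma suslin_all:
  fixes P :: "nat \<Rightarrow> (nat \<Rightarrow> 'c) \<Rightarrow> bool"
  assumes "\<And>i. suslin (P i)" shows "suslin (\<lambda>z. \<forall>i. P i z)"
proof -
  obtain F where F: "\<And>i. closed_condition (F i)" "\<And>i z. P i z \<longleftrightarrow> (\<exists>b. F i z b)"
    using assms unfolding suslin_def by metis
  define G where "G z b \<longleftrightarrow> (\<forall>i. F i z (\<lambda>m. b (prod_encode (i, m))))" for z b
  have "closed_condition G" unfolding closed_condition_def
  proof (intro allI impI)
    fix z b assume *: "\<forall>n. \<exists>z' b'. G z' b' \<and> (\<forall>i<n. z i = z' i \<and> b i = b' i)"
    show "G z b" unfolding G_def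
    proof
      fix i
      have *: "\<exists>z' b'. F i z' b' \<and> (\<forall>m<n. z m = z' m \<and> b (prod_encode (i, m)) = b' m)" for n
      proof -
        \<comment> \<open>Agreement below \<open>N\<close> includes the first \<open>n\<close>
          entries of \<open>z\<close> and of row \<open>i\<close>.\<close>
        define N where "N = Suc (Max ((\<lambda>m. prod_encode (i, m)) ` {..n} \<union> {..n}))"
        have N: "m < N \<and> prod_encode (i, m) < N" if "m < n" for m
        proof -
          have "m \<le> Max ((\<lambda>m. prod_encode (i, m)) ` {..n} \<union> {..n})"
            "prod_encode (i, m) \<le> Max ((\<lambda>m. prod_encode (i, m)) ` {..n} \<union> {..n})"
            using that by (intro Max_ge; force)+
          then show ?thesis unfolding N_def by (simp only: less_Suc_eq_le)
        qed
        obtain z' b' where "G z' b'" "\<forall>i<N. z i = z' i \<and> b i = b' i" using * by blast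
        then show ?thesis using N unfolding G_def
          by (intro exI[of _ z'] exI[of _ "\<lambda>m. b' (prod_encode (i, m))"]) auto
      qed
      show "F i z (\<lambda>m. b (prod_encode (i, m)))"
        by (rule closed_conditionD[OF F(1)]) (rule *)
    qed
  qed
  moreover have "(\<forall>i. P i z) \<longleftrightarrow> (\<exists>b. G z b)" for z
  proof
    assume "\<forall>i. P i z"
    then have "\<forall>i. \<exists>b. F i z b" unfolding F(2) .
    then obtain b where b: "\<And>i. F i z (b i)" by metis
    have "G z (\<lambda>n. case prod_decode n of (i, m) \<Rightarrow> b i m)" using b by (simp add: G_def)
    then show "\<exists>b. G z b" by blast
  next
    assume "\<exists>b. G z b"
    then show "\<forall>i. P i z" unfolding G_def F(2) by blast
  qed
  ultimately show ?thesis unfolding suslin_def by blast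
qed

text \<open>The index is stored as \<open>b 0\<close>. Approximations of positive length fix it, so
  only the closedness of \<open>F (b 0)\<close> enters.\<close>

lemma suslin_ex:
  fixes P :: "nat \<Rightarrow> (nat \<Rightarrow> 'c) \<Rightarrow> bool"
  assumes "\<And>i. suslin (P i)" shows "suslin (\<lambda>z. \<exists>i. P i z)"
proof -
  obtain F where F: "\<And>i. closed_condition (F i)" "\<And>i z. P i z \<longleftrightarrow> (\<exists>b. F i z b)"
    using assms unfolding suslin_def by metis
  define G where "G z b \<longleftrightarrow> F (b 0) z (\<lambda>m. b (Suc m))" for z b
  have "closed_condition G" unfolding closed_condition_def
  proof (intro allI impI)
    fix z b assume *: "\<forall>n. \<exists>z' b'. G z' b' \<and> (\<forall>i<n. z i = z' i \<and> b i = b' i)"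
    have *: "\<exists>z' b'. F (b 0) z' b' \<and> (\<forall>m<n. z m = z' m \<and> b (Suc m) = b' m)" for n
    proof -
      obtain z' b' where "G z' b'" "\<forall>i<Suc n. z i = z' i \<and> b i = b' i" using * by blast
      then show ?thesis unfolding G_def
        by (intro exI[of _ z'] exI[of _ "\<lambda>m. b' (Suc m)"]) auto
    qed
    show "G z b" unfolding G_def by (rule closed_conditionD[OF F(1)]) (rule *)
  qed
  moreover have "(\<exists>i. P i z) \<longleftrightarrow> (\<exists>b. G z b)" for z
  proof
    assume "\<exists>i. P i z"
    then obtain i b where b: "F i z b" unfolding F(2) by blast
    have "G z (case_nat i b)" using b by (simp add: G_def)
    then show "\<exists>b. G z b" by blast
  next
    assume "\<exists>b. G z b"
    then show "\<exists>i. P i z" unfolding G_def F(2) by blast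
  qed
  ultimately show ?thesis unfolding suslin_def by blast
qed

lemma measurable_borel_countable:
  "measurable M (borel :: 'y :: {countable, t2_space} measure) = measurable M (count_space UNIV)"
  by (rule measurable_cong_sets) (simp_all add: sets_borel_eq_count_space)

text \<open>The sets that are \<open>suslin\<close> together with their complements form a
  sigma-algebra for which the coordinates are measurable, so it contains \<open>D\<close>. The
  witness of the resulting closed set is merged with the given one.\<close>

lemma analytic_closed_condition:
  assumes D: "D \<in> sets (((borel :: bits measure) \<Otimes>\<^sub>M (borel :: bits measure)) \<Otimes>\<^sub>M (borel :: (nat \<Rightarrow> nat) measure))"
  obtains F where "\<And>u v d. (\<And>n. approx F n u v d) \<Longrightarrow> F u v d"
    "\<And>u v. (\<exists>d. ((u, v), d) \<in> D) \<longleftrightarrow> (\<exists>d. F u v d)"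
proof -
  define dec :: "(nat \<Rightarrow> bool \<times> bool \<times> nat) \<Rightarrow> (bits \<times> bits) \<times> (nat \<Rightarrow> nat)" where
    "dec z = ((\<lambda>i. fst (z i), \<lambda>i. fst (snd (z i))), \<lambda>i. snd (snd (z i)))" for z
  define \<A> where "\<A> = {A. suslin (\<lambda>z. dec z \<in> A) \<and> suslin (\<lambda>z. dec z \<notin> A)}"
  have const: "suslin (\<lambda>z :: nat \<Rightarrow> bool \<times> bool \<times> nat. b)" for b
    using suslin_coordinate[of "\<lambda>_. b" 0] by simp
  interpret sigma_algebra UNIV \<A>
    unfolding sigma_algebra_iff2
  proof (intro conjI ballI allI impI)
    show "{} \<in> \<A>" using const by (simp add: \<A>_def)
    fix A :: "nat \<Rightarrow> _ set" assume A: "range A \<subseteq> \<A>"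
    then have "suslin (\<lambda>z. dec z \<in> A i)" "suslin (\<lambda>z. dec z \<notin> A i)" for i by (auto simp: \<A>_def)
    from suslin_ex[of "\<lambda>i z. dec z \<in> A i", OF this(1)] suslin_all[of "\<lambda>i z. dec z \<notin> A i", OF this(2)]
    show "(\<Union>i. A i) \<in> \<A>" by (simp add: \<A>_def)
  qed (auto simp: \<A>_def)
  define M where "M = sigma UNIV \<A>"
  have M: "sets M = \<A>" "space M = UNIV" by (simp_all add: M_def)
  have coordb: "(\<lambda>x. f x) \<in> measurable M (count_space UNIV)"
    if "\<And>z. f (dec z) = p (z i)" for f :: "_ \<Rightarrow> bool" and p i
  proof (rule measurableI)
    fix B :: "bool set"
    have "f -` B \<in> \<A>"
      unfolding \<A>_def using suslin_coordinate[of "\<lambda>y. p y \<in> B" i] suslin_coordinate[of "\<lambda>y. p y \<notin> B" i] that by simp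
    then show "f -` B \<inter> space M \<in> sets M" by (simp add: M)
  qed simp
  have coordn: "(\<lambda>x. f x) \<in> measurable M (count_space UNIV)"
    if "\<And>z. f (dec z) = p (z i)" for f :: "_ \<Rightarrow> nat" and p i
  proof (rule measurableI)
    fix B :: "nat set"
    have "f -` B \<in> \<A>"
      unfolding \<A>_def using suslin_coordinate[of "\<lambda>y. p y \<in> B" i] suslin_coordinate[of "\<lambda>y. p y \<notin> B" i] that by simp
    then show "f -` B \<inter> space M \<in> sets M" by (simp add: M)
  qed simp
  have 1: "(\<lambda>x. fst (fst x)) \<in> measurable M borel"
  proof (rule measurable_coordinatewise_then_product)
    fix i show "(\<lambda>x. fst (fst x) i) \<in> borel_measurable M"
      unfolding measurable_borel_countable by (rule coordb[where p = fst and i = i]) (simp add: dec_def)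
  qed
  have 2: "(\<lambda>x. snd (fst x)) \<in> measurable M borel"
  proof (rule measurable_coordinatewise_then_product)
    fix i show "(\<lambda>x. snd (fst x) i) \<in> borel_measurable M"
      unfolding measurable_borel_countable by (rule coordb[where p = "fst \<circ> snd" and i = i]) (simp add: dec_def)
  qed
  have 3: "snd \<in> measurable M borel"
  proof (rule measurable_coordinatewise_then_product)
    fix i show "(\<lambda>x. snd x i) \<in> borel_measurable M"
      unfolding measurable_borel_countable by (rule coordn[where p = "snd \<circ> snd" and i = i]) (simp add: dec_def)
  qed
  have "(\<lambda>x. ((fst (fst x), snd (fst x)), snd x)) \<in> measurable M ((borel \<Otimes>\<^sub>M borel) \<Otimes>\<^sub>M borel)"
    using 1 2 3 by (intro measurable_Pair)
  from measurable_sets[OF this D] have "D \<in> \<A>" by (simp add: M vimage_def)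
  then obtain G where G: "closed_condition G" "\<And>z. dec z \<in> D \<longleftrightarrow> (\<exists>b. G z b)"
    by (auto simp: \<A>_def suslin_def)
  \<comment> \<open>Entry \<open>i\<close> of the new witness codes entry \<open>i\<close> of both
    old ones, so initial segments correspond.\<close>
  define F where "F u v d \<longleftrightarrow> G (\<lambda>i. (u i, v i, fst (prod_decode (d i)))) (\<lambda>i. snd (prod_decode (d i)))" for u v d
  show thesis
  proof (rule that[of F])
    fix u v d assume *: "\<And>n. approx F n u v d"
    have **: "\<exists>z' b'. G z' b' \<and> (\<forall>i<n. (u i, v i, fst (prod_decode (d i))) = z' i \<and> snd (prod_decode (d i)) = b' i)" for n
      using *[of n] unfolding approx_def F_def by fastforce
    show "F u v d" unfolding F_def by (rule closed_conditionD[OF G(1)]) (rule **)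
  next
    fix u v
    show "(\<exists>d. ((u, v), d) \<in> D) \<longleftrightarrow> (\<exists>d. F u v d)"
    proof
      assume "\<exists>d. ((u, v), d) \<in> D"
      then obtain d where "((u, v), d) \<in> D" by blast
      then have "dec (\<lambda>i. (u i, v i, d i)) \<in> D" by (simp add: dec_def)
      then obtain b where "G (\<lambda>i. (u i, v i, d i)) b" using G(2) by blast
      then have "F u v (\<lambda>i. prod_encode (d i, b i))" by (simp add: F_def)
      then show "\<exists>d. F u v d" by blast
    next
      assume "\<exists>d. F u v d"
      then obtain d where "F u v d" by blast
      then have "dec (\<lambda>i. (u i, v i, fst (prod_decode (d i)))) \<in> D" using G(2) unfolding F_def by blast
      then show "\<exists>d. ((u, v), d) \<in> D" by (auto simp: dec_def)
    qed
  qed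
qed

lemma bits_coordinate [measurable]: "(\<lambda>u :: bits. u i) \<in> measurable borel (count_space UNIV)"
  unfolding measurable_borel_countable[symmetric] by measurable

lemma measurable_bits:
  assumes "\<And>i. (\<lambda>x. f x i) \<in> measurable M (count_space UNIV)"
  shows "f \<in> measurable M (borel :: bits measure)"
  by (rule measurable_coordinatewise_then_product) (use assms measurable_borel_countable in blast)

section \<open>Coding standard Borel spaces by bit sequences\<close>

text \<open>\<open>D\<close> is to be \<open>\<lambda>i q. d x (a i) < q\<close> for a point \<open>x\<close>, where \<open>a\<close> enumerates a dense set.\<close>

definition distance_cut :: "('a \<Rightarrow> 'a \<Rightarrow> real) \<Rightarrow> (nat \<Rightarrow> 'a) \<Rightarrow> (nat \<Rightarrow> rat \<Rightarrow> bool) \<Rightarrow> bool" where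
  "distance_cut d a D \<longleftrightarrow> (\<forall>m. \<exists>i. D i (1 / of_nat (Suc m))) \<and>
     (\<forall>i j q r. D i q \<and> D j r \<longrightarrow> d (a i) (a j) < of_rat (q + r)) \<and>
     (\<forall>i j q r. D i q \<and> d (a i) (a j) \<le> of_rat (r - q) \<longrightarrow> D j r) \<and>
     (\<forall>i q. D i q \<longrightarrow> (\<exists>q'<q. D i q'))"

text \<open>The points \<open>a (i m)\<close> with \<open>D (i m) (1 / of_nat (Suc m))\<close> form
  a Cauchy sequence by the second clause, and its limit is the point described by \<open>D\<close>.
  The clauses quantify over countable sets only, which will make the set of codes Borel.\<close>

lemma (in Metric_space) distance_cut_iff:
  assumes complete: mcomplete and a: "\<And>i. a i \<in> M"
    and dense: "\<And>x \<epsilon>. x \<in> M \<Longrightarrow> 0 < \<epsilon> \<Longrightarrow> \<exists>i. d x (a i) < \<epsilon>"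
  shows "distance_cut d a D \<longleftrightarrow> (\<exists>x\<in>M. \<forall>j r. D j r \<longleftrightarrow> d x (a j) < of_rat r)"
proof
  assume "\<exists>x\<in>M. \<forall>j r. D j r \<longleftrightarrow> d x (a j) < of_rat r"
  then obtain x where x: "x \<in> M" "\<And>j r. D j r \<longleftrightarrow> d x (a j) < of_rat r" by blast
  show "distance_cut d a D"
    unfolding distance_cut_def x(2)
  proof (intro conjI allI impI; (elim conjE)?)
    show "\<exists>i. d x (a i) < of_rat (1 / of_nat (Suc m))" for m
      by (rule dense[OF x(1)]) (simp add: of_rat_divide)
  next
    fix i j and q r :: rat assume "d x (a i) < of_rat q" "d x (a j) < of_rat r"
    then show "d (a i) (a j) < of_rat (q + r)"
      using triangle[OF a x(1) a, of i j] commute[of "a i" x] by (simp add: of_rat_add)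
  next
    fix i j and q r :: rat assume "d x (a i) < of_rat q" "d (a i) (a j) \<le> of_rat (r - q)"
    then show "d x (a j) < of_rat r" using triangle[OF x(1) a[of i] a[of j]] by (simp add: of_rat_diff)
  next
    fix i and q :: rat assume "d x (a i) < of_rat q"
    then obtain q' where "d x (a i) < of_rat q'" "(of_rat q' :: real) < of_rat q" using of_rat_dense by blast
    then show "\<exists>q'<q. d x (a i) < of_rat q'" by (auto simp: of_rat_less)
  qed
next
  assume "distance_cut d a D"
  then have D: "\<exists>i. D i (1 / of_nat (Suc m))" "D i q \<Longrightarrow> D j r \<Longrightarrow> d (a i) (a j) < of_rat (q + r)"
    "D i q \<Longrightarrow> d (a i) (a j) \<le> of_rat (r - q) \<Longrightarrow> D j r" "D i q \<Longrightarrow> \<exists>q'<q. D i q'" for m i j q r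
    unfolding distance_cut_def by blast+
  obtain i where i: "\<And>m. D (i m) (1 / of_nat (Suc m))" using D(1) by metis
  define \<sigma> where "\<sigma> m = a (i m)" for m
  define \<eta> where "\<eta> m = 1 / real (Suc m)" for m
  have eta: "of_rat (1 / of_nat (Suc m)) = \<eta> m" for m by (simp add: \<eta>_def of_rat_divide of_rat_add)
  have eta_ex: "\<exists>m. \<eta> m < \<epsilon>" if "0 < \<epsilon>" for \<epsilon>
    using reals_Archimedean[OF that] by (auto simp: \<eta>_def inverse_eq_divide)
  have eta_mono: "\<eta> n \<le> \<eta> m" if "m \<le> n" for m n using that by (simp add: \<eta>_def frac_le)
  have s\<sigma>: "\<sigma> m \<in> M" for m using a by (simp add: \<sigma>_def)
  have dd: "d (\<sigma> m) (\<sigma> n) < \<eta> m + \<eta> n" for m n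
    using D(2)[OF i[of m] i[of n]] unfolding of_rat_add eta \<sigma>_def .
  have "MCauchy \<sigma>"
    unfolding MCauchy_def
  proof (intro conjI allI impI)
    fix \<epsilon> :: real assume "0 < \<epsilon>"
    then obtain N where N: "\<eta> N < \<epsilon> / 2" using eta_ex[of "\<epsilon> / 2"] by auto
    show "\<exists>N. \<forall>n n'. N \<le> n \<longrightarrow> N \<le> n' \<longrightarrow> d (\<sigma> n) (\<sigma> n') < \<epsilon>"
    proof (intro exI allI impI)
      fix n n' assume "N \<le> n" "N \<le> n'"
      then show "d (\<sigma> n) (\<sigma> n') < \<epsilon>" using dd[of n n'] eta_mono[of N n] eta_mono[of N n'] N by linarith
    qed
  qed (use s\<sigma> in auto)
  then obtain x where "limitin mtopology \<sigma> x sequentially" using complete by (auto simp: mcomplete_def)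
  then have x: "x \<in> M" "\<And>\<epsilon>. 0 < \<epsilon> \<Longrightarrow> \<exists>N. \<forall>n\<ge>N. \<sigma> n \<in> M \<and> d (\<sigma> n) x < \<epsilon>"
    unfolding limit_metric_sequentially by auto
  have dx: "d x (\<sigma> m) \<le> \<eta> m" for m
  proof (rule field_le_epsilon)
    fix \<epsilon> :: real assume e: "0 < \<epsilon>"
    obtain N where N: "\<And>n. N \<le> n \<Longrightarrow> d (\<sigma> n) x < \<epsilon> / 2" using x(2)[of "\<epsilon> / 2"] e by auto
    obtain N' where N': "\<eta> N' < \<epsilon> / 2" using eta_ex[of "\<epsilon> / 2"] e by auto
    let ?n = "max N N'"
    have "d x (\<sigma> m) \<le> d x (\<sigma> ?n) + d (\<sigma> ?n) (\<sigma> m)" using triangle[OF x(1) s\<sigma>[of ?n] s\<sigma>[of m]] .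
    also have "\<dots> < \<epsilon> / 2 + (\<eta> ?n + \<eta> m)" using N[of ?n] dd[of ?n m] commute[of x "\<sigma> ?n"] by simp
    also have "\<dots> \<le> \<eta> m + \<epsilon>" using N' eta_mono[of N' ?n] by simp
    finally show "d x (\<sigma> m) \<le> \<eta> m + \<epsilon>" by simp
  qed
  \<comment> \<open>From left to right the last clause leaves room for a strict inequality; the
    converse is the third clause at a point \<open>\<sigma> m\<close> close to
    \<open>x\<close>.\<close>
  have "D j r \<longleftrightarrow> d x (a j) < of_rat r" for j r
  proof
    assume "D j r"
    then obtain r' where r': "r' < r" "D j r'" using D(4) by blast
    then have "0 < of_rat r - (of_rat r' :: real)" by (simp add: of_rat_less)
    then obtain m where m: "\<eta> m < (of_rat r - of_rat r') / 2" using eta_ex[of "(of_rat r - of_rat r') / 2"] by auto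
    have "d (\<sigma> m) (a j) < \<eta> m + of_rat r'" using D(2)[OF i[of m] r'(2)] unfolding of_rat_add eta \<sigma>_def .
    then show "d x (a j) < of_rat r" using triangle[OF x(1) s\<sigma>[of m] a[of j]] dx[of m] m by (simp add: field_simps)
  next
    assume "d x (a j) < of_rat r"
    then obtain m where m: "\<eta> m < (of_rat r - d x (a j)) / 2" using eta_ex[of "(of_rat r - d x (a j)) / 2"] by auto
    have "d (\<sigma> m) (a j) \<le> of_rat (r - 1 / of_nat (Suc m))"
      using triangle[OF s\<sigma>[of m] x(1) a[of j]] dx[of m] m commute[of "\<sigma> m" x] unfolding of_rat_diff eta by (simp add: field_simps)
    then show "D j r" using D(3)[OF i[of m]] by (simp add: \<sigma>_def)
  qed
  then show "\<exists>x\<in>M. \<forall>j r. D j r \<longleftrightarrow> d x (a j) < of_rat r" using x(1) by blast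
qed

text \<open>Interleaving the bits with their complements makes the set of codes an antichain, so that
  bitwise domination between codes, which is all that the zero counts control, is equality.\<close>

lemma standard_borel_coding:
  fixes N :: "'b measure"
  assumes "standard_borel N"
  obtains e :: "'b \<Rightarrow> bits" and A k where "e \<in> measurable N borel" "A \<in> sets borel"
    "k \<in> measurable (restrict_space borel A) N" "\<And>x. x \<in> space N \<Longrightarrow> e x \<in> A \<and> k (e x) = x"
    "\<And>u. u \<in> A \<Longrightarrow> k u \<in> space N \<and> e (k u) = u"
    "\<And>u v. u \<in> A \<Longrightarrow> v \<in> A \<Longrightarrow> (\<And>i. u i \<Longrightarrow> v i) \<Longrightarrow> u = v"
proof (cases "space N = {}")
  \<comment> \<open>An empty space has no dense sequence; it is coded by the empty set.\<close>
  case True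
  show thesis
  proof (rule that[of "\<lambda>_ _. True" "{}" "\<lambda>_. undefined"])
    show "(\<lambda>_. undefined) \<in> measurable (restrict_space borel {}) N"
      using True by (auto simp: measurable_def space_restrict_space)
  qed (use True in auto)
next
  case False
  obtain T where T: "topspace T = space N" "completely_metrizable_space T" "second_countable T"
    "sets N = sigma_sets (space N) {U. openin T U}"
    using assms by (auto simp: standard_borel_def)
  obtain M d where Md: "Metric_space M d" "Metric_space.mcomplete M d" "T = Metric_space.mtopology M d"
    using T(2) by (auto simp: completely_metrizable_space_def)
  interpret Metric_space M d by (rule Md(1))
  have MN: "M = space N" using T(1) Md(3) by simp
  obtain C where C: "countable C" "C \<subseteq> M" "mtopology closure_of C = M"
    using second_countable_imp_separable_space[OF T(3)] Md(3) by (auto simp: separable_space_def)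
  have dC: "\<exists>y\<in>C. d x y < \<epsilon>" if "x \<in> M" "0 < \<epsilon>" for x \<epsilon>
  proof -
    have "x \<in> mtopology closure_of C" using that C(3) by simp
    then have "\<exists>y. y \<in> C \<and> y \<in> mball x \<epsilon>" using that unfolding in_closure_of
      by (metis centre_in_mball_iff openin_mball)
    then show ?thesis by auto
  qed
  then have "C \<noteq> {}" using False MN by (metis empty_iff equals0I zero_less_one)
  define a where "a = from_nat_into C"
  have aC: "a i \<in> C" for i unfolding a_def by (rule from_nat_into[OF \<open>C \<noteq> {}\<close>])
  then have aM: "a i \<in> M" for i using C(2) by blast
  have dense: "\<exists>i. d x (a i) < \<epsilon>" if "x \<in> M" "0 < \<epsilon>" for x \<epsilon>
    using dC[OF that] from_nat_into_surj[OF C(1)] unfolding a_def by metis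
  define near where "near x n \<longleftrightarrow> (case from_nat n of (i, q) \<Rightarrow> d x (a i) < of_rat q)" for x n
  define e where "e x n \<longleftrightarrow> (if even n then near x (n div 2) else \<not> near x (n div 2))" for x n
  define cut where "cut u i q \<longleftrightarrow> u (2 * to_nat (i, q))" for u :: bits and i :: nat and q :: rat
  \<comment> \<open>Several \<open>n\<close> may decode to the same pair; the last condition makes
    their bits agree with the bit at the canonical code.\<close>
  define A where "A = {u. distance_cut d a (cut u) \<and> (\<forall>n. u (Suc (2 * n)) \<longleftrightarrow> \<not> u (2 * n)) \<and>
    (\<forall>n. u (2 * n) \<longleftrightarrow> u (2 * to_nat (from_nat n :: nat \<times> rat)))}"
  define k where "k u = (SOME x. x \<in> M \<and> e x = u)" for u
  have cut_e: "cut (e x) i q \<longleftrightarrow> d x (a i) < of_rat q" for x i q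
    by (simp add: cut_def e_def near_def)
  have eA: "e x \<in> A" if "x \<in> M" for x
    unfolding A_def using distance_cut_iff[OF Md(2) aM dense, of "cut (e x)"] that cut_e
    by (auto simp: e_def near_def)
  have inj: "x = y" if xy: "x \<in> M" "y \<in> M" "e x = e y" for x y
  proof (rule ccontr)
    assume "x \<noteq> y"
    then have "0 < d x y / 2" using xy by simp
    then obtain i where "d x (a i) < d x y / 2" using dense xy(1) by blast
    then obtain q where q: "d x (a i) < of_rat q" "of_rat q < d x y / 2" using of_rat_dense by blast
    then have "d y (a i) < of_rat q" using cut_e[of x i q] cut_e[of y i q] xy(3) by simp
    then show False using triangle[OF xy(1) aM xy(2), of i] q commute[of y "a i"] by simp
  qed
  have kA: "k u \<in> M \<and> e (k u) = u" if u: "u \<in> A" for u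
  proof -
    obtain x where x: "x \<in> M" "\<And>j r. cut u j r \<longleftrightarrow> d x (a j) < of_rat r"
      using u distance_cut_iff[OF Md(2) aM dense, of "cut u"] unfolding A_def by blast
    have ev: "near x n \<longleftrightarrow> u (2 * n)" for n
    proof -
      obtain i q where iq: "(from_nat n :: nat \<times> rat) = (i, q)" by fastforce
      have "u (2 * n) \<longleftrightarrow> cut u i q" using u unfolding A_def cut_def iq[symmetric] by simp
      then show ?thesis by (simp add: near_def iq x(2))
    qed
    have "e x n \<longleftrightarrow> u n" for n
    proof (cases "even n")
      case True
      then show ?thesis using ev[of "n div 2"] by (simp add: e_def)
    next
      case False
      then obtain m where m: "n = Suc (2 * m)" by (auto elim: oddE)
      have "u (Suc (2 * m)) \<longleftrightarrow> \<not> u (2 * m)" using u by (simp add: A_def)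
      then show ?thesis using ev[of m] unfolding m by (simp add: e_def)
    qed
    then have "e x = u" by blast
    with x(1) have "\<exists>x. x \<in> M \<and> e x = u" by blast
    then show ?thesis unfolding k_def by (rule someI_ex)
  qed
  have ke: "k (e x) = x" if "x \<in> M" for x
    using inj[of "k (e x)" x] kA[OF eA[OF that]] that by blast
  have A: "A \<in> sets borel"
  proof -
    have "{u \<in> space borel. distance_cut d a (cut u) \<and> (\<forall>n. u (Suc (2 * n)) \<longleftrightarrow> \<not> u (2 * n)) \<and>
      (\<forall>n. u (2 * n) \<longleftrightarrow> u (2 * to_nat (from_nat n :: nat \<times> rat)))} \<in> sets borel"
      unfolding distance_cut_def cut_def by measurable
    then show ?thesis by (simp add: A_def)
  qed
  have e: "e \<in> measurable N borel"
  proof (rule measurable_bits)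
    fix n
    obtain i q where iq: "(from_nat (n div 2) :: nat \<times> rat) = (i, q)" by fastforce
    have "mball (a i) (of_rat q) \<in> sets N" unfolding T(4) using Md(3) by (intro sigma_sets.Basic) simp
    moreover have "{x \<in> space N. near x (n div 2)} = mball (a i) (of_rat q)"
      using aM commute unfolding MN[symmetric] by (auto simp: near_def iq)
    ultimately have "Measurable.pred N (\<lambda>x. near x (n div 2))" by (simp add: pred_def)
    then show "(\<lambda>x. e x n) \<in> measurable N (count_space UNIV)" unfolding e_def by (cases "even n") simp_all
  qed
  have k: "k \<in> measurable (restrict_space borel A) N"
  proof (rule measurable_sigma_sets[OF T(4)])
    show "{U. openin T U} \<subseteq> Pow (space N)" using openin_subset T(1) by blast
    show "k \<in> space (restrict_space borel A) \<rightarrow> space N" using kA MN by (auto simp: space_restrict_space)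
    fix U assume "U \<in> {U. openin T U}"
    then have U: "openin mtopology U" using Md(3) by simp
    \<comment> \<open>\<open>U\<close> is the union of the balls of rational radius about points
      \<open>a i\<close> that it contains, so \<open>k u \<in> U\<close> becomes a countable
      disjunction of bits of \<open>u\<close>.\<close>
    define I where "I = {(i, q :: rat). mball (a i) (of_rat q) \<subseteq> U}"
    have UI: "x \<in> U \<longleftrightarrow> (\<exists>(i, q)\<in>I. d x (a i) < of_rat q)" if xM: "x \<in> M" for x
    proof
      assume "x \<in> U"
      then obtain \<epsilon> where eps: "0 < \<epsilon>" "mball x \<epsilon> \<subseteq> U" using U by (auto simp: openin_mtopology)
      obtain i where i: "d x (a i) < \<epsilon> / 2" using dense[OF xM, of "\<epsilon> / 2"] eps by auto
      then obtain q where q: "d x (a i) < of_rat q" "of_rat q < \<epsilon> / 2" using of_rat_dense by blast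
      have "mball (a i) (of_rat q) \<subseteq> mball x \<epsilon>"
      proof
        fix y assume "y \<in> mball (a i) (of_rat q)"
        then show "y \<in> mball x \<epsilon>" using triangle[OF xM aM[of i], of y] i q xM by simp
      qed
      then show "\<exists>(i, q)\<in>I. d x (a i) < of_rat q" using q(1) eps(2) by (auto simp: I_def)
    next
      assume "\<exists>(i, q)\<in>I. d x (a i) < of_rat q"
      then obtain i q where "mball (a i) (of_rat q) \<subseteq> U" "d x (a i) < of_rat q" by (auto simp: I_def)
      then show "x \<in> U" using xM aM commute[of x "a i"] by (auto simp: subset_iff)
    qed
    have "k -` U \<inter> space (restrict_space borel A) = A \<inter> {u \<in> space borel. \<exists>p\<in>I. u (2 * to_nat p)}"
    proof -
      have "k u \<in> U \<longleftrightarrow> (\<exists>p\<in>I. u (2 * to_nat p))" if "u \<in> A" for u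
      proof -
        have "u (2 * to_nat p) \<longleftrightarrow> (case p of (i, q) \<Rightarrow> d (k u) (a i) < of_rat q)" for p
          using kA[OF that] cut_e[of "k u" "fst p" "snd p"] by (simp add: cut_def split_beta)
        then show ?thesis using UI[of "k u"] kA[OF that] by simp
      qed
      then show ?thesis by (auto simp: space_restrict_space)
    qed
    moreover have "{u \<in> space borel. \<exists>p\<in>I. u (2 * to_nat p)} \<in> sets borel" by measurable
    ultimately show "k -` U \<inter> space (restrict_space borel A) \<in> sets (restrict_space borel A)"
      by (auto simp: sets_restrict_space)
  qed
  show thesis
  proof (rule that[OF e A k])
    show "e x \<in> A \<and> k (e x) = x" if "x \<in> space N" for x using that eA ke MN by blast
    show "k u \<in> space N \<and> e (k u) = u" if "u \<in> A" for u using that kA MN by blast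
    show "u = v" if uv: "u \<in> A" "v \<in> A" "\<And>i. u i \<Longrightarrow> v i" for u v
    proof
      fix i
      have c: "u (Suc (2 * n)) \<longleftrightarrow> \<not> u (2 * n)" "v (Suc (2 * n)) \<longleftrightarrow> \<not> v (2 * n)" for n
        using uv(1,2) by (simp_all add: A_def)
      then have ev: "u (2 * n) \<longleftrightarrow> v (2 * n)" for n using uv(3) by blast
      show "u i = v i"
      proof (cases "even i")
        case True
        then show ?thesis using ev[of "i div 2"] by simp
      next
        case False
        then obtain m where m: "i = Suc (2 * m)" by (auto elim: oddE)
        show ?thesis using ev[of m] c[of m] unfolding m by simp
      qed
    qed
  qed
qed

section \<open>The reductions\<close>

lemma colour_coordinate [measurable]: "(\<lambda>c. c q) \<in> measurable colourings (count_space UNIV)"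
  unfolding measurable_borel_countable[symmetric] by measurable

lemma pred_head [measurable]: "Measurable.pred colourings (\<lambda>c. head c v)"
  unfolding head_def by measurable

lemma measurable_level [measurable]: "(\<lambda>c. level c v) \<in> measurable colourings (count_space UNIV)"
  unfolding level_def by measurable

lemma pred_block [measurable]: "Measurable.pred colourings (\<lambda>c. block c v q)"
  unfolding block_def by measurable

lemma pred_has_word [measurable]: "Measurable.pred colourings (\<lambda>c. has_word c v w)"
proof -
  have [measurable]: "Measurable.pred colourings (\<lambda>c. map c ps = w)" for ps
    unfolding list_eq_iff_nth_eq length_map by (simp cong: conj_cong) measurable
  have *: "has_word c v w \<longleftrightarrow> (\<exists>ps. sorted_wrt (<) (v # ps) \<and> map c ps = w \<and> (\<forall>p. p \<in> set ps \<longrightarrow> block c v p) \<and>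
     (\<forall>q. block c v q \<longrightarrow> q = v \<or> q \<in> set ps \<or> c q = 3 * level c v + 2))" for c :: "rat \<Rightarrow> nat"
    by (auto simp: has_word_def)
  show ?thesis unfolding * by measurable
qed

lemma pred_child [measurable]: "Measurable.pred colourings (\<lambda>c. child c u v)"
  unfolding child_def by measurable

lemma pred_node [measurable]: "Measurable.pred colourings (\<lambda>c. node c s v)"
proof (induction s arbitrary: v)
  case Nil
  show ?case unfolding node.simps by measurable
next
  case (Cons a s)
  note Cons.IH[measurable]
  show ?case unfolding node.simps by measurable
qed

lemma measurable_decode [measurable]: "decode \<in> measurable colourings borel"
  by (rule measurable_bits) (unfold decode_def, measurable)

text \<open>\<open>f\<close> factors through the initial segments of length \<open>n\<close>, a
  countable set on which every function is measurable.\<close>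

lemma measurable_finite_dependence:
  fixes f :: "bits \<Rightarrow> 'x"
  assumes "\<And>z z'. (\<And>i. i < n \<Longrightarrow> z i = z' i) \<Longrightarrow> f z = f z'"
  shows "f \<in> measurable borel (count_space UNIV)"
proof -
  have "(\<lambda>z :: bits. map z [0..<n]) \<in> measurable borel (count_space UNIV)"
  proof -
    have "{z \<in> space borel. map z [0..<n] = l} \<in> sets (borel :: bits measure)" for l
      unfolding list_eq_iff_nth_eq length_map by (simp cong: conj_cong) measurable
    then show ?thesis
      by (subst measurable_count_space_eq2_countable) (auto simp: vimage_def)
  qed
  then have "(\<lambda>z. f ((!) (map z [0..<n]))) \<in> measurable borel (count_space UNIV)"
    by (rule measurable_compose) simp
  moreover have "f ((!) (map z [0..<n])) = f z" for z by (rule assms) simp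
  ultimately show ?thesis by simp
qed

lemma admissible_cong:
  assumes "\<And>i. i < length s \<Longrightarrow> z i = z' i"
  shows "admissible F z s \<longleftrightarrow> admissible F z' s"
proof (cases s)
  case (Cons a t)
  have "alive F z (Suc (length t)) (\<lambda>i. rev (a # t) ! i) \<longleftrightarrow> alive F z' (Suc (length t)) (\<lambda>i. rev (a # t) ! i)"
    using assms Cons by (intro alive_cong) auto
  then show ?thesis using Cons by simp
qed simp

text \<open>The colour of a point depends on the names along its address, and these involve
  \<open>z\<close> only below the length of the address.\<close>

lemma measurable_tree_colouring:
  "(\<lambda>z. tree_colouring (admissible F z) x) \<in> measurable borel (count_space UNIV)"
proof (cases x)
  case (Point \<tau> e)
  show ?thesis
  proof (rule measurable_finite_dependence[where n = "length \<tau>"])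
    fix z z' :: bits assume z: "\<And>i. i < length \<tau> \<Longrightarrow> z i = z' i"
    have "path_names (admissible F z) \<tau> = path_names (admissible F z') \<tau>"
      using z
    proof (induction \<tau> rule: rev_induct)
      case (snoc q \<tau>)
      have p: "path_names (admissible F z) \<tau> = path_names (admissible F z') \<tau>" using snoc by simp
      have "admissible F z (a # path_names (admissible F z') \<tau>) \<longleftrightarrow> admissible F z' (a # path_names (admissible F z') \<tau>)" for a
        using snoc.prems by (intro admissible_cong) (simp add: length_path_names)
      then show ?case unfolding path_names_snoc p pick_def by simp
    qed (simp add: path_names_Nil)
    then have "letters (admissible F z) \<tau> = letters (admissible F z') \<tau>" by (simp add: letters_def)
    then show "tree_colouring (admissible F z) x = tree_colouring (admissible F z') x"
      by (simp only: Point tree_colouring.simps)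
  qed
qed

lemma meets_cuts_Collect:
  "meets_cuts {v. P v} {v. Q v} \<longleftrightarrow> (\<exists>v. P v) \<and>
     (\<forall>y. Q y \<longrightarrow> (\<exists>a. P a \<and> a < y) \<and> (\<exists>a. P a \<and> y < a)) \<and>
     (\<forall>y y'. Q y \<longrightarrow> Q y' \<longrightarrow> y < y' \<longrightarrow> (\<exists>a. P a \<and> y < a \<and> a < y'))"
  by (auto simp: meets_cuts_def Bex_def Ball_def)

lemma pred_shaped [measurable]:
  "Measurable.pred colourings (\<lambda>c. shaped c (admissible F (decode c)))"
proof -
  have [measurable]: "Measurable.pred borel (\<lambda>z. admissible F z s)" for s
    by (rule measurable_finite_dependence[OF admissible_cong])
  show ?thesis unfolding shaped_def meets_cuts_Collect by measurable
qed

text \<open>Since \<open>k\<close> is measurable on \<open>A\<close> only, the preimage is taken in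
  a restricted space whose carrier is itself measurable.\<close>

lemma sets_pullback:
  assumes D: "D \<in> sets ((N \<Otimes>\<^sub>M N) \<Otimes>\<^sub>M L)" and A: "A \<in> sets C"
    and k: "k \<in> measurable (restrict_space C A) N"
  shows "{x \<in> space ((C \<Otimes>\<^sub>M C) \<Otimes>\<^sub>M L). fst (fst x) \<in> A \<and> snd (fst x) \<in> A \<and>
    ((k (fst (fst x)), k (snd (fst x))), snd x) \<in> D} \<in> sets ((C \<Otimes>\<^sub>M C) \<Otimes>\<^sub>M L)"
proof -
  let ?P = "(C \<Otimes>\<^sub>M C) \<Otimes>\<^sub>M L"
  let ?\<Omega> = "{x \<in> space ?P. fst (fst x) \<in> A \<and> snd (fst x) \<in> A}"
  have \<Omega>: "?\<Omega> \<in> sets ?P" using A by measurable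
  have f: "p \<in> measurable (restrict_space ?P ?\<Omega>) (restrict_space C A)"
    if "p \<in> measurable ?P C" "\<And>x. x \<in> ?\<Omega> \<Longrightarrow> p x \<in> A" for p
    using that by (intro measurable_restrict_space2 measurable_restrict_space1) (auto simp: space_restrict_space)
  have "(\<lambda>x. fst (fst x)) \<in> measurable (restrict_space ?P ?\<Omega>) (restrict_space C A)"
    by (rule f) auto
  moreover have "(\<lambda>x. snd (fst x)) \<in> measurable (restrict_space ?P ?\<Omega>) (restrict_space C A)"
    by (rule f) auto
  moreover note f = calculation
  have "(\<lambda>x. ((k (fst (fst x)), k (snd (fst x))), snd x)) \<in> measurable (restrict_space ?P ?\<Omega>) ((N \<Otimes>\<^sub>M N) \<Otimes>\<^sub>M L)"
    by (intro measurable_Pair measurable_compose[OF f(1) k] measurable_compose[OF f(2) k] measurable_restrict_space1[OF measurable_snd])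
  from measurable_sets[OF this D]
  have "{x \<in> ?\<Omega>. ((k (fst (fst x)), k (snd (fst x))), snd x) \<in> D} \<in> sets (restrict_space ?P ?\<Omega>)"
    by (simp add: space_restrict_space vimage_def Int_def conj_ac)
  then show ?thesis using \<Omega> by (simp add: sets_restrict_space_iff conj_assoc)
qed

text \<open>One reduction colours the tree of the code of a point; the other decodes a colouring and
  applies \<open>k\<close>.\<close>

lemma reduction_exists:
  fixes N :: "'b measure"
  assumes S: "dop_le (=) \<subseteq> S" "S \<subseteq> dop_le (\<ge>)" and R: "analytic_quasi_order N R"
  shows "\<exists>B \<in> sets colourings. invariant_set dop_iso B \<and>
    borel_bireducible N R (restrict_space colourings B) (S \<inter> B \<times> B)"
proof -
  have "standard_borel N" and pre: "preorder_on (space N) R" and an: "analytic_in (N \<Otimes>\<^sub>M N) R"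
    using R by (auto simp: analytic_quasi_order_def)
  obtain e :: "'b \<Rightarrow> bits" and A k where e: "e \<in> measurable N borel" and A: "A \<in> sets borel"
    and k: "k \<in> measurable (restrict_space borel A) N" and ek: "\<And>x. x \<in> space N \<Longrightarrow> e x \<in> A \<and> k (e x) = x"
    and ke: "\<And>u. u \<in> A \<Longrightarrow> k u \<in> space N \<and> e (k u) = u"
    and antichain: "\<And>u v. u \<in> A \<Longrightarrow> v \<in> A \<Longrightarrow> (\<And>i. u i \<Longrightarrow> v i) \<Longrightarrow> u = v"
    using standard_borel_coding[OF \<open>standard_borel N\<close>] by blast
  obtain D where D: "D \<in> sets ((N \<Otimes>\<^sub>M N) \<Otimes>\<^sub>M (borel :: (nat \<Rightarrow> nat) measure))" "R = fst ` D"
    using an by (auto simp: analytic_in_def)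
  have DR: "(x, y) \<in> R \<longleftrightarrow> (\<exists>d. ((x, y), d) \<in> D)" for x y
    unfolding D(2) by force
  obtain F where F: "\<And>u v d. (\<And>n. approx F n u v d) \<Longrightarrow> F u v d"
    "\<And>u v. u \<in> A \<and> v \<in> A \<and> (\<exists>d. ((k u, k v), d) \<in> D) \<longleftrightarrow> (\<exists>d. F u v d)"
    using analytic_closed_condition[OF sets_pullback[OF D(1) A k]] by (simp add: space_pair_measure) blast
  define R' where "R' = {(u, v). u \<in> A \<and> v \<in> A \<and> (k u, k v) \<in> R}"
  have FR: "(u, v) \<in> R' \<longleftrightarrow> (\<exists>d. F u v d)" for u v
    using F(2)[of u v] by (simp add: R'_def DR)
  have pre': "preorder_on A R'"
    unfolding preorder_on_def
  proof (intro conjI)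
    show "R' \<subseteq> A \<times> A" by (auto simp: R'_def)
    show "refl_on A R'" using pre ke by (auto simp: refl_on_def R'_def preorder_on_def)
    show "trans R'" using pre unfolding trans_def R'_def preorder_on_def by blast
  qed
  obtain h :: "rat \<Rightarrow> point" where h: "bij h" "strict_mono h" using point_isomorphism by blast
  define H where "H x = tree_colouring (admissible F (e x)) \<circ> h" for x
  \<comment> \<open>The code is computed from the colouring instead of being quantified over, which
    keeps \<open>B\<close> Borel.\<close>
  define B where "B = {c. shaped c (admissible F (decode c)) \<and> decode c \<in> A}"
  have B: "B \<in> sets colourings"
  proof -
    have "{c \<in> space colourings. shaped c (admissible F (decode c)) \<and> decode c \<in> A} \<in> sets colourings"
      using A by measurable
    then show ?thesis by (simp add: B_def)
  qed
  \<comment> \<open>Here the bounds on \<open>S\<close> come in: reflection holds for the largest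
    relation, embedding for the smallest.\<close>
  have S_iff: "(c, c') \<in> S \<longleftrightarrow> (decode c, decode c') \<in> R'" if "c \<in> B" "c' \<in> B" for c c'
  proof
    assume "(c, c') \<in> S"
    then have "(c, c') \<in> dop_le (\<ge>)" using S(2) by blast
    then show "(decode c, decode c') \<in> R'"
      using coded_reflection[of c F "decode c" c' "decode c'" R' A, OF _ _ _ F(1) _ pre' _ _ antichain] that FR
      unfolding B_def by blast
  next
    assume "(decode c, decode c') \<in> R'"
    then obtain d where "F (decode c) (decode c') d" using FR by blast
    then have "(c, c') \<in> dop_le (=)" using coded_embedding[of c F "decode c" c' "decode c'"] that by (simp add: B_def)
    then show "(c, c') \<in> S" using S(1) by blast
  qed
  have H: "shaped (H x) (admissible F (e x))" for x
    unfolding H_def shaped_image[OF h] by (rule shaped_tree_colouring) simp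
  have dec_H: "decode (H x) = e x" for x by (rule decode_shaped[OF H])
  have HB: "H x \<in> B" if "x \<in> space N" for x using H ek[OF that] by (simp add: B_def dec_H)
  have "invariant_set dop_iso B"
    unfolding invariant_set_def
  proof (intro allI impI)
    fix c c' assume c: "c \<in> B" "(c, c') \<in> dop_iso"
    then obtain g where g: "bij g" "strict_mono g" "\<forall>q. c q = c' (g q)" by (auto simp: dop_iso_def)
    then have "c = c' \<circ> g" by auto
    \<comment> \<open>An isomorphic copy has the shape given by the same code and hence decodes to
      it.\<close>
    then have s: "shaped c' (admissible F (decode c))" using c(1) shaped_image[OF g(1,2), of c'] by (simp add: B_def)
    then have "decode c' = decode c" by (rule decode_shaped)
    then show "c' \<in> B" using s c(1) by (simp add: B_def)
  qed
  moreover have "borel_reducible N R (restrict_space colourings B) (S \<inter> B \<times> B)"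
    unfolding borel_reducible_def
  proof (intro bexI[of _ H] ballI)
    have "H \<in> measurable N colourings"
    proof (rule measurable_coordinatewise_then_product)
      fix q
      have "(\<lambda>x. H x q) \<in> measurable N (count_space UNIV)"
        unfolding H_def comp_def using measurable_compose[OF e measurable_tree_colouring] .
      then show "(\<lambda>x. H x q) \<in> borel_measurable N" unfolding measurable_borel_countable .
    qed
    then show "H \<in> measurable N (restrict_space colourings B)" using HB by (intro measurable_restrict_space2) auto
    fix x y assume "x \<in> space N" "y \<in> space N"
    then show "(x, y) \<in> R \<longleftrightarrow> (H x, H y) \<in> S \<inter> B \<times> B"
      using HB S_iff[of "H x" "H y"] ek by (simp add: dec_H R'_def)
  qed
  moreover have "borel_reducible (restrict_space colourings B) (S \<inter> B \<times> B) N R"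
    unfolding borel_reducible_def
  proof (intro bexI[of _ "\<lambda>c. k (decode c)"] ballI)
    have "decode \<in> measurable (restrict_space colourings B) (restrict_space borel A)"
      by (intro measurable_restrict_space2 measurable_restrict_space1 measurable_decode)
        (auto simp: space_restrict_space B_def)
    then show "(\<lambda>c. k (decode c)) \<in> measurable (restrict_space colourings B) N"
      using k by (rule measurable_compose)
    fix c c' assume "c \<in> space (restrict_space colourings B)" "c' \<in> space (restrict_space colourings B)"
    then have c: "c \<in> B" "c' \<in> B" by (auto simp: space_restrict_space)
    then show "(c, c') \<in> S \<inter> B \<times> B \<longleftrightarrow> (k (decode c), k (decode c')) \<in> R"
      using S_iff[OF c] by (simp add: R'_def B_def)
  qed
  ultimately show ?thesis using B unfolding borel_bireducible_def by blast
qed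

section \<open>Analyticity of the relations between colourings\<close>

lemma standard_borel_colourings: "standard_borel colourings"
proof -
  obtain \<B> :: "(rat \<Rightarrow> nat) set set" where \<B>: "countable \<B>" "topological_basis \<B>"
    using ex_countable_basis by blast
  have "second_countable (euclidean :: (rat \<Rightarrow> nat) topology)"
    unfolding second_countable_def
  proof (intro exI[of _ \<B>] conjI ballI allI impI)
    show "openin euclidean V" if "V \<in> \<B>" for V using topological_basis_open[OF \<B>(2) that] by simp
    show "\<exists>V\<in>\<B>. x \<in> V \<and> V \<subseteq> U" if "openin euclidean U \<and> x \<in> U" for U x
      using that topological_basisE[OF \<B>(2), of U x] by (metis open_openin)
  qed (rule \<B>(1))
  moreover have "completely_metrizable_space (euclidean :: (rat \<Rightarrow> nat) topology)"
  proof -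
    have "(euclidean :: nat topology) = discrete_topology UNIV"
      by (simp add: topology_eq open_discrete)
    then show ?thesis
      unfolding euclidean_product_topology[symmetric]
      by (simp add: completely_metrizable_space_product_topology completely_metrizable_space_discrete_topology)
  qed
  moreover have "sets colourings = sigma_sets (space colourings) {U. openin euclidean U}"
    by (simp add: borel_def)
  ultimately show ?thesis unfolding standard_borel_def by (intro exI[of _ euclidean]) simp
qed

text \<open>\<open>analytic_in\<close> projects along \<open>nat \<Rightarrow> nat\<close>, so maps
  of the rationals are coded there; every map has a code.\<close>

definition map_of_code :: "(nat \<Rightarrow> nat) \<Rightarrow> rat \<Rightarrow> rat" where
  "map_of_code \<gamma> q = from_nat (\<gamma> (to_nat q))"

lemma measurable_map_of_code [measurable]:
  "(\<lambda>\<gamma>. map_of_code \<gamma> q) \<in> measurable borel (count_space UNIV)"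
proof -
  have [measurable]: "(\<lambda>\<gamma> :: nat \<Rightarrow> nat. \<gamma> i) \<in> measurable borel (count_space UNIV)" for i
    unfolding measurable_borel_countable[symmetric] by measurable
  show ?thesis unfolding map_of_code_def by measurable
qed

lemma analytic_in_maps:
  assumes Q: "Measurable.pred (borel :: (nat \<Rightarrow> nat) measure) (\<lambda>\<gamma>. Q (map_of_code \<gamma>))"
  shows "analytic_in (colourings \<Otimes>\<^sub>M colourings) {(c, c'). \<exists>g. Q g \<and> (\<forall>q. P (c q) (c' (g q)))}"
proof -
  let ?M = "(colourings \<Otimes>\<^sub>M colourings) \<Otimes>\<^sub>M (borel :: (nat \<Rightarrow> nat) measure)"
  \<comment> \<open>Quantifying over the countably many values \<open>r\<close>, \<open>m\<close>,
    \<open>n\<close> replaces the evaluation of a colouring at a point that varies with the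
    code.\<close>
  define D where "D = {x \<in> space ?M. Q (map_of_code (snd x)) \<and>
    (\<forall>q. \<exists>r m n. map_of_code (snd x) q = r \<and> fst (fst x) q = m \<and> snd (fst x) r = n \<and> P m n)}"
  note Q[measurable]
  have "D \<in> sets ?M" unfolding D_def by measurable
  moreover have "{(c, c'). \<exists>g. Q g \<and> (\<forall>q. P (c q) (c' (g q)))} = fst ` D"
  proof (intro equalityI subsetI)
    fix x assume "x \<in> {(c, c'). \<exists>g. Q g \<and> (\<forall>q. P (c q) (c' (g q)))}"
    then obtain c c' g where x: "x = (c, c')" "Q g" "\<forall>q. P (c q) (c' (g q))" by auto
    have "map_of_code (\<lambda>i. to_nat (g (from_nat i))) = g" by (simp add: map_of_code_def fun_eq_iff)
    then have "((c, c'), \<lambda>i. to_nat (g (from_nat i))) \<in> D" using x by (simp add: D_def space_pair_measure)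
    then show "x \<in> fst ` D" using x(1) by force
  next
    fix x assume "x \<in> fst ` D"
    then show "x \<in> {(c, c'). \<exists>g. Q g \<and> (\<forall>q. P (c q) (c' (g q)))}" by (auto simp: D_def)
  qed
  ultimately show ?thesis unfolding analytic_in_def by blast
qed

lemma dense_order_preserving_id: "dense_order_preserving (\<lambda>q. q)"
proof -
  have "\<exists>q. r0 < q \<and> q < r1" if "r0 < r1" for r0 r1 :: rat using dense that by blast
  then show ?thesis by (auto simp: dense_order_preserving_def strict_mono_def)
qed

text \<open>Density of \<open>g\<close> gives two points \<open>s0 < s1\<close> between
  \<open>f q0\<close> and \<open>f q1\<close> whose images lie in the interval; density of
  \<open>f\<close> gives a value between them.\<close>

lemma dense_order_preserving_comp:
  assumes f: "dense_order_preserving f" and g: "dense_order_preserving g"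
  shows "dense_order_preserving (\<lambda>q. g (f q))"
  unfolding dense_order_preserving_def
proof (intro conjI allI impI)
  have mono: "strict_mono f" "strict_mono g" using f g by (auto simp: dense_order_preserving_def)
  then show "strict_mono (\<lambda>q. g (f q))" by (simp add: strict_mono_def)
  fix q0 q1 r0 r1 assume r: "g (f q0) < r0 \<and> r0 < r1 \<and> r1 < g (f q1)"
  then have r': "g (f q0) \<le> r0" "r0 < r1" "r1 \<le> g (f q1)" by auto
  obtain s0 where s0: "r0 < g s0" "g s0 < r1" "f q0 < s0" "s0 < f q1"
    by (rule dop_between[OF g r'])
  obtain s1 where s1: "g s0 < g s1" "g s1 < r1" "s0 < s1" "s1 < f q1"
    by (rule dop_between[OF g order_refl s0(2) r'(3)])
  obtain q where "s0 < f q" "f q < s1"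
    by (rule dop_between[OF f less_imp_le[OF s0(3)] s1(3) less_imp_le[OF s1(4)]])
  then have "g s0 < g (f q)" "g (f q) < g s1" using mono(2) by (auto simp: strict_mono_less)
  then show "\<exists>q. r0 < g (f q) \<and> g (f q) < r1" using s0 s1 by (intro exI[of _ q]) auto
qed

lemma analytic_quasi_order_dop_le:
  assumes "reflp P" "transp P"
  shows "analytic_quasi_order colourings (dop_le P)"
proof -
  have "Measurable.pred borel (\<lambda>\<gamma>. dense_order_preserving (map_of_code \<gamma>))"
    unfolding dense_order_preserving_def strict_mono_def by measurable
  from analytic_in_maps[OF this, of P] have "analytic_in (colourings \<Otimes>\<^sub>M colourings) (dop_le P)"
    by (simp add: dop_le_def)
  moreover have "preorder_on (space colourings) (dop_le P)"
    unfolding preorder_on_def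
  proof (intro conjI)
    show "refl_on (space colourings) (dop_le P)"
      using dense_order_preserving_id assms(1) by (auto simp: refl_on_def dop_le_def reflp_def)
    show "trans (dop_le P)"
    proof (rule transI)
      fix c1 c2 c3 assume "(c1, c2) \<in> dop_le P" "(c2, c3) \<in> dop_le P"
      then obtain f g where "dense_order_preserving f" "\<forall>q. P (c1 q) (c2 (f q))"
        "dense_order_preserving g" "\<forall>q. P (c2 q) (c3 (g q))" by (auto simp: dop_le_def)
      then show "(c1, c3) \<in> dop_le P"
        using dense_order_preserving_comp[of f g] assms(2) unfolding dop_le_def transp_def by blast
    qed
  qed simp
  ultimately show ?thesis using standard_borel_colourings by (simp add: analytic_quasi_order_def)
qed

lemma analytic_equivalence_dop_iso: "analytic_equivalence colourings dop_iso"
proof -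
  \<comment> \<open>For strictly increasing maps bijectivity amounts to surjectivity, a countable
    condition.\<close>
  have "Measurable.pred borel (\<lambda>\<gamma>. (\<forall>x y. x < y \<longrightarrow> map_of_code \<gamma> x < map_of_code \<gamma> y) \<and>
      (\<forall>y. \<exists>x. map_of_code \<gamma> x = y))" by measurable
  then have *: "Measurable.pred borel (\<lambda>\<gamma>. bij (map_of_code \<gamma>) \<and> strict_mono (map_of_code \<gamma>))"
  proof (rule measurable_cong[THEN iffD1, rotated])
    fix \<gamma> :: "nat \<Rightarrow> nat"
    show "(\<forall>x y. x < y \<longrightarrow> map_of_code \<gamma> x < map_of_code \<gamma> y) \<and> (\<forall>y. \<exists>x. map_of_code \<gamma> x = y) \<longleftrightarrow>
        bij (map_of_code \<gamma>) \<and> strict_mono (map_of_code \<gamma>)"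
      using strict_mono_imp_inj_on[of "map_of_code \<gamma>" UNIV] by (auto simp: strict_mono_def bij_def surj_def; metis)
  qed
  have "analytic_in (colourings \<Otimes>\<^sub>M colourings) dop_iso"
    using analytic_in_maps[OF *, of "(=)"] by (simp add: dop_iso_def conj_assoc)
  moreover have "equiv (space colourings) (dop_iso :: (rat \<Rightarrow> nat) rel)"
  proof (rule equivI)
    show "refl_on (space colourings) dop_iso"
      by (auto simp: refl_on_def dop_iso_def strict_mono_def intro!: exI[of _ id])
    show "sym (dop_iso :: (rat \<Rightarrow> nat) rel)"
    proof (rule symI)
      fix c c' :: "rat \<Rightarrow> nat" assume "(c, c') \<in> dop_iso"
      then obtain h where h: "bij h" "strict_mono h" "\<forall>q. c q = c' (h q)" by (auto simp: dop_iso_def)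
      have hi: "h (inv h q) = q" for q using h(1) by (simp add: bij_is_surj surj_f_inv_f)
      have "strict_mono (inv h)"
        by (rule strict_monoI) (use hi h(2) in \<open>metis strict_mono_less\<close>)
      then show "(c', c) \<in> dop_iso" using bij_imp_bij_inv[OF h(1)] h(3) hi unfolding dop_iso_def by auto
    qed
    show "trans (dop_iso :: (rat \<Rightarrow> nat) rel)"
    proof (rule transI)
      fix c1 c2 c3 :: "rat \<Rightarrow> nat" assume "(c1, c2) \<in> dop_iso" "(c2, c3) \<in> dop_iso"
      then obtain f g where "bij f" "strict_mono f" "\<forall>q. c1 q = c2 (f q)"
        "bij g" "strict_mono g" "\<forall>q. c2 q = c3 (g q)" by (auto simp: dop_iso_def)
      then show "(c1, c3) \<in> dop_iso"
        using bij_comp[of f g] unfolding dop_iso_def by (auto simp: strict_mono_def intro!: exI[of _ "g \<circ> f"])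
    qed
  qed simp
  ultimately show ?thesis using standard_borel_colourings by (simp add: analytic_equivalence_def)
qed

lemma dop_iso_subset: "dop_iso \<subseteq> dop_le (=)"
proof
  fix x :: "(rat \<Rightarrow> 'c) \<times> (rat \<Rightarrow> 'c)" assume "x \<in> dop_iso"
  then obtain c c' h where x: "x = (c, c')" "bij h" "strict_mono h" "\<forall>q. c q = c' (h q)"
    by (auto simp: dop_iso_def)
  have "dense_order_preserving h"
    unfolding dense_order_preserving_def
  proof (intro conjI allI impI)
    fix q0 q1 r0 r1 assume r: "h q0 < r0 \<and> r0 < r1 \<and> r1 < h q1"
    then obtain s where s: "r0 < s" "s < r1" using dense by blast
    obtain q where "s = h q" using x(2) by (auto simp: bij_def surj_def)
    then show "\<exists>q. r0 < h q \<and> h q < r1" using s by blast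
  qed (rule x(3))
  then show "x \<in> dop_le (=)" using x by (auto simp: dop_le_def)
qed

lemma invariantly_universal_between:
  assumes "analytic_quasi_order colourings S" "dop_le (=) \<subseteq> S" "S \<subseteq> dop_le (\<ge>)"
  shows "invariantly_universal TYPE('b) colourings S dop_iso"
proof -
  have "dop_iso \<subseteq> S" using dop_iso_subset assms(2) by blast
  moreover have "sym (dop_iso :: (rat \<Rightarrow> nat) rel)"
    using analytic_equivalence_dop_iso by (simp add: analytic_equivalence_def equiv_def)
  ultimately have "dop_iso \<subseteq> S \<inter> S\<inverse>" by (auto dest: symD)
  then show ?thesis
    unfolding invariantly_universal_def
    using assms(1) analytic_equivalence_dop_iso reduction_exists[OF assms(2,3)] by blast
qed

theorem theorem5p13:
  shows
    "(\<forall>S. analytic_quasi_order colourings S \<and> dop_le (=) \<subseteq> S \<and> S \<subseteq> dop_le (\<ge>) \<longrightarrow>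
        invariantly_universal TYPE('b) colourings S dop_iso) \<and>
     invariantly_universal TYPE('b) colourings (dop_le (=)) dop_iso \<and>
     invariantly_universal TYPE('b) colourings (dop_le (\<ge>)) dop_iso"
proof -
  have "dop_le (=) \<subseteq> dop_le ((\<ge>) :: nat \<Rightarrow> nat \<Rightarrow> bool)" by (auto simp: dop_le_def)
  moreover have "analytic_quasi_order colourings (dop_le (=))" "analytic_quasi_order colourings (dop_le (\<ge>))"
    by (auto intro!: analytic_quasi_order_dop_le reflpI transpI)
  ultimately show ?thesis using invariantly_universal_between by blast
qed

end
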